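(* Let $m\ge1$, let $F=F(V_m)=\mathbb{K}[v_1,\dots,v_m]$, and let $M$ be a $V_m$-module. The finite complex $C^f(M)=(M\otimes_{\mathbb{K}}[V]_n,\partial_n^{YB})_{0\le n\le m}$ is isomorphic to $(M\otimes_F\bigwedge^nF^m,\mathrm{id}_M\otimes d_n)_{0\le n\le m}$, where $(\bigwedge^nF^m,d_n)$ is the Koszul resolution of the one-dimensional left $F$-module $\mathbb{K}$. A chain isomorphism is given by the linear maps $$f_k:M\otimes_F\bigwedge^kF^m\to M\otimes_{\mathbb{K}}[V]_k,\qquad m\otimes(e_{i_1}\wedge\cdots\wedge e_{i_k})\mapsto\frac{1}{[k]_{y^2}!}\,m\otimes[v_{i_1},\dots,v_{i_k}]$$ for $1\le k\le m$, together with the canonical isomorphism $M\otimes_FF\simeq M$ in degree $0$.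
   Context: Let $\mathbb{K}=\mathbb{C}(y)$, and let $V=V_m$ be the $\mathbb{K}$-vector space with basis $v_1,\dots,v_m$; tensor products are over $\mathbb{K}$ unless indicated. The Yang-Baxter operator $R=R_m:V\otimes V\to V\otimes V$ is the linear map with $R(v_i\otimes v_j)=(1-y^2)v_i\otimes v_j+y^2v_j\otimes v_i$ and $R(v_j\otimes v_i)=v_i\otimes v_j$ for $1\le i<j\le m$, and $R(v_i\otimes v_i)=v_i\otimes v_i$. A $V_m$-module is a $\mathbb{K}$-vector space $M$ with a linear map $R_M:M\otimes V\to M$ satisfying the wall condition $R_M\circ(R_M\otimes\mathrm{id}_V)=R_M\circ(R_M\otimes\mathrm{id}_V)\circ(\mathrm{id}_M\otimes R)$. Such an $M$ is the same as a right module over $F=T(V)/(\mathrm{im}(\mathrm{id}_{V^{\otimes2}}-R))=\mathbb{K}[v_1,\dots,v_m]$, with $m\cdot v=R_M(m\otimes v)$. For $n\ge1$ let $d_1^n=\mathrm{id}_{V^{\otimes n}}$ and, for $2\le k\le n$, $d_k^n=(R\otimes\mathrm{id}_{V^{\otimes n-2}})\circ(\mathrm{id}_V\otimes R\otimes\mathrm{id}_{V^{\otimes n-3}})\circ\cdots\circ(\mathrm{id}_{V^{\otimes k-2}}\otimes R\otimes\mathrm{id}_{V^{\otimes n-k}})$ (the rightmost map is applied first). The one-term Yang-Baxter complex has terms $M\otimes V^{\otimes n}$ ($n\ge0$) and differential $\partial_n^{YB}=\sum_{i=1}^n(-1)^{i-1}(R_M\otimes\mathrm{id}_{V^{\otimes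 n-1}})\circ(\mathrm{id}_M\otimes d_i^n)$. For $n\ge 1$, $[V]_n\subset V^{\otimes n}$ is the span of all elements $[v_{i_1},\dots,v_{i_n}]=\sum_{\tau\in S_n}\mathrm{sgn}(\tau)\,v_{i_{\tau(1)}}\otimes\cdots\otimes v_{i_{\tau(n)}}$, with $\mathrm{sgn}(\tau)\in\{1,-1\}$ the sign of $\tau$; $[V]_0=\mathbb{K}$, and $[V]_n=0$ for $n>m$. The complex $C^f(M)$ is the subcomplex with terms $M\otimes[V]_n$, with $\partial_n^{YB}$ restricted to it. $F^m$ is the free $F$-module with basis $e_1,\dots,e_m$, and the Koszul differential $d_k:\bigwedge^kF^m\to\bigwedge^{k-1}F^m$ is $d_k(e_{i_1}\wedge\cdots\wedge e_{i_k})=\sum_{j=1}^k(-1)^{j+1}v_{i_j}\,e_{i_1}\wedge\cdots\wedge\hat e_{i_j}\wedge\cdots\wedge e_{i_k}$. Quantum integers: $[k]_{y^2}=1+y^2+\cdots+y^{2k-2}$ and $[k]_{y^2}!=[1]_{y^2}[2]_{y^2}\cdots[k]_{y^2}$. *)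

theory Defs
  imports
    "HOL-Computational_Algebra.Polynomial"
    "HOL-Computational_Algebra.Fraction_Field"
    "HOL-Library.Poly_Mapping"
    "HOL-Combinatorics.Permutations"
    "HOL-Algebra.Free_Abelian_Groups"
    "HOL-Algebra.Generated_Groups"
    "HOL-Algebra.Coset"
    "HOL-Algebra.Module"
begin

section \<open>Modules, tensor products and complexes\<close>

text \<open>
  All rings below are commutative, so left and right modules are identified; the right action
  \<open>m \<cdot> r\<close> is written \<open>r \<odot> m\<close>. A vector space is a module over a field. The multiplicative fields
  \<open>mult\<close> and \<open>one\<close> of the module records built here play no role.
\<close>

definition mod_hom ::
  "('r, 's) ring_scheme \<Rightarrow> ('r, 'a, 'p) module_scheme \<Rightarrow> ('r, 'b, 'q) module_scheme \<Rightarrow> ('a \<Rightarrow> 'b) set"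
  where "mod_hom R M N =
    {f. f \<in> carrier M \<rightarrow> carrier N
      \<and> (\<forall>x\<in>carrier M. \<forall>z\<in>carrier M. f (x \<oplus>\<^bsub>M\<^esub> z) = f x \<oplus>\<^bsub>N\<^esub> f z)
      \<and> (\<forall>r\<in>carrier R. \<forall>x\<in>carrier M. f (r \<odot>\<^bsub>M\<^esub> x) = r \<odot>\<^bsub>N\<^esub> f x)}"

definition mod_span ::
  "('r, 's) ring_scheme \<Rightarrow> ('r, 'a, 'p) module_scheme \<Rightarrow> 'a set \<Rightarrow> 'a set"
  where "mod_span R M S = \<Inter>{H. submodule H R M \<and> S \<subseteq> H}"

text \<open>The free \<open>R\<close>-module with basis \<open>B\<close>: finitely supported functions on \<open>B\<close>, extended by zero.\<close>

definition free_module :: "('r, 's) ring_scheme \<Rightarrow> 'b set \<Rightarrow> ('r, 'b \<Rightarrow> 'r) module"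
  where "free_module R B =
    \<lparr>carrier = {f. (\<forall>b. f b \<in> carrier R) \<and> finite {b. f b \<noteq> \<zero>\<^bsub>R\<^esub>} \<and> {b. f b \<noteq> \<zero>\<^bsub>R\<^esub>} \<subseteq> B},
     monoid.mult = undefined, one = undefined,
     ring.zero = (\<lambda>b. \<zero>\<^bsub>R\<^esub>),
     ring.add = (\<lambda>f g b. f b \<oplus>\<^bsub>R\<^esub> g b),
     module.smult = (\<lambda>r f b. r \<otimes>\<^bsub>R\<^esub> f b)\<rparr>"

definition basis_vec :: "('r, 's) ring_scheme \<Rightarrow> 'b \<Rightarrow> ('b \<Rightarrow> 'r)"
  where "basis_vec R b = (\<lambda>c. if c = b then \<one>\<^bsub>R\<^esub> else \<zero>\<^bsub>R\<^esub>)"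

text \<open>The linear map from a free module to \<open>N\<close> with the values \<open>g\<close> on the basis.\<close>

definition lin_ext ::
  "('r, 's) ring_scheme \<Rightarrow> ('r, 'a, 'p) module_scheme \<Rightarrow> ('b \<Rightarrow> 'a) \<Rightarrow> ('b \<Rightarrow> 'r) \<Rightarrow> 'a"
  where "lin_ext R N g f = (\<Oplus>\<^bsub>N\<^esub>b\<in>{b. f b \<noteq> \<zero>\<^bsub>R\<^esub>}. f b \<odot>\<^bsub>N\<^esub> g b)"

text \<open>
  The tensor product \<open>M \<otimes>\<^sub>R N\<close>: the free abelian group on \<open>M \<times> N\<close> modulo the subgroup generated by
  the biadditivity and balancing relations.
\<close>

definition tensor_rels ::
  "('r, 's) ring_scheme \<Rightarrow> ('r, 'a, 'p) module_scheme \<Rightarrow> ('r, 'b, 'q) module_scheme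
     \<Rightarrow> ('a \<times> 'b \<Rightarrow>\<^sub>0 int) set"
  where "tensor_rels R M N =
    {frag_of (x \<oplus>\<^bsub>M\<^esub> x', z) - frag_of (x, z) - frag_of (x', z) | x x' z.
       x \<in> carrier M \<and> x' \<in> carrier M \<and> z \<in> carrier N}
    \<union> {frag_of (x, z \<oplus>\<^bsub>N\<^esub> z') - frag_of (x, z) - frag_of (x, z') | x z z'.
       x \<in> carrier M \<and> z \<in> carrier N \<and> z' \<in> carrier N}
    \<union> {frag_of (r \<odot>\<^bsub>M\<^esub> x, z) - frag_of (x, r \<odot>\<^bsub>N\<^esub> z) | r x z.
       r \<in> carrier R \<and> x \<in> carrier M \<and> z \<in> carrier N}"

definition tensor_ker ::
  "('r, 's) ring_scheme \<Rightarrow> ('r, 'a, 'p) module_scheme \<Rightarrow> ('r, 'b, 'q) module_scheme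
     \<Rightarrow> ('a \<times> 'b \<Rightarrow>\<^sub>0 int) set"
  where "tensor_ker R M N =
    generate (free_Abelian_group (carrier M \<times> carrier N)) (tensor_rels R M N)"

text \<open>
  Scalars act through the first factor. In \<open>smult\<close> all cosets in the union coincide.
\<close>

definition tensor ::
  "('r, 's) ring_scheme \<Rightarrow> ('r, 'a, 'p) module_scheme \<Rightarrow> ('r, 'b, 'q) module_scheme
     \<Rightarrow> ('r, ('a \<times> 'b \<Rightarrow>\<^sub>0 int) set) module"
  where "tensor R M N =
    (let A = free_Abelian_group (carrier M \<times> carrier N); Q = A Mod tensor_ker R M N in
     \<lparr>carrier = carrier Q,
      monoid.mult = undefined, one = undefined,
      ring.zero = \<one>\<^bsub>Q\<^esub>,
      ring.add = (\<lambda>X Y. X \<otimes>\<^bsub>Q\<^esub> Y),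
      module.smult = (\<lambda>r X. \<Union>a\<in>X. tensor_ker R M N #>\<^bsub>A\<^esub>
                 frag_extend (\<lambda>(x, z). frag_of (r \<odot>\<^bsub>M\<^esub> x, z)) a)\<rparr>)"

definition tens ::
  "('r, 's) ring_scheme \<Rightarrow> ('r, 'a, 'p) module_scheme \<Rightarrow> ('r, 'b, 'q) module_scheme
     \<Rightarrow> 'a \<Rightarrow> 'b \<Rightarrow> ('a \<times> 'b \<Rightarrow>\<^sub>0 int) set"
  where "tens R M N x z =
    tensor_ker R M N #>\<^bsub>free_Abelian_group (carrier M \<times> carrier N)\<^esub> frag_of (x, z)"

text \<open>
  The map out of a tensor product induced by a balanced biadditive map \<open>\<beta>\<close> into \<open>P\<close>: the sum
  \<open>\<Sum> k\<^sub>i (x\<^sub>i, z\<^sub>i)\<close> representing a tensor goes to \<open>\<Sum> k\<^sub>i \<beta> x\<^sub>i z\<^sub>i\<close>, for any choice of representative.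
\<close>

definition tensor_lift ::
  "('r, 'c, 'p) module_scheme \<Rightarrow> ('a \<Rightarrow> 'b \<Rightarrow> 'c) \<Rightarrow> ('a \<times> 'b \<Rightarrow>\<^sub>0 int) set \<Rightarrow> 'c"
  where "tensor_lift P \<beta> X =
    the_elem ((\<lambda>a. \<Oplus>\<^bsub>P\<^esub>q\<in>Poly_Mapping.keys a. [Poly_Mapping.lookup a q] \<cdot>\<^bsub>P\<^esub> \<beta> (fst q) (snd q)) ` X)"

text \<open>The map \<open>id\<^sub>M \<otimes> g\<close>, where \<open>g\<close> takes values in \<open>N'\<close>.\<close>

definition id_tensor ::
  "('r, 's) ring_scheme \<Rightarrow> ('r, 'a, 'p) module_scheme \<Rightarrow> ('r, 'c, 'q) module_scheme
     \<Rightarrow> ('b \<Rightarrow> 'c) \<Rightarrow> ('a \<times> 'b \<Rightarrow>\<^sub>0 int) set \<Rightarrow> ('a \<times> 'c \<Rightarrow>\<^sub>0 int) set"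
  where "id_tensor R M N' g = tensor_lift (tensor R M N') (\<lambda>x z. tens R M N' x (g z))"

definition restrict_scalars ::
  "('k \<Rightarrow> 'r) \<Rightarrow> ('r, 'a, 'p) module_scheme \<Rightarrow> ('k, 'a) module"
  where "restrict_scalars \<phi> M =
    \<lparr>carrier = carrier M, monoid.mult = monoid.mult M, one = monoid.one M, ring.zero = ring.zero M,
     ring.add = ring.add M, module.smult = (\<lambda>c x. \<phi> c \<odot>\<^bsub>M\<^esub> x)\<rparr>"

text \<open>Complexes with terms in the degrees \<open>0, \<dots>, m\<close>; \<open>d n\<close> maps degree \<open>n\<close> to degree \<open>n - 1\<close>.\<close>

definition chain_complex ::
  "('r, 's) ring_scheme \<Rightarrow> nat \<Rightarrow> (nat \<Rightarrow> ('r, 'a) module) \<Rightarrow> (nat \<Rightarrow> 'a \<Rightarrow> 'a) \<Rightarrow> bool"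
  where "chain_complex R m C d \<longleftrightarrow>
    (\<forall>n\<le>m. Module.module R (C n))
    \<and> (\<forall>n\<in>{1..m}. d n \<in> mod_hom R (C n) (C (n - 1)))
    \<and> (\<forall>n\<in>{2..m}. \<forall>x\<in>carrier (C n). d (n - 1) (d n x) = \<zero>\<^bsub>C (n - 2)\<^esub>)"

definition chain_iso ::
  "('r, 's) ring_scheme \<Rightarrow> nat \<Rightarrow> (nat \<Rightarrow> ('r, 'a) module) \<Rightarrow> (nat \<Rightarrow> 'a \<Rightarrow> 'a)
     \<Rightarrow> (nat \<Rightarrow> ('r, 'b) module) \<Rightarrow> (nat \<Rightarrow> 'b \<Rightarrow> 'b) \<Rightarrow> (nat \<Rightarrow> 'a \<Rightarrow> 'b) \<Rightarrow> bool"
  where "chain_iso R m C d C' d' f \<longleftrightarrow>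
    (\<forall>n\<le>m. f n \<in> mod_hom R (C n) (C' n) \<and> bij_betw (f n) (carrier (C n)) (carrier (C' n)))
    \<and> (\<forall>n\<in>{1..m}. \<forall>x\<in>carrier (C n). f (n - 1) (d n x) = d' n (f n x))"

text \<open>Exactness of \<open>0 \<rightarrow> P\<^sub>m \<rightarrow> \<dots> \<rightarrow> P\<^sub>0 \<rightarrow> N \<rightarrow> 0\<close>, the last map being \<open>\<epsilon>\<close>, for \<open>m \<ge> 1\<close>.\<close>

definition resolution ::
  "('r, 's) ring_scheme \<Rightarrow> nat \<Rightarrow> (nat \<Rightarrow> ('r, 'a) module) \<Rightarrow> (nat \<Rightarrow> 'a \<Rightarrow> 'a)
     \<Rightarrow> ('r, 'b) module \<Rightarrow> ('a \<Rightarrow> 'b) \<Rightarrow> bool"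
  where "resolution R m P d N \<epsilon> \<longleftrightarrow>
    chain_complex R m P d
    \<and> Module.module R N \<and> \<epsilon> \<in> mod_hom R (P 0) N
    \<and> \<epsilon> ` carrier (P 0) = carrier N
    \<and> {x \<in> carrier (P 0). \<epsilon> x = \<zero>\<^bsub>N\<^esub>} = d 1 ` carrier (P 1)
    \<and> (\<forall>n\<in>{1..<m}. {x \<in> carrier (P n). d n x = \<zero>\<^bsub>P (n - 1)\<^esub>} = d (n + 1) ` carrier (P (n + 1)))
    \<and> {x \<in> carrier (P m). d m x = \<zero>\<^bsub>P (m - 1)\<^esub>} = {\<zero>\<^bsub>P m\<^esub>}"


section \<open>The Yang-Baxter operator\<close>

type_synonym ratfun = "complex poly fract"

definition yvar :: ratfun
  where "yvar = Fract [:0, 1:] 1"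

definition type_ring :: "'a::comm_ring_1 set \<Rightarrow> 'a ring"
  where "type_ring A = \<lparr>carrier = A, monoid.mult = (*), one = 1, ring.zero = 0, ring.add = (+)\<rparr>"

abbreviation KK :: "ratfun ring"
  where "KK \<equiv> type_ring UNIV"

text \<open>
  \<open>Vpow m n\<close> is the \<open>n\<close>-th tensor power of \<open>V\<^sub>m\<close>, with the words \<open>[i\<^sub>1, \<dots>, i\<^sub>n]\<close> standing for the basis
  vectors \<open>v\<^sub>i\<^sub>1 \<otimes> \<dots> \<otimes> v\<^sub>i\<^sub>n\<close>; the tensor product of basis vectors is concatenation. In particular
  \<open>Vpow m 1\<close> is \<open>V\<^sub>m\<close> and \<open>Vpow m 0\<close> is \<open>K\<close>.
\<close>

definition words :: "nat \<Rightarrow> nat \<Rightarrow> nat list set"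
  where "words m n = {w. length w = n \<and> set w \<subseteq> {1..m}}"

abbreviation Vpow :: "nat \<Rightarrow> nat \<Rightarrow> (ratfun, nat list \<Rightarrow> ratfun) module"
  where "Vpow m n \<equiv> free_module KK (words m n)"

abbreviation vtens :: "nat list \<Rightarrow> (nat list \<Rightarrow> ratfun)"
  where "vtens w \<equiv> basis_vec KK w"

definition YB_basis :: "nat \<Rightarrow> nat \<Rightarrow> (nat list \<Rightarrow> ratfun)"
  where "YB_basis i j =
    (if i < j then (\<lambda>u. (1 - yvar^2) * vtens [i, j] u + yvar^2 * vtens [j, i] u)
     else vtens [j, i])"

definition YB :: "nat \<Rightarrow> (nat list \<Rightarrow> ratfun) \<Rightarrow> (nat list \<Rightarrow> ratfun)"
  where "YB m = lin_ext KK (Vpow m 2) (\<lambda>w. YB_basis (w ! 0) (w ! 1))"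

text \<open>\<open>YB_at m p q\<close> is \<open>id \<otimes> R \<otimes> id\<close> with \<open>p\<close> identity factors on the left and \<open>q\<close> on the right.\<close>

definition YB_at :: "nat \<Rightarrow> nat \<Rightarrow> nat \<Rightarrow> (nat list \<Rightarrow> ratfun) \<Rightarrow> (nat list \<Rightarrow> ratfun)"
  where "YB_at m p q = lin_ext KK (Vpow m (p + 2 + q))
    (\<lambda>w. lin_ext KK (Vpow m (p + 2 + q))
           (\<lambda>u. vtens (take p w @ u @ drop (p + 2) w))
           (YB m (vtens (take 2 (drop p w)))))"

text \<open>
  \<open>YB_d m n k\<close> is \<open>d\<^sub>k\<^sup>n\<close>: the composition of the \<open>YB_at m p (n - 2 - p)\<close> for \<open>p = 0, \<dots>, k - 2\<close>, where
  the largest \<open>p\<close> is applied first.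
\<close>

definition YB_d :: "nat \<Rightarrow> nat \<Rightarrow> nat \<Rightarrow> (nat list \<Rightarrow> ratfun) \<Rightarrow> (nat list \<Rightarrow> ratfun)"
  where "YB_d m n k = foldr (\<lambda>p g. YB_at m p (n - 2 - p) \<circ> g) [0..<k - 1] id"


section \<open>Modules over the Yang-Baxter operator and the one-term complex\<close>

abbreviation MV ::
  "nat \<Rightarrow> (ratfun, 'a) module \<Rightarrow> nat \<Rightarrow> (ratfun, ('a \<times> (nat list \<Rightarrow> ratfun) \<Rightarrow>\<^sub>0 int) set) module"
  where "MV m M n \<equiv> tensor KK M (Vpow m n)"

abbreviation MVtens ::
  "nat \<Rightarrow> (ratfun, 'a) module \<Rightarrow> nat \<Rightarrow> 'a \<Rightarrow> (nat list \<Rightarrow> ratfun)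
     \<Rightarrow> ('a \<times> (nat list \<Rightarrow> ratfun) \<Rightarrow>\<^sub>0 int) set"
  where "MVtens m M n \<equiv> tens KK M (Vpow m n)"

text \<open>\<open>R\<^sub>M \<otimes> id\<close> on \<open>M \<otimes> V\<^sup>n = (M \<otimes> V) \<otimes> V\<^sup>n\<^sup>-\<^sup>1\<close>, for \<open>n \<ge> 1\<close>.\<close>

definition RM_id ::
  "nat \<Rightarrow> (ratfun, 'a) module \<Rightarrow> (('a \<times> (nat list \<Rightarrow> ratfun) \<Rightarrow>\<^sub>0 int) set \<Rightarrow> 'a) \<Rightarrow> nat
     \<Rightarrow> ('a \<times> (nat list \<Rightarrow> ratfun) \<Rightarrow>\<^sub>0 int) set \<Rightarrow> ('a \<times> (nat list \<Rightarrow> ratfun) \<Rightarrow>\<^sub>0 int) set"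
  where "RM_id m M RM n = tensor_lift (MV m M (n - 1))
    (\<lambda>x. lin_ext KK (MV m M (n - 1))
       (\<lambda>w. MVtens m M (n - 1) (RM (MVtens m M 1 x (vtens [hd w]))) (vtens (tl w))))"

text \<open>The last conjunct is the wall condition.\<close>

definition V_module ::
  "nat \<Rightarrow> (ratfun, 'a) module \<Rightarrow> (('a \<times> (nat list \<Rightarrow> ratfun) \<Rightarrow>\<^sub>0 int) set \<Rightarrow> 'a) \<Rightarrow> bool"
  where "V_module m M RM \<longleftrightarrow>
    Module.module KK M \<and> RM \<in> mod_hom KK (MV m M 1) M
    \<and> (\<forall>X\<in>carrier (MV m M 2).
         RM (RM_id m M RM 2 X) = RM (RM_id m M RM 2 (id_tensor KK M (Vpow m 2) (YB m) X)))"

definition YB_diff ::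
  "nat \<Rightarrow> (ratfun, 'a) module \<Rightarrow> (('a \<times> (nat list \<Rightarrow> ratfun) \<Rightarrow>\<^sub>0 int) set \<Rightarrow> 'a) \<Rightarrow> nat
     \<Rightarrow> ('a \<times> (nat list \<Rightarrow> ratfun) \<Rightarrow>\<^sub>0 int) set \<Rightarrow> ('a \<times> (nat list \<Rightarrow> ratfun) \<Rightarrow>\<^sub>0 int) set"
  where "YB_diff m M RM n X =
    (\<Oplus>\<^bsub>MV m M (n - 1)\<^esub>i\<in>{1..n}. (-1) ^ (i - 1) \<odot>\<^bsub>MV m M (n - 1)\<^esub>
       RM_id m M RM n (id_tensor KK M (Vpow m n) (YB_d m n i) X))"

text \<open>The antisymmetrized tensor \<open>[v\<^sub>i\<^sub>1, \<dots>, v\<^sub>i\<^sub>n]\<close>.\<close>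

definition vbracket :: "nat list \<Rightarrow> (nat list \<Rightarrow> ratfun)"
  where "vbracket w = (\<lambda>u. \<Sum>\<tau> | \<tau> permutes {..<length w}.
    of_int (sign \<tau>) * vtens (permute_list \<tau> w) u)"

text \<open>The span of all brackets is \<open>0\<close> for \<open>n > m\<close>, and is \<open>Vpow m 0\<close>, i.e. \<open>K\<close>, for \<open>n = 0\<close>.\<close>

definition Vbr :: "nat \<Rightarrow> nat \<Rightarrow> (nat list \<Rightarrow> ratfun) set"
  where "Vbr m n = mod_span KK (Vpow m n) (vbracket ` words m n)"

text \<open>\<open>M \<otimes> [V]\<^sub>n\<close> as a subspace of \<open>M \<otimes> V\<^sup>n\<close>.\<close>

definition Cf ::
  "nat \<Rightarrow> (ratfun, 'a) module \<Rightarrow> nat \<Rightarrow> (ratfun, ('a \<times> (nat list \<Rightarrow> ratfun) \<Rightarrow>\<^sub>0 int) set) module"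
  where "Cf m M n = (MV m M n)
    \<lparr>carrier := mod_span KK (MV m M n) {MVtens m M n x u | x u. x \<in> carrier M \<and> u \<in> Vbr m n}\<rparr>"


section \<open>The polynomial ring and the Koszul complex\<close>

text \<open>
  \<open>FF m\<close> is \<open>K[v\<^sub>1, \<dots>, v\<^sub>m]\<close>: polynomials map exponent vectors to coefficients, and the variables
  are restricted to \<open>v\<^sub>1, \<dots>, v\<^sub>m\<close>.
\<close>

type_synonym mpol = "(nat \<Rightarrow>\<^sub>0 nat) \<Rightarrow>\<^sub>0 ratfun"

definition FF :: "nat \<Rightarrow> mpol ring"
  where "FF m = type_ring {p. \<forall>a\<in>Poly_Mapping.keys p. Poly_Mapping.keys a \<subseteq> {1..m}}"

definition pconst :: "ratfun \<Rightarrow> mpol"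
  where "pconst c = Poly_Mapping.single 0 c"

definition pvar :: "nat \<Rightarrow> mpol"
  where "pvar i = Poly_Mapping.single (Poly_Mapping.single i 1) 1"

text \<open>
  The \<open>F\<close>-module given by a \<open>V\<^sub>m\<close>-module: \<open>v\<^sub>i\<close> acts as \<open>x \<mapsto> R\<^sub>M (x \<otimes> v\<^sub>i)\<close>. These operators commute
  by the wall condition, so the order in which a monomial applies them is immaterial.
\<close>

definition mono_act ::
  "nat \<Rightarrow> (ratfun, 'a) module \<Rightarrow> (('a \<times> (nat list \<Rightarrow> ratfun) \<Rightarrow>\<^sub>0 int) set \<Rightarrow> 'a)
     \<Rightarrow> (nat \<Rightarrow>\<^sub>0 nat) \<Rightarrow> 'a \<Rightarrow> 'a"
  where "mono_act m M RM a =
    foldr (\<lambda>i g. ((\<lambda>x. RM (MVtens m M 1 x (vtens [i]))) ^^ Poly_Mapping.lookup a i) \<circ> g) [1..<Suc m] id"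

definition F_module ::
  "nat \<Rightarrow> (ratfun, 'a) module \<Rightarrow> (('a \<times> (nat list \<Rightarrow> ratfun) \<Rightarrow>\<^sub>0 int) set \<Rightarrow> 'a)
     \<Rightarrow> (mpol, 'a) module"
  where "F_module m M RM =
    \<lparr>carrier = carrier M, monoid.mult = monoid.mult M, one = monoid.one M, ring.zero = ring.zero M,
     ring.add = ring.add M,
     module.smult = (\<lambda>p x. \<Oplus>\<^bsub>M\<^esub>a\<in>Poly_Mapping.keys p.
                Poly_Mapping.lookup p a \<odot>\<^bsub>M\<^esub> mono_act m M RM a x)\<rparr>"

text \<open>
  The exterior power \<open>\<Lambda>\<^sup>k F\<^sup>m\<close> is the free module on the \<open>k\<close>-subsets of \<open>{1, \<dots>, m}\<close>, where
  \<open>{i\<^sub>1 < \<dots> < i\<^sub>k}\<close> stands for \<open>e\<^sub>i\<^sub>1 \<and> \<dots> \<and> e\<^sub>i\<^sub>k\<close>. For an arbitrary sequence of indices, \<open>ewedge\<close> gives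
  the alternating product: the sign is the parity of the number of inversions.
\<close>

definition ext_pow :: "nat \<Rightarrow> nat \<Rightarrow> (mpol, nat set \<Rightarrow> mpol) module"
  where "ext_pow m k = free_module (FF m) {S. S \<subseteq> {1..m} \<and> card S = k}"

definition ewedge :: "nat list \<Rightarrow> (nat set \<Rightarrow> mpol)"
  where "ewedge w = (\<lambda>S. if distinct w \<and> S = set w
    then (-1) ^ card {(a, b). a < b \<and> b < length w \<and> w ! b < w ! a} else 0)"

text \<open>Positions are counted from \<open>0\<close> here, whence the sign \<open>(-1)\<^sup>j\<close>.\<close>

definition koszul_basis :: "nat list \<Rightarrow> (nat set \<Rightarrow> mpol)"
  where "koszul_basis w = (\<lambda>T. \<Sum>j<length w.
    (-1) ^ j * pvar (w ! j) * ewedge (take j w @ drop (Suc j) w) T)"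

definition koszul_d :: "nat \<Rightarrow> nat \<Rightarrow> (nat set \<Rightarrow> mpol) \<Rightarrow> (nat set \<Rightarrow> mpol)"
  where "koszul_d m k =
    lin_ext (FF m) (ext_pow m (k - 1)) (\<lambda>S. koszul_basis (sorted_list_of_set S))"

text \<open>
  The one-dimensional \<open>F\<close>-module \<open>K\<close>, on which every \<open>v\<^sub>i\<close> acts by \<open>0\<close>, and the augmentation
  \<open>\<Lambda>\<^sup>0 F\<^sup>m = F \<rightarrow> K\<close>, which takes the constant coefficient.
\<close>

definition K_module :: "(mpol, ratfun) module"
  where "K_module = \<lparr>carrier = UNIV, monoid.mult = (*), one = 1, ring.zero = 0, ring.add = (+),
    module.smult = (\<lambda>p c. Poly_Mapping.lookup p 0 * c)\<rparr>"

definition augmentation :: "(nat set \<Rightarrow> mpol) \<Rightarrow> ratfun"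
  where "augmentation f = Poly_Mapping.lookup (f {}) 0"

abbreviation Ktens ::
  "nat \<Rightarrow> (ratfun, 'a) module \<Rightarrow> (('a \<times> (nat list \<Rightarrow> ratfun) \<Rightarrow>\<^sub>0 int) set \<Rightarrow> 'a) \<Rightarrow> nat
     \<Rightarrow> 'a \<Rightarrow> (nat set \<Rightarrow> mpol) \<Rightarrow> ('a \<times> (nat set \<Rightarrow> mpol) \<Rightarrow>\<^sub>0 int) set"
  where "Ktens m M RM n \<equiv> tens (FF m) (F_module m M RM) (ext_pow m n)"

text \<open>\<open>M \<otimes>\<^sub>F \<Lambda>\<^sup>n F\<^sup>m\<close> as a vector space over \<open>K\<close>.\<close>

definition koszul_tensor ::
  "nat \<Rightarrow> (ratfun, 'a) module \<Rightarrow> (('a \<times> (nat list \<Rightarrow> ratfun) \<Rightarrow>\<^sub>0 int) set \<Rightarrow> 'a) \<Rightarrow> nat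
     \<Rightarrow> (ratfun, ('a \<times> (nat set \<Rightarrow> mpol) \<Rightarrow>\<^sub>0 int) set) module"
  where "koszul_tensor m M RM n =
    restrict_scalars pconst (tensor (FF m) (F_module m M RM) (ext_pow m n))"

definition koszul_tensor_d ::
  "nat \<Rightarrow> (ratfun, 'a) module \<Rightarrow> (('a \<times> (nat list \<Rightarrow> ratfun) \<Rightarrow>\<^sub>0 int) set \<Rightarrow> 'a) \<Rightarrow> nat
     \<Rightarrow> ('a \<times> (nat set \<Rightarrow> mpol) \<Rightarrow>\<^sub>0 int) set \<Rightarrow> ('a \<times> (nat set \<Rightarrow> mpol) \<Rightarrow>\<^sub>0 int) set"
  where "koszul_tensor_d m M RM n =
    id_tensor (FF m) (F_module m M RM) (ext_pow m (n - 1)) (koszul_d m n)"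

definition qint :: "nat \<Rightarrow> ratfun"
  where "qint k = (\<Sum>j<k. (yvar^2) ^ j)"

definition qfact :: "nat \<Rightarrow> ratfun"
  where "qfact k = (\<Prod>j=1..k. qint j)"

end

theory Submission
  imports Defs "Jordan_Normal_Form.Determinant"
begin

text \<open>
  On an antisymmetrized tensor \<open>[v\<^sub>i\<^sub>1, \<dots>, v\<^sub>i\<^sub>n]\<close> every \<open>id \<otimes> R \<otimes> id\<close> is multiplication by \<open>-y\<^sup>2\<close>, so
  \<open>(-1)\<^sup>k\<^sup>-\<^sup>1 d\<^sub>k\<^sup>n\<close> multiplies it by \<open>y\<^sup>2\<^sup>(\<^sup>k\<^sup>-\<^sup>1\<^sup>)\<close> and the alternating sum over \<open>k\<close> by \<open>[n]\<close>. What is left of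
  the differential is \<open>R\<^sub>M \<otimes> id\<close>, and the Laplace expansion of the antisymmetrized tensor along its first factor
  turns this into the Koszul differential; the factor \<open>[n]\<close> is absorbed by the normalization
  \<open>1 / [k]!\<close>. The words \<open>[v\<^sub>i\<^sub>1, \<dots>, v\<^sub>i\<^sub>k]\<close> with \<open>i\<^sub>1 < \<dots> < i\<^sub>k\<close> have disjoint supports and span \<open>[V]\<^sub>k\<close>, which
  gives bijectivity. Exactness of the Koszul complex comes from a monomial contracting homotopy, which
  needs no division.
\<close>

subsection \<open>Additive and balanced maps\<close>

text \<open>For i < j the operator R multiplies v_i (x) v_j - v_j (x) v_i by -y^2, because (1 - y^2)
  - 1 = -y^2; an antisymmetrized tensor consists of such differences at every adjacent pair of
  places. The obstacle is that the two complexes live over different rings: the source is a tensor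
  product over F, while M (x) [V]_k has only a K-structure. The comparison map can therefore not be
  obtained as an F-linear map. Lifting is done for balanced maps into mere abelian groups, the
  polynomial coefficients act on M before anything is sent to the target, and K-linearity is checked
  afterwards. Identities between additive maps are then tested on x (x) b with b a basis element.
  That the Yang-Baxter differential preserves C^f and squares to zero there is transported from the
  Koszul side along the bijection. The wall condition enters once, in the commutation of the
  operators v_i. The field enters twice: [k] is nonzero since it takes the value 1 at y = 0, and
  characteristic different from 2 turns antisymmetry into vanishing.\<close>

definition additive_map ::
  "('a, 'p) ring_scheme \<Rightarrow> ('b, 'q) ring_scheme \<Rightarrow> ('a \<Rightarrow> 'b) \<Rightarrow> bool"
  where "additive_map M N f \<longleftrightarrow> f \<in> carrier M \<rightarrow> carrier N
    \<and> (\<forall>x\<in>carrier M. \<forall>z\<in>carrier M. f (x \<oplus>\<^bsub>M\<^esub> z) = f x \<oplus>\<^bsub>N\<^esub> f z)"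

lemma additive_mapI:
  assumes "\<And>x. x \<in> carrier M \<Longrightarrow> f x \<in> carrier N"
    and "\<And>x z. x \<in> carrier M \<Longrightarrow> z \<in> carrier M \<Longrightarrow> f (x \<oplus>\<^bsub>M\<^esub> z) = f x \<oplus>\<^bsub>N\<^esub> f z"
  shows "additive_map M N f"
  using assms by (auto simp: additive_map_def)

lemma additive_map_closed: "additive_map M N f \<Longrightarrow> x \<in> carrier M \<Longrightarrow> f x \<in> carrier N"
  by (auto simp: additive_map_def)

lemma additive_map_add:
  "additive_map M N f \<Longrightarrow> x \<in> carrier M \<Longrightarrow> z \<in> carrier M \<Longrightarrow> f (x \<oplus>\<^bsub>M\<^esub> z) = f x \<oplus>\<^bsub>N\<^esub> f z"
  by (auto simp: additive_map_def)

lemma additive_map_zero: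
  assumes "abelian_group M" "abelian_group N" "additive_map M N f"
  shows "f \<zero>\<^bsub>M\<^esub> = \<zero>\<^bsub>N\<^esub>"
proof -
  interpret M: abelian_group M by fact
  interpret N: abelian_group N by fact
  have c: "f \<zero>\<^bsub>M\<^esub> \<in> carrier N" using additive_map_closed[OF assms(3)] by simp
  have "f \<zero>\<^bsub>M\<^esub> \<oplus>\<^bsub>N\<^esub> f \<zero>\<^bsub>M\<^esub> = f \<zero>\<^bsub>M\<^esub>"
    using additive_map_add[OF assms(3), of "\<zero>\<^bsub>M\<^esub>" "\<zero>\<^bsub>M\<^esub>"] by simp
  then show ?thesis using c by (metis N.add.l_cancel_one')
qed

lemma additive_map_minus:
  assumes "abelian_group M" "abelian_group N" "additive_map M N f" "x \<in> carrier M"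
  shows "f (\<ominus>\<^bsub>M\<^esub> x) = \<ominus>\<^bsub>N\<^esub> f x"
proof -
  interpret M: abelian_group M by fact
  interpret N: abelian_group N by fact
  have "f (\<ominus>\<^bsub>M\<^esub> x) \<oplus>\<^bsub>N\<^esub> f x = \<zero>\<^bsub>N\<^esub>"
    using additive_map_add[OF assms(3), of "\<ominus>\<^bsub>M\<^esub> x" x] assms(4)
      additive_map_zero[OF assms(1-3)] by (simp add: M.l_neg)
  then show ?thesis
    using additive_map_closed[OF assms(3)] assms(4)
    by (metis M.a_inv_closed N.minus_equality)
qed

lemma additive_map_finsum:
  assumes "abelian_group M" "abelian_group N" "additive_map M N f"
    and "finite I" "\<And>i. i \<in> I \<Longrightarrow> g i \<in> carrier M"
  shows "f (finsum M g I) = finsum N (\<lambda>i. f (g i)) I"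
proof -
  interpret M: abelian_group M by fact
  interpret N: abelian_group N by fact
  show ?thesis
    using assms(4,5)
  proof (induction I rule: finite_induct)
    case empty
    then show ?case using additive_map_zero[OF assms(1-3)] by simp
  next
    case (insert i I)
    then show ?case
      using additive_map_add[OF assms(3)] additive_map_closed[OF assms(3)]
      by (simp add: Pi_def)
  qed
qed

lemma mod_hom_additive: "f \<in> mod_hom R M N \<Longrightarrow> additive_map M N f"
  by (auto simp: mod_hom_def additive_map_def)

lemma mod_hom_smult:
  "f \<in> mod_hom R M N \<Longrightarrow> r \<in> carrier R \<Longrightarrow> x \<in> carrier M \<Longrightarrow> f (r \<odot>\<^bsub>M\<^esub> x) = r \<odot>\<^bsub>N\<^esub> f x"
  by (auto simp: mod_hom_def)

lemma mod_homI:
  assumes "additive_map M N f"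
    and "\<And>r x. r \<in> carrier R \<Longrightarrow> x \<in> carrier M \<Longrightarrow> f (r \<odot>\<^bsub>M\<^esub> x) = r \<odot>\<^bsub>N\<^esub> f x"
  shows "f \<in> mod_hom R M N"
  using assms by (auto simp: mod_hom_def additive_map_def)

lemma additive_map_comp:
  "additive_map M N f \<Longrightarrow> additive_map N P g \<Longrightarrow> additive_map M P (\<lambda>x. g (f x))"
  by (auto simp: additive_map_def Pi_def)

lemma additive_map_plus:
  assumes "abelian_group N" "additive_map M N f" "additive_map M N g"
  shows "additive_map M N (\<lambda>x. f x \<oplus>\<^bsub>N\<^esub> g x)"
proof -
  interpret N: abelian_group N by fact
  show ?thesis
    using assms(2,3) by (auto simp: additive_map_def Pi_def N.a_ac)
qed

lemma additive_map_smult: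
  "Module.module R M \<Longrightarrow> r \<in> carrier R \<Longrightarrow> additive_map M M (\<lambda>x. r \<odot>\<^bsub>M\<^esub> x)"
  by (auto simp: additive_map_def module.smult_closed module.smult_r_distr)

lemma additive_map_finsum_fun:
  assumes "abelian_group N" "finite I" "\<And>i. i \<in> I \<Longrightarrow> additive_map M N (\<lambda>x. f x i)"
  shows "additive_map M N (\<lambda>x. \<Oplus>\<^bsub>N\<^esub>i\<in>I. f x i)"
proof -
  interpret N: abelian_group N by fact
  show ?thesis
  proof (rule additive_mapI)
    fix x assume x: "x \<in> carrier M"
    then show "(\<Oplus>\<^bsub>N\<^esub>i\<in>I. f x i) \<in> carrier N"
      using additive_map_closed[OF assms(3)] by (intro N.finsum_closed) auto
    fix z assume z: "z \<in> carrier M"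
    have "(\<Oplus>\<^bsub>N\<^esub>i\<in>I. f (x \<oplus>\<^bsub>M\<^esub> z) i) = (\<Oplus>\<^bsub>N\<^esub>i\<in>I. f x i \<oplus>\<^bsub>N\<^esub> f z i)"
      using additive_map_closed[OF assms(3)] additive_map_add[OF assms(3)] x z
      by (intro N.finsum_cong') auto
    also have "\<dots> = (\<Oplus>\<^bsub>N\<^esub>i\<in>I. f x i) \<oplus>\<^bsub>N\<^esub> (\<Oplus>\<^bsub>N\<^esub>i\<in>I. f z i)"
      using additive_map_closed[OF assms(3)] x z by (intro N.finsum_addf) auto
    finally show "(\<Oplus>\<^bsub>N\<^esub>i\<in>I. f (x \<oplus>\<^bsub>M\<^esub> z) i) = (\<Oplus>\<^bsub>N\<^esub>i\<in>I. f x i) \<oplus>\<^bsub>N\<^esub> (\<Oplus>\<^bsub>N\<^esub>i\<in>I. f z i)" .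
  qed
qed

lemma module_abelian_group: "Module.module R M \<Longrightarrow> abelian_group M"
  by (simp add: module_def)

text \<open>The target is only an additive group, since the main instance goes from a tensor product
  over \<open>FF m\<close> to a space on which \<open>FF m\<close> does not act.\<close>

definition balanced_map ::
  "('r, 's) ring_scheme \<Rightarrow> ('r, 'a, 'p) module_scheme \<Rightarrow> ('r, 'b, 'q) module_scheme
     \<Rightarrow> ('c, 't) ring_scheme \<Rightarrow> ('a \<Rightarrow> 'b \<Rightarrow> 'c) \<Rightarrow> bool"
  where "balanced_map R M N P \<beta> \<longleftrightarrow>
    (\<forall>z\<in>carrier N. additive_map M P (\<lambda>x. \<beta> x z))
    \<and> (\<forall>x\<in>carrier M. additive_map N P (\<beta> x))
    \<and> (\<forall>r\<in>carrier R. \<forall>x\<in>carrier M. \<forall>z\<in>carrier N. \<beta> (r \<odot>\<^bsub>M\<^esub> x) z = \<beta> x (r \<odot>\<^bsub>N\<^esub> z))"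

lemma balanced_mapI:
  assumes "\<And>z. z \<in> carrier N \<Longrightarrow> additive_map M P (\<lambda>x. \<beta> x z)"
    and "\<And>x. x \<in> carrier M \<Longrightarrow> additive_map N P (\<beta> x)"
    and "\<And>r x z. r \<in> carrier R \<Longrightarrow> x \<in> carrier M \<Longrightarrow> z \<in> carrier N
      \<Longrightarrow> \<beta> (r \<odot>\<^bsub>M\<^esub> x) z = \<beta> x (r \<odot>\<^bsub>N\<^esub> z)"
  shows "balanced_map R M N P \<beta>"
  using assms by (auto simp: balanced_map_def)

lemma balanced_map_closed:
  "balanced_map R M N P \<beta> \<Longrightarrow> x \<in> carrier M \<Longrightarrow> z \<in> carrier N \<Longrightarrow> \<beta> x z \<in> carrier P"
  by (auto simp: balanced_map_def additive_map_def)

text \<open>This is the value that \<open>tensor_lift\<close> attaches to one chosen representative;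
  \<open>tensor_lift\<close> extracts the common value over a whole coset.\<close>

definition frag_sum ::
  "('c, 't) ring_scheme \<Rightarrow> ('a \<Rightarrow> 'b \<Rightarrow> 'c) \<Rightarrow> ('a \<times> 'b \<Rightarrow>\<^sub>0 int) \<Rightarrow> 'c"
  where "frag_sum P \<beta> a =
    (\<Oplus>\<^bsub>P\<^esub>q\<in>Poly_Mapping.keys a. [Poly_Mapping.lookup a q] \<cdot>\<^bsub>P\<^esub> \<beta> (fst q) (snd q))"

context abelian_group
begin

text \<open>Keys of a sum may cancel, so additivity needs one index set that serves several formal
  sums at once. The set \<open>S\<close> holds the pairs on which \<open>\<beta>\<close> is known to
  be well-behaved.\<close>

lemma frag_sum_superset:
  assumes "\<And>x z. (x, z) \<in> S \<Longrightarrow> \<beta> x z \<in> carrier G"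
    and "finite U" "Poly_Mapping.keys a \<subseteq> U" "U \<subseteq> S"
  shows "frag_sum G \<beta> a = (\<Oplus>\<^bsub>G\<^esub>q\<in>U. [Poly_Mapping.lookup a q] \<cdot>\<^bsub>G\<^esub> \<beta> (fst q) (snd q))"
proof -
  have c: "[k] \<cdot>\<^bsub>G\<^esub> \<beta> (fst q) (snd q) \<in> carrier G" if "q \<in> S" for q and k :: int
    using add.int_pow_closed assms(1)[of "fst q" "snd q"] that by simp
  show ?thesis
    unfolding frag_sum_def
  proof (rule add.finprod_mono_neutral_cong_left)
    show "[Poly_Mapping.lookup a q] \<cdot>\<^bsub>G\<^esub> \<beta> (fst q) (snd q) = \<zero>"
      if "q \<in> U - Poly_Mapping.keys a" for q
      using that by (simp add: in_keys_iff add_pow_def int_pow_def nat_pow_def)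
  qed (use assms c in auto)
qed

lemma frag_sum_closed:
  assumes "\<And>x z. (x, z) \<in> S \<Longrightarrow> \<beta> x z \<in> carrier G" "Poly_Mapping.keys a \<subseteq> S"
  shows "frag_sum G \<beta> a \<in> carrier G"
  unfolding frag_sum_def
proof (rule finsum_closed, rule Pi_I)
  fix q assume "q \<in> Poly_Mapping.keys a"
  then show "[Poly_Mapping.lookup a q] \<cdot> \<beta> (fst q) (snd q) \<in> carrier G"
    using add.int_pow_closed assms(1)[of "fst q" "snd q"] assms(2) by auto
qed

lemma frag_sum_add:
  assumes "\<And>x z. (x, z) \<in> S \<Longrightarrow> \<beta> x z \<in> carrier G"
    and "Poly_Mapping.keys a \<subseteq> S" "Poly_Mapping.keys b \<subseteq> S"
  shows "frag_sum G \<beta> (a + b) = frag_sum G \<beta> a \<oplus> frag_sum G \<beta> b"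
proof -
  let ?U = "Poly_Mapping.keys a \<union> Poly_Mapping.keys b"
  have c: "\<beta> (fst q) (snd q) \<in> carrier G" if "q \<in> ?U" for q
    using assms(1)[of "fst q" "snd q"] assms(2,3) that by auto
  have U: "finite ?U" "?U \<subseteq> S" "Poly_Mapping.keys (a + b) \<subseteq> ?U"
    using assms(2,3) Poly_Mapping.keys_add[of a b] by auto
  have "frag_sum G \<beta> (a + b) = (\<Oplus>q\<in>?U. [Poly_Mapping.lookup (a + b) q] \<cdot> \<beta> (fst q) (snd q))"
    using frag_sum_superset[of S \<beta> ?U] assms(1) U by blast
  also have "\<dots> = (\<Oplus>q\<in>?U. [Poly_Mapping.lookup a q] \<cdot> \<beta> (fst q) (snd q)
      \<oplus> [Poly_Mapping.lookup b q] \<cdot> \<beta> (fst q) (snd q))"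
    using c add.int_pow_closed
    by (intro finsum_cong') (auto simp: lookup_add add.int_pow_mult)
  also have "\<dots> = (\<Oplus>q\<in>?U. [Poly_Mapping.lookup a q] \<cdot> \<beta> (fst q) (snd q))
      \<oplus> (\<Oplus>q\<in>?U. [Poly_Mapping.lookup b q] \<cdot> \<beta> (fst q) (snd q))"
    using c add.int_pow_closed by (intro finsum_addf) auto
  also have "\<dots> = frag_sum G \<beta> a \<oplus> frag_sum G \<beta> b"
    using frag_sum_superset[of S \<beta> ?U a] frag_sum_superset[of S \<beta> ?U b] assms(1) U by auto
  finally show ?thesis .
qed

lemma frag_sum_frag_of:
  "\<beta> x z \<in> carrier G \<Longrightarrow> frag_sum G \<beta> (frag_of (x, z)) = \<beta> x z"
  by (simp add: frag_sum_def keys_frag_of add.int_pow_1)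

lemma frag_sum_diff:
  assumes "\<And>x z. (x, z) \<in> S \<Longrightarrow> \<beta> x z \<in> carrier G"
    and "Poly_Mapping.keys a \<subseteq> S" "Poly_Mapping.keys b \<subseteq> S"
  shows "frag_sum G \<beta> (a - b) = frag_sum G \<beta> a \<ominus> frag_sum G \<beta> b"
proof -
  have k: "Poly_Mapping.keys (a - b) \<subseteq> S"
    using keys_diff[of a b] assms(2,3) by auto
  have "frag_sum G \<beta> a = frag_sum G \<beta> (a - b) \<oplus> frag_sum G \<beta> b"
    using frag_sum_add[of S \<beta> "a - b" b] assms k by simp
  then show ?thesis
    using frag_sum_closed[of S \<beta>] assms k
    by (simp add: minus_eq a_assoc r_neg)
qed

end

subsection \<open>Tensor products\<close>

locale tensor_pair = M: Module.module R M + N: Module.module R N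
  for R :: "('r, 's) ring_scheme" and M :: "('r, 'a, 'p) module_scheme"
    and N :: "('r, 'b, 'q) module_scheme"
begin

abbreviation "A \<equiv> free_Abelian_group (carrier M \<times> carrier N)"
abbreviation "K \<equiv> tensor_ker R M N"
abbreviation "T \<equiv> tensor R M N"
abbreviation "cls a \<equiv> K #>\<^bsub>A\<^esub> a"

lemma frag_of_carrier: "x \<in> carrier M \<Longrightarrow> z \<in> carrier N \<Longrightarrow> frag_of (x, z) \<in> carrier A"
  by (simp add: keys_frag_of)

lemma diff_carrier: "a \<in> carrier A \<Longrightarrow> b \<in> carrier A \<Longrightarrow> a - b \<in> carrier A"
  using keys_diff[of a b] by auto

lemma tensor_rels_subset: "tensor_rels R M N \<subseteq> carrier A"
  unfolding tensor_rels_def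
  by (auto intro!: diff_carrier frag_of_carrier simp del: carrier_free_Abelian_group_iff)

sublocale A: comm_group A
  by (rule abelian_free_Abelian_group)

lemma subgroup_ker: "subgroup K A"
  unfolding tensor_ker_def by (rule A.generate_is_subgroup[OF tensor_rels_subset])

sublocale K: normal K A
  by (rule A.subgroup_imp_normal[OF subgroup_ker])

lemma tensor_rels_in_ker: "a \<in> tensor_rels R M N \<Longrightarrow> a \<in> K"
  unfolding tensor_ker_def by (rule generate.incl)

text \<open>The way to prove a property of all of \<open>K\<close>: show that it defines a subgroup
  and check it on the three kinds of relations.\<close>

lemma ker_minimal:
  assumes "subgroup H A" "tensor_rels R M N \<subseteq> H"
  shows "K \<subseteq> H"
  unfolding tensor_ker_def using A.generate_subgroup_incl[OF assms(2,1)] .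

lemma cls_eqI:
  assumes "a \<in> carrier A" "b \<in> carrier A" "a - b \<in> K"
  shows "cls a = cls b"
proof -
  have "a \<in> cls b"
    using K.rcos_module_rev[OF A.is_group, of b a] assms by simp
  then show ?thesis
    using A.repr_independence[OF _ _ subgroup_ker] assms by blast
qed

lemma cls_add: "a \<in> carrier A \<Longrightarrow> b \<in> carrier A \<Longrightarrow> cls a <#>\<^bsub>A\<^esub> cls b = cls (a + b)"
  using K.rcos_sum[of a b] by simp

lemma carrier_tensor: "carrier T = (\<lambda>a. cls a) ` carrier A"
  by (simp add: tensor_def Let_def carrier_FactGroup)

lemma add_tensor: "X \<oplus>\<^bsub>T\<^esub> Y = X <#>\<^bsub>A\<^esub> Y"
  by (simp add: tensor_def Let_def)

lemma zero_tensor: "\<zero>\<^bsub>T\<^esub> = cls 0"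
  using A.coset_mult_one[of K] K.subset by (simp add: tensor_def Let_def)

lemma tens_cls: "tens R M N x z = cls (frag_of (x, z))"
  by (simp add: tens_def)

lemma abelian_group_tensor: "abelian_group T"
proof -
  interpret Q: comm_group "A Mod K"
    using A.abelian_FactGroup[OF subgroup_ker] .
  have c: "carrier T = carrier (A Mod K)" "\<zero>\<^bsub>T\<^esub> = \<one>\<^bsub>A Mod K\<^esub>"
    and a: "X \<oplus>\<^bsub>T\<^esub> Y = X \<otimes>\<^bsub>A Mod K\<^esub> Y" for X Y
    by (simp_all add: tensor_def Let_def)
  show ?thesis
    by (rule abelian_groupI)
      (use Q.m_assoc Q.m_comm Q.l_inv_ex in \<open>auto simp: c a simp del: one_FactGroup mult_FactGroup\<close>)
qed

sublocale T: abelian_group T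
  by (rule abelian_group_tensor)

lemma cls_closed: "a \<in> carrier A \<Longrightarrow> cls a \<in> carrier T"
  by (auto simp: carrier_tensor)

lemma add_carrier: "a \<in> carrier A \<Longrightarrow> b \<in> carrier A \<Longrightarrow> a + b \<in> carrier A"
  using A.m_closed[of a b] by simp

lemma cls_diff:
  assumes "a \<in> carrier A" "b \<in> carrier A"
  shows "cls (a - b) = cls a \<ominus>\<^bsub>T\<^esub> cls b"
proof -
  have "cls (a - b) \<oplus>\<^bsub>T\<^esub> cls b = cls a"
    unfolding add_tensor using cls_add[of "a - b" b] diff_carrier[OF assms] assms by simp
  then show ?thesis
    using cls_closed diff_carrier[OF assms] assms
    by (metis T.a_inv_closed T.a_assoc T.minus_eq T.r_neg T.r_zero)
qed

lemma tens_closed: "x \<in> carrier M \<Longrightarrow> z \<in> carrier N \<Longrightarrow> tens R M N x z \<in> carrier T"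
  unfolding tens_cls by (intro cls_closed frag_of_carrier)

lemma rels_in_ker:
  shows "x \<in> carrier M \<Longrightarrow> x' \<in> carrier M \<Longrightarrow> z \<in> carrier N \<Longrightarrow>
      frag_of (x \<oplus>\<^bsub>M\<^esub> x', z) - frag_of (x, z) - frag_of (x', z) \<in> K"
    and "x \<in> carrier M \<Longrightarrow> z \<in> carrier N \<Longrightarrow> z' \<in> carrier N \<Longrightarrow>
      frag_of (x, z \<oplus>\<^bsub>N\<^esub> z') - frag_of (x, z) - frag_of (x, z') \<in> K"
    and "r \<in> carrier R \<Longrightarrow> x \<in> carrier M \<Longrightarrow> z \<in> carrier N \<Longrightarrow>
      frag_of (r \<odot>\<^bsub>M\<^esub> x, z) - frag_of (x, r \<odot>\<^bsub>N\<^esub> z) \<in> K"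
  by (intro tensor_rels_in_ker, unfold tensor_rels_def, blast)+

lemma tens_add_left:
  assumes "x \<in> carrier M" "x' \<in> carrier M" "z \<in> carrier N"
  shows "tens R M N (x \<oplus>\<^bsub>M\<^esub> x') z = tens R M N x z \<oplus>\<^bsub>T\<^esub> tens R M N x' z"
  using rels_in_ker(1)[OF assms] assms frag_of_carrier
  unfolding tens_cls add_tensor diff_diff_eq
  by (simp only: cls_add) (intro cls_eqI add_carrier frag_of_carrier M.a_closed)

lemma tens_add_right:
  assumes "x \<in> carrier M" "z \<in> carrier N" "z' \<in> carrier N"
  shows "tens R M N x (z \<oplus>\<^bsub>N\<^esub> z') = tens R M N x z \<oplus>\<^bsub>T\<^esub> tens R M N x z'"
  using rels_in_ker(2)[OF assms] assms frag_of_carrier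
  unfolding tens_cls add_tensor diff_diff_eq
  by (simp only: cls_add) (intro cls_eqI add_carrier frag_of_carrier N.a_closed)

lemma tens_smult:
  assumes "r \<in> carrier R" "x \<in> carrier M" "z \<in> carrier N"
  shows "tens R M N (r \<odot>\<^bsub>M\<^esub> x) z = tens R M N x (r \<odot>\<^bsub>N\<^esub> z)"
  using rels_in_ker(3)[OF assms] assms unfolding tens_cls
  by (intro cls_eqI frag_of_carrier M.smult_closed N.smult_closed)

text \<open>Every tensor is the class of a formal integer combination of pairs, and the free abelian
  group is generated by pairs under subtraction. No scalar case occurs, as scalars are absorbed by
  the first factor.\<close>

lemma tensor_induct [consumes 1, case_names zero tens diff]:
  assumes "X \<in> carrier T"
    and "P \<zero>\<^bsub>T\<^esub>"
    and "\<And>x z. x \<in> carrier M \<Longrightarrow> z \<in> carrier N \<Longrightarrow> P (tens R M N x z)"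
    and "\<And>X Y. X \<in> carrier T \<Longrightarrow> Y \<in> carrier T \<Longrightarrow> P X \<Longrightarrow> P Y \<Longrightarrow> P (X \<ominus>\<^bsub>T\<^esub> Y)"
  shows "P X"
proof -
  obtain a where a: "Poly_Mapping.keys a \<subseteq> carrier M \<times> carrier N" "X = cls a"
    using assms(1) by (auto simp: carrier_tensor)
  have "P (cls a)"
    using a(1)
  proof (rule free_Abelian_group_induct)
    show "P (cls 0)" using assms(2) by (simp add: zero_tensor)
    show "P (cls (frag_of q))" if "q \<in> carrier M \<times> carrier N" for q
      using assms(3)[of "fst q" "snd q"] that by (auto simp: tens_cls)
    show "P (cls (x - y))"
      if "Poly_Mapping.keys x \<subseteq> carrier M \<times> carrier N" "Poly_Mapping.keys y \<subseteq> carrier M \<times> carrier N"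
        "P (cls x)" "P (cls y)" for x y
      using assms(4)[of "cls x" "cls y"] cls_diff[of x y] cls_closed that by simp
  qed
  then show ?thesis using a by simp
qed

text \<open>Pure tensors generate the tensor product as an additive group, so equality on them
  suffices even for maps that are not linear over \<open>R\<close>.\<close>

lemma additive_map_eqI:
  assumes "abelian_group P" "additive_map T P f" "additive_map T P g"
    and "\<And>x z. x \<in> carrier M \<Longrightarrow> z \<in> carrier N \<Longrightarrow> f (tens R M N x z) = g (tens R M N x z)"
    and "X \<in> carrier T"
  shows "f X = g X"
  using assms(5)
proof (induction rule: tensor_induct)
  case zero
  show ?case
    using additive_map_zero[OF T.abelian_group_axioms assms(1,2)]
      additive_map_zero[OF T.abelian_group_axioms assms(1,3)] by simp
next
  case (tens x z)
  then show ?case using assms(4) by simp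
next
  case (diff X Y)
  then show ?case
    using additive_map_add[OF assms(2)] additive_map_add[OF assms(3)]
      additive_map_minus[OF T.abelian_group_axioms assms(1,2)]
      additive_map_minus[OF T.abelian_group_axioms assms(1,3)]
    by (simp add: T.minus_eq)
qed

text \<open>The formal sums killed by \<open>\<beta>\<close> form a subgroup, and each defining
  property of a balanced map puts one kind of relation into it.\<close>

lemma frag_sum_ker:
  assumes P: "abelian_group P" and \<beta>: "balanced_map R M N P \<beta>" and "a \<in> K"
  shows "frag_sum P \<beta> a = \<zero>\<^bsub>P\<^esub>"
proof -
  interpret P: abelian_group P by fact
  let ?S = "carrier M \<times> carrier N"
  note c = balanced_map_closed[OF \<beta>]
  have c': "\<And>x z. (x, z) \<in> ?S \<Longrightarrow> \<beta> x z \<in> carrier P" using c by auto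
  let ?H = "{a \<in> carrier A. frag_sum P \<beta> a = \<zero>\<^bsub>P\<^esub>}"
  have z: "frag_sum P \<beta> 0 = \<zero>\<^bsub>P\<^esub>" by (simp add: frag_sum_def)
  have d: "frag_sum P \<beta> (a - b) = frag_sum P \<beta> a \<ominus>\<^bsub>P\<^esub> frag_sum P \<beta> b"
    if "a \<in> carrier A" "b \<in> carrier A" for a b
    using P.frag_sum_diff[of ?S \<beta> a b, OF c'] that by simp
  have H: "subgroup ?H A"
  proof (rule A.subgroupI)
    show "?H \<noteq> {}" using z by force
    show "inv\<^bsub>A\<^esub> a \<in> ?H" if "a \<in> ?H" for a
      using d[of 0 a] z that by (simp add: P.minus_eq)
    show "a \<otimes>\<^bsub>A\<^esub> b \<in> ?H" if "a \<in> ?H" "b \<in> ?H" for a b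
      using P.frag_sum_add[of ?S \<beta> a b, OF c'] add_carrier[of a b] that by simp
  qed auto
  have f: "frag_sum P \<beta> (frag_of (x, z)) = \<beta> x z" if "x \<in> carrier M" "z \<in> carrier N" for x z
    by (rule P.frag_sum_frag_of[where \<beta> = \<beta>, OF c[OF that]])
  have a3: "(u \<oplus>\<^bsub>P\<^esub> v) \<ominus>\<^bsub>P\<^esub> u \<ominus>\<^bsub>P\<^esub> v = \<zero>\<^bsub>P\<^esub>" if "u \<in> carrier P" "v \<in> carrier P" for u v
  proof -
    have "(u \<oplus>\<^bsub>P\<^esub> v) \<ominus>\<^bsub>P\<^esub> u \<ominus>\<^bsub>P\<^esub> v = (u \<oplus>\<^bsub>P\<^esub> v) \<oplus>\<^bsub>P\<^esub> \<ominus>\<^bsub>P\<^esub> (u \<oplus>\<^bsub>P\<^esub> v)"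
      using that by (simp add: P.minus_eq P.minus_add P.a_assoc)
    then show ?thesis using that P.r_neg by simp
  qed
  note simps = d diff_carrier frag_of_carrier f
  have l: "frag_sum P \<beta> (frag_of (x \<oplus>\<^bsub>M\<^esub> x', z) - frag_of (x, z) - frag_of (x', z)) = \<zero>\<^bsub>P\<^esub>"
    if "x \<in> carrier M" "x' \<in> carrier M" "z \<in> carrier N" for x x' z
  proof -
    have "\<beta> (x \<oplus>\<^bsub>M\<^esub> x') z = \<beta> x z \<oplus>\<^bsub>P\<^esub> \<beta> x' z"
      using \<beta> that by (simp add: balanced_map_def additive_map_def)
    then show ?thesis
      using a3[of "\<beta> x z" "\<beta> x' z"] c that by (simp add: simps del: carrier_free_Abelian_group_iff)
  qed
  have r: "frag_sum P \<beta> (frag_of (x, z \<oplus>\<^bsub>N\<^esub> z') - frag_of (x, z) - frag_of (x, z')) = \<zero>\<^bsub>P\<^esub>"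
    if "x \<in> carrier M" "z \<in> carrier N" "z' \<in> carrier N" for x z z'
  proof -
    have "\<beta> x (z \<oplus>\<^bsub>N\<^esub> z') = \<beta> x z \<oplus>\<^bsub>P\<^esub> \<beta> x z'"
      using \<beta> that by (simp add: balanced_map_def additive_map_def)
    then show ?thesis
      using a3[of "\<beta> x z" "\<beta> x z'"] c that by (simp add: simps del: carrier_free_Abelian_group_iff)
  qed
  have b: "frag_sum P \<beta> (frag_of (r \<odot>\<^bsub>M\<^esub> x, z) - frag_of (x, r \<odot>\<^bsub>N\<^esub> z)) = \<zero>\<^bsub>P\<^esub>"
    if "r \<in> carrier R" "x \<in> carrier M" "z \<in> carrier N" for r x z
  proof -
    have "\<beta> (r \<odot>\<^bsub>M\<^esub> x) z = \<beta> x (r \<odot>\<^bsub>N\<^esub> z)"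
      using \<beta> that by (simp add: balanced_map_def)
    then show ?thesis
      using c[of x "r \<odot>\<^bsub>N\<^esub> z"] that
      by (simp add: simps P.minus_eq P.r_neg del: carrier_free_Abelian_group_iff)
  qed
  have "tensor_rels R M N \<subseteq> {a. frag_sum P \<beta> a = \<zero>\<^bsub>P\<^esub>}"
    unfolding tensor_rels_def using l r b by (intro Un_least subsetI) (elim CollectE exE conjE, simp)+
  then have "tensor_rels R M N \<subseteq> ?H"
    using tensor_rels_subset by blast
  then show ?thesis using ker_minimal[OF H] \<open>a \<in> K\<close> by blast
qed

text \<open>Two representatives differ by an element of \<open>K\<close>, on which the sum vanishes.
  As the coset contains \<open>a\<close>, the image is exactly one point and \<open>the_elem\<close>
  returns it.\<close>

lemma tensor_lift_cls:
  assumes P: "abelian_group P" and \<beta>: "balanced_map R M N P \<beta>" and a: "a \<in> carrier A"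
  shows "tensor_lift P \<beta> (cls a) = frag_sum P \<beta> a"
proof -
  interpret P: abelian_group P by fact
  let ?S = "carrier M \<times> carrier N"
  have c': "\<And>x z. (x, z) \<in> ?S \<Longrightarrow> \<beta> x z \<in> carrier P" using balanced_map_closed[OF \<beta>] by auto
  have eq: "frag_sum P \<beta> c = frag_sum P \<beta> a" if c: "c \<in> cls a" for c
  proof -
    obtain k where k: "k \<in> K" "c = k + a"
      using c by (auto simp: r_coset_def)
    then have "k \<in> carrier A" using K.subset by blast
    then show ?thesis
      using P.frag_sum_add[of ?S \<beta> k a, OF c'] P.frag_sum_closed[of ?S \<beta> a, OF c'] a
        frag_sum_ker[OF P \<beta> k(1)] k(2) by simp
  qed
  have "frag_sum P \<beta> ` cls a = (\<lambda>c. frag_sum P \<beta> a) ` cls a"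
    by (rule image_cong[OF refl eq])
  then have "frag_sum P \<beta> ` cls a = {frag_sum P \<beta> a}"
    using A.rcos_self[OF a subgroup_ker] by auto
  then show ?thesis by (simp add: tensor_lift_def frag_sum_def[abs_def])
qed

lemma additive_tensor_lift:
  assumes P: "abelian_group P" and \<beta>: "balanced_map R M N P \<beta>"
  shows "additive_map T P (tensor_lift P \<beta>)"
proof -
  interpret P: abelian_group P by fact
  let ?S = "carrier M \<times> carrier N"
  have c': "\<And>x z. (x, z) \<in> ?S \<Longrightarrow> \<beta> x z \<in> carrier P" using balanced_map_closed[OF \<beta>] by auto
  show ?thesis
  proof (rule additive_mapI)
    show "tensor_lift P \<beta> X \<in> carrier P" if "X \<in> carrier T" for X
      using that P.frag_sum_closed[of ?S \<beta>, OF c'] tensor_lift_cls[OF P \<beta>]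
      by (auto simp: carrier_tensor)
    show "tensor_lift P \<beta> (X \<oplus>\<^bsub>T\<^esub> Y) = tensor_lift P \<beta> X \<oplus>\<^bsub>P\<^esub> tensor_lift P \<beta> Y"
      if XY: "X \<in> carrier T" "Y \<in> carrier T" for X Y
    proof -
      obtain a b where ab: "a \<in> carrier A" "b \<in> carrier A" "X = cls a" "Y = cls b"
        using XY unfolding carrier_tensor by blast
      then show ?thesis
        using P.frag_sum_add[of ?S \<beta> a b, OF c'] add_carrier[OF ab(1,2)]
        by (simp add: add_tensor cls_add tensor_lift_cls[OF P \<beta>])
    qed
  qed
qed

lemma tensor_lift_tens:
  assumes P: "abelian_group P" and \<beta>: "balanced_map R M N P \<beta>"
    and "x \<in> carrier M" "z \<in> carrier N"
  shows "tensor_lift P \<beta> (tens R M N x z) = \<beta> x z"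
proof -
  interpret P: abelian_group P by fact
  show ?thesis
    using assms balanced_map_closed[OF \<beta>, of x z]
    by (simp add: tens_cls tensor_lift_cls[OF P \<beta>] frag_of_carrier P.frag_sum_frag_of
        del: carrier_free_Abelian_group_iff)
qed

end

lemma additive_map_ident: "additive_map M M (\<lambda>x. x)"
  by (simp add: additive_map_def)

section \<open>The scalar action on a tensor product\<close>

context tensor_pair
begin

abbreviation "scale r \<equiv> frag_extend (\<lambda>(x, z). frag_of (r \<odot>\<^bsub>M\<^esub> x, z))"

lemma scale_closed:
  assumes "r \<in> carrier R" "a \<in> carrier A"
  shows "scale r a \<in> carrier A"
  using keys_frag_extend[of "\<lambda>(x, z). frag_of (r \<odot>\<^bsub>M\<^esub> x, z)" a] assms
  by (fastforce simp: keys_frag_of split: prod.splits)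

text \<open>Scaling first entries turns each relation into a relation of the same kind; this is what
  makes the action on cosets well defined.\<close>

lemma scale_ker:
  assumes r: "r \<in> carrier R" and a: "a \<in> K"
  shows "scale r a \<in> K"
proof -
  let ?H = "{a \<in> carrier A. scale r a \<in> K}"
  have "subgroup ?H A"
  proof (rule A.subgroupI)
    show "?H \<noteq> {}" using K.one_closed by (auto intro!: exI[of _ 0])
    show "inv\<^bsub>A\<^esub> a \<in> ?H" if "a \<in> ?H" for a
    proof -
      have a: "a \<in> carrier A" "scale r a \<in> K" using that by auto
      have i: "inv\<^bsub>A\<^esub> a = - a" "inv\<^bsub>A\<^esub> scale r a = - scale r a"
        using a(1) scale_closed[OF r a(1)] by simp_all
      show ?thesis
        using K.m_inv_closed[OF a(2)] a(1) unfolding i by (simp add: frag_extend_minus)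
    qed
    show "a \<otimes>\<^bsub>A\<^esub> b \<in> ?H" if "a \<in> ?H" "b \<in> ?H" for a b
      using K.m_closed[of "scale r a" "scale r b"] add_carrier[of a b] that
      by (simp add: frag_extend_add)
  qed auto
  moreover have "tensor_rels R M N \<subseteq> ?H"
  proof -
    \<comment> \<open>Commutativity of \<open>R\<close> is what lets the balancing relation survive:
      r has to move past the scalar s that is being transferred.\<close>
    have b: "s \<odot>\<^bsub>M\<^esub> (r \<odot>\<^bsub>M\<^esub> x) = r \<odot>\<^bsub>M\<^esub> (s \<odot>\<^bsub>M\<^esub> x)"
      if "s \<in> carrier R" "x \<in> carrier M" for s x
      using that r M.smult_assoc1[of s r x] M.smult_assoc1[of r s x] M.m_comm[of r s] by simp
    have 1: "scale r (frag_of (x \<oplus>\<^bsub>M\<^esub> x', z) - frag_of (x, z) - frag_of (x', z)) \<in> K"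
      if "x \<in> carrier M" "x' \<in> carrier M" "z \<in> carrier N" for x x' z
      using rels_in_ker(1)[of "r \<odot>\<^bsub>M\<^esub> x" "r \<odot>\<^bsub>M\<^esub> x'" z] that r
      by (simp add: frag_extend_diff M.smult_r_distr)
    have 2: "scale r (frag_of (x, z \<oplus>\<^bsub>N\<^esub> z') - frag_of (x, z) - frag_of (x, z')) \<in> K"
      if "x \<in> carrier M" "z \<in> carrier N" "z' \<in> carrier N" for x z z'
      using rels_in_ker(2)[of "r \<odot>\<^bsub>M\<^esub> x" z z'] that r by (simp add: frag_extend_diff)
    have 3: "scale r (frag_of (s \<odot>\<^bsub>M\<^esub> x, z) - frag_of (x, s \<odot>\<^bsub>N\<^esub> z)) \<in> K"
      if "s \<in> carrier R" "x \<in> carrier M" "z \<in> carrier N" for s x z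
      using rels_in_ker(3)[of s "r \<odot>\<^bsub>M\<^esub> x" z] that r by (simp add: frag_extend_diff b)
    have "tensor_rels R M N \<subseteq> {a. scale r a \<in> K}"
      unfolding tensor_rels_def using 1 2 3
      by (intro Un_least subsetI) (elim CollectE exE conjE, simp)+
    then show ?thesis
      using tensor_rels_subset by blast
  qed
  ultimately show ?thesis using ker_minimal a by blast
qed

text \<open>By \<open>scale_ker\<close> all members of the union in the definition of the action are
  the same coset, and the union is over a nonempty set.\<close>

lemma smult_cls:
  assumes r: "r \<in> carrier R" and a: "a \<in> carrier A"
  shows "r \<odot>\<^bsub>T\<^esub> cls a = cls (scale r a)"
proof -
  have eq: "cls (scale r c) = cls (scale r a)" if c: "c \<in> cls a" for c
  proof -
    obtain k where k: "k \<in> K" "c = k + a"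
      using c by (auto simp: r_coset_def)
    then have kA: "k \<in> carrier A" using K.subset by blast
    have "scale r c - scale r a = scale r k"
      by (simp add: k(2) frag_extend_add)
    then show ?thesis
      using scale_ker[OF r k(1)] scale_closed[OF r] a add_carrier[OF kA a] k(2)
      by (intro cls_eqI) simp_all
  qed
  have "r \<odot>\<^bsub>T\<^esub> cls a = (\<Union>c\<in>cls a. cls (scale r c))"
    by (simp add: tensor_def Let_def)
  also have "\<dots> = (\<Union>c\<in>cls a. cls (scale r a))"
    by (rule SUP_cong[OF refl eq])
  also have "\<dots> = cls (scale r a)"
    using A.rcos_self[OF a subgroup_ker] by auto
  finally show ?thesis .
qed

lemma additive_tensor_smult:
  assumes r: "r \<in> carrier R"
  shows "additive_map T T (\<lambda>X. r \<odot>\<^bsub>T\<^esub> X)"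
proof (rule additive_mapI)
  show "r \<odot>\<^bsub>T\<^esub> X \<in> carrier T" if X: "X \<in> carrier T" for X
  proof -
    obtain a where a: "a \<in> carrier A" "X = cls a"
      using X unfolding carrier_tensor by blast
    show ?thesis
      unfolding a(2) smult_cls[OF r a(1)] by (rule cls_closed[OF scale_closed[OF r a(1)]])
  qed
  show "r \<odot>\<^bsub>T\<^esub> (X \<oplus>\<^bsub>T\<^esub> Y) = r \<odot>\<^bsub>T\<^esub> X \<oplus>\<^bsub>T\<^esub> r \<odot>\<^bsub>T\<^esub> Y"
    if XY: "X \<in> carrier T" "Y \<in> carrier T" for X Y
  proof -
    obtain a b where ab: "a \<in> carrier A" "b \<in> carrier A" "X = cls a" "Y = cls b"
      using XY unfolding carrier_tensor by blast
    show ?thesis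
      unfolding ab(3,4) smult_cls[OF r ab(1)] smult_cls[OF r ab(2)] add_tensor
        cls_add[OF ab(1,2)] cls_add[OF scale_closed[OF r ab(1)] scale_closed[OF r ab(2)]]
        smult_cls[OF r add_carrier[OF ab(1,2)]]
      by (simp add: frag_extend_add)
  qed
qed

lemma smult_tens:
  "r \<in> carrier R \<Longrightarrow> x \<in> carrier M \<Longrightarrow> z \<in> carrier N \<Longrightarrow>
    r \<odot>\<^bsub>T\<^esub> tens R M N x z = tens R M N (r \<odot>\<^bsub>M\<^esub> x) z"
  unfolding tens_cls by (simp add: smult_cls frag_of_carrier del: carrier_free_Abelian_group_iff)

text \<open>Both sides of each axiom are additive in the tensor, so each one reduces to pure tensors
  and hence to the same axiom in \<open>M\<close>.\<close>

lemma module_tensor: "Module.module R T"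
proof (rule moduleI)
  note add = additive_tensor_smult and closed = additive_map_closed[OF additive_tensor_smult]
  show "abelian_group T" by (rule abelian_group_tensor)
  show "cring R" by (rule M.is_cring)
  show "r \<odot>\<^bsub>T\<^esub> X \<in> carrier T" if "r \<in> carrier R" "X \<in> carrier T" for r X
    using closed that .
  show "r \<odot>\<^bsub>T\<^esub> (X \<oplus>\<^bsub>T\<^esub> Y) = r \<odot>\<^bsub>T\<^esub> X \<oplus>\<^bsub>T\<^esub> r \<odot>\<^bsub>T\<^esub> Y"
    if "r \<in> carrier R" "X \<in> carrier T" "Y \<in> carrier T" for r X Y
    using additive_map_add[OF add] that .
  show "(r \<oplus>\<^bsub>R\<^esub> s) \<odot>\<^bsub>T\<^esub> X = r \<odot>\<^bsub>T\<^esub> X \<oplus>\<^bsub>T\<^esub> s \<odot>\<^bsub>T\<^esub> X"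
    if r: "r \<in> carrier R" "s \<in> carrier R" and X: "X \<in> carrier T" for r s X
  proof (rule additive_map_eqI[OF abelian_group_tensor _ _ _ X])
    show "additive_map T T (\<lambda>X. r \<odot>\<^bsub>T\<^esub> X \<oplus>\<^bsub>T\<^esub> s \<odot>\<^bsub>T\<^esub> X)"
      using r by (intro additive_map_plus abelian_group_tensor add)
    show "additive_map T T (\<lambda>X. (r \<oplus>\<^bsub>R\<^esub> s) \<odot>\<^bsub>T\<^esub> X)"
      using r by (intro add) simp
    show "(r \<oplus>\<^bsub>R\<^esub> s) \<odot>\<^bsub>T\<^esub> tens R M N x z = r \<odot>\<^bsub>T\<^esub> tens R M N x z \<oplus>\<^bsub>T\<^esub> s \<odot>\<^bsub>T\<^esub> tens R M N x z"
      if "x \<in> carrier M" "z \<in> carrier N" for x z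
      using that r by (simp add: smult_tens M.smult_l_distr tens_add_left)
  qed
  show "(r \<otimes>\<^bsub>R\<^esub> s) \<odot>\<^bsub>T\<^esub> X = r \<odot>\<^bsub>T\<^esub> (s \<odot>\<^bsub>T\<^esub> X)"
    if r: "r \<in> carrier R" "s \<in> carrier R" and X: "X \<in> carrier T" for r s X
  proof (rule additive_map_eqI[OF abelian_group_tensor _ _ _ X])
    show "additive_map T T (\<lambda>X. r \<odot>\<^bsub>T\<^esub> (s \<odot>\<^bsub>T\<^esub> X))"
      using r by (intro additive_map_comp[OF add add])
    show "additive_map T T (\<lambda>X. (r \<otimes>\<^bsub>R\<^esub> s) \<odot>\<^bsub>T\<^esub> X)"
      using r by (intro add) simp
    show "(r \<otimes>\<^bsub>R\<^esub> s) \<odot>\<^bsub>T\<^esub> tens R M N x z = r \<odot>\<^bsub>T\<^esub> (s \<odot>\<^bsub>T\<^esub> tens R M N x z)"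
      if "x \<in> carrier M" "z \<in> carrier N" for x z
      using that r by (simp add: smult_tens M.smult_assoc1)
  qed
  show "\<one>\<^bsub>R\<^esub> \<odot>\<^bsub>T\<^esub> X = X" if X: "X \<in> carrier T" for X
    by (rule additive_map_eqI[OF abelian_group_tensor _ _ _ X])
      (simp_all add: add additive_map_ident smult_tens)
qed

lemma tensor_lift_smult:
  assumes P: "abelian_group P" and \<beta>: "balanced_map R M N P \<beta>" and \<sigma>: "additive_map P P \<sigma>"
    and r: "r \<in> carrier R"
    and eq: "\<And>x z. x \<in> carrier M \<Longrightarrow> z \<in> carrier N \<Longrightarrow> \<beta> (r \<odot>\<^bsub>M\<^esub> x) z = \<sigma> (\<beta> x z)"
    and X: "X \<in> carrier T"
  shows "tensor_lift P \<beta> (r \<odot>\<^bsub>T\<^esub> X) = \<sigma> (tensor_lift P \<beta> X)"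
proof (rule additive_map_eqI[OF P _ _ _ X])
  note add = additive_tensor_lift[OF P \<beta>]
  show "additive_map T P (\<lambda>X. tensor_lift P \<beta> (r \<odot>\<^bsub>T\<^esub> X))"
    by (rule additive_map_comp[OF additive_tensor_smult[OF r] add])
  show "additive_map T P (\<lambda>X. \<sigma> (tensor_lift P \<beta> X))"
    by (rule additive_map_comp[OF add \<sigma>])
  show "tensor_lift P \<beta> (r \<odot>\<^bsub>T\<^esub> tens R M N x z) = \<sigma> (tensor_lift P \<beta> (tens R M N x z))"
    if "x \<in> carrier M" "z \<in> carrier N" for x z
    using that r eq by (simp add: smult_tens tensor_lift_tens[OF P \<beta>])
qed

lemma tensor_lift_mod_hom:
  assumes P: "Module.module R P" and \<beta>: "balanced_map R M N P \<beta>"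
    and "\<And>r x z. r \<in> carrier R \<Longrightarrow> x \<in> carrier M \<Longrightarrow> z \<in> carrier N \<Longrightarrow> \<beta> (r \<odot>\<^bsub>M\<^esub> x) z = r \<odot>\<^bsub>P\<^esub> \<beta> x z"
  shows "tensor_lift P \<beta> \<in> mod_hom R T P"
proof (rule mod_homI)
  show "additive_map T P (tensor_lift P \<beta>)"
    by (rule additive_tensor_lift[OF module_abelian_group[OF P] \<beta>])
  show "tensor_lift P \<beta> (r \<odot>\<^bsub>T\<^esub> X) = r \<odot>\<^bsub>P\<^esub> tensor_lift P \<beta> X"
    if r: "r \<in> carrier R" and "X \<in> carrier T" for r X
    by (rule tensor_lift_smult[OF module_abelian_group[OF P] \<beta> additive_map_smult[OF P r] r
          assms(3)[OF r] that(2)])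
qed

end

section \<open>Functoriality in the second factor\<close>

context
  fixes R :: "('r, 's) ring_scheme" and M :: "('r, 'a, 'p) module_scheme"
    and N :: "('r, 'b, 'q) module_scheme" and N' :: "('r, 'c, 't) module_scheme" and g
  assumes M: "Module.module R M" and N: "Module.module R N" and N': "Module.module R N'"
    and g: "g \<in> mod_hom R N N'"
begin

interpretation MN: tensor_pair R M N using M N by (simp add: tensor_pair_def)
interpretation MN': tensor_pair R M N' using M N' by (simp add: tensor_pair_def)

lemma balanced_id_tensor: "balanced_map R M N (tensor R M N') (\<lambda>x z. tens R M N' x (g z))"
proof -
  have c: "g z \<in> carrier N'" if "z \<in> carrier N" for z
    by (rule additive_map_closed[OF mod_hom_additive[OF g] that])
  show ?thesis
  proof (intro balanced_mapI additive_mapI)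
    show "tens R M N' x (g (z \<oplus>\<^bsub>N\<^esub> z')) = tens R M N' x (g z) \<oplus>\<^bsub>tensor R M N'\<^esub> tens R M N' x (g z')"
      if "x \<in> carrier M" "z \<in> carrier N" "z' \<in> carrier N" for x z z'
      using that by (simp add: additive_map_add[OF mod_hom_additive[OF g]] c MN'.tens_add_right)
    show "tens R M N' (r \<odot>\<^bsub>M\<^esub> x) (g z) = tens R M N' x (g (r \<odot>\<^bsub>N\<^esub> z))"
      if "r \<in> carrier R" "x \<in> carrier M" "z \<in> carrier N" for r x z
      using that by (simp add: mod_hom_smult[OF g] c MN'.tens_smult)
  qed (simp_all add: c MN'.tens_closed MN'.tens_add_left)
qed

lemma id_tensor_mod_hom: "id_tensor R M N' g \<in> mod_hom R (tensor R M N) (tensor R M N')"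
  unfolding id_tensor_def
proof (rule MN.tensor_lift_mod_hom[OF MN'.module_tensor balanced_id_tensor])
  show "tens R M N' (r \<odot>\<^bsub>M\<^esub> x) (g z) = r \<odot>\<^bsub>tensor R M N'\<^esub> tens R M N' x (g z)"
    if "r \<in> carrier R" "x \<in> carrier M" "z \<in> carrier N" for r x z
    using that additive_map_closed[OF mod_hom_additive[OF g]] by (simp add: MN'.smult_tens)
qed

lemma id_tensor_tens:
  "x \<in> carrier M \<Longrightarrow> z \<in> carrier N \<Longrightarrow> id_tensor R M N' g (tens R M N x z) = tens R M N' x (g z)"
  unfolding id_tensor_def
  by (rule MN.tensor_lift_tens[OF MN'.abelian_group_tensor balanced_id_tensor])

end

subsection \<open>Free modules and extension of scalars\<close>

lemma cring_type_ring:
  assumes "0 \<in> A" "1 \<in> A" "\<And>x z. x \<in> A \<Longrightarrow> z \<in> A \<Longrightarrow> x + z \<in> A"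
    "\<And>x z. x \<in> A \<Longrightarrow> z \<in> A \<Longrightarrow> x * z \<in> A" "\<And>x. x \<in> A \<Longrightarrow> - x \<in> A"
  shows "cring (type_ring A)"
proof (rule cringI)
  show "abelian_group (type_ring A)"
  proof (rule abelian_groupI)
    fix x assume "x \<in> carrier (type_ring A)"
    then show "\<exists>y\<in>carrier (type_ring A). y \<oplus>\<^bsub>type_ring A\<^esub> x = \<zero>\<^bsub>type_ring A\<^esub>"
      using assms(5)[of x] by (auto simp: type_ring_def intro!: bexI[of _ "- x"])
  qed (use assms in \<open>auto simp: type_ring_def algebra_simps\<close>)
  show "Group.comm_monoid (type_ring A)"
    by (rule comm_monoidI) (use assms in \<open>auto simp: type_ring_def algebra_simps\<close>)
qed (auto simp: type_ring_def algebra_simps)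

lemma type_ring_simps [simp]:
  "carrier (type_ring A) = A" "\<zero>\<^bsub>type_ring A\<^esub> = 0" "\<one>\<^bsub>type_ring A\<^esub> = 1"
  "x \<oplus>\<^bsub>type_ring A\<^esub> z = x + z" "x \<otimes>\<^bsub>type_ring A\<^esub> z = x * z"
  by (simp_all add: type_ring_def)

lemma finsum_type_ring:
  assumes "cring (type_ring A)" "finite I" "\<And>i. i \<in> I \<Longrightarrow> f i \<in> A"
  shows "finsum (type_ring A) f I = sum f I"
proof -
  interpret cring "type_ring A" by fact
  show ?thesis
    using assms(2,3) by (induction I rule: finite_induct) (simp_all add: Pi_def)
qed

lemma cring_KK: "cring KK"
  by (rule cring_type_ring) auto

lemma free_module_simps [simp]:
  "\<zero>\<^bsub>free_module R B\<^esub> = (\<lambda>b. \<zero>\<^bsub>R\<^esub>)"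
  "f \<oplus>\<^bsub>free_module R B\<^esub> g = (\<lambda>b. f b \<oplus>\<^bsub>R\<^esub> g b)"
  "r \<odot>\<^bsub>free_module R B\<^esub> f = (\<lambda>b. r \<otimes>\<^bsub>R\<^esub> f b)"
  by (simp_all add: free_module_def)

lemma free_module_carrierI:
  assumes "finite B" "\<And>b. f b \<in> carrier R" "\<And>b. b \<notin> B \<Longrightarrow> f b = \<zero>\<^bsub>R\<^esub>"
  shows "f \<in> carrier (free_module R B)"
proof -
  have "{b. f b \<noteq> \<zero>\<^bsub>R\<^esub>} \<subseteq> B" using assms(3) by blast
  then show ?thesis
    using assms finite_subset by (auto simp: free_module_def)
qed

lemma free_module_carrierD:
  assumes "f \<in> carrier (free_module R B)"
  shows "f b \<in> carrier R" "b \<notin> B \<Longrightarrow> f b = \<zero>\<^bsub>R\<^esub>"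
  using assms by (auto simp: free_module_def)

lemma module_free_module:
  assumes R: "cring R"
  shows "Module.module R (free_module R B)"
proof -
  interpret R: cring R by fact
  let ?F = "free_module R B"
  have fin: "finite {b. g b \<noteq> \<zero>\<^bsub>R\<^esub>} \<and> {b. g b \<noteq> \<zero>\<^bsub>R\<^esub>} \<subseteq> B"
    if "f \<in> carrier ?F" "\<And>b. f b = \<zero>\<^bsub>R\<^esub> \<Longrightarrow> g b = \<zero>\<^bsub>R\<^esub>" for f g :: "'c \<Rightarrow> 'a"
  proof -
    have "{b. g b \<noteq> \<zero>\<^bsub>R\<^esub>} \<subseteq> {b. f b \<noteq> \<zero>\<^bsub>R\<^esub>}" using that(2) by blast
    then show ?thesis
      using that(1) finite_subset by (auto simp: free_module_def)
  qed
  have smult: "(\<lambda>b. r \<otimes>\<^bsub>R\<^esub> f b) \<in> carrier ?F" if "r \<in> carrier R" "f \<in> carrier ?F" for r f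
    using that fin[of f "\<lambda>b. r \<otimes>\<^bsub>R\<^esub> f b"] free_module_carrierD(1)[OF that(2)]
    by (auto simp: free_module_def)
  have add: "(\<lambda>b. f b \<oplus>\<^bsub>R\<^esub> g b) \<in> carrier ?F" if "f \<in> carrier ?F" "g \<in> carrier ?F" for f g
  proof -
    have fg: "{b. f b \<noteq> \<zero>\<^bsub>R\<^esub>} \<union> {b. g b \<noteq> \<zero>\<^bsub>R\<^esub>} \<subseteq> B"
      "finite ({b. f b \<noteq> \<zero>\<^bsub>R\<^esub>} \<union> {b. g b \<noteq> \<zero>\<^bsub>R\<^esub>})"
      using that by (simp_all add: free_module_def)
    have s: "{b. f b \<oplus>\<^bsub>R\<^esub> g b \<noteq> \<zero>\<^bsub>R\<^esub>} \<subseteq> {b. f b \<noteq> \<zero>\<^bsub>R\<^esub>} \<union> {b. g b \<noteq> \<zero>\<^bsub>R\<^esub>}"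
      by auto
    show ?thesis
      using finite_subset[OF s fg(2)] subset_trans[OF s fg(1)] that by (simp add: free_module_def)
  qed
  have neg: "(\<lambda>b. \<ominus>\<^bsub>R\<^esub> f b) \<in> carrier ?F" if "f \<in> carrier ?F" for f
    using that fin[of f "\<lambda>b. \<ominus>\<^bsub>R\<^esub> f b"] free_module_carrierD(1)[OF that]
    by (auto simp: free_module_def)
  note D = free_module_carrierD(1)[of _ R B]
  show ?thesis
  proof (rule moduleI)
    show "abelian_group ?F"
    proof (rule abelian_groupI)
      show "\<zero>\<^bsub>?F\<^esub> \<in> carrier ?F" by (simp add: free_module_def)
      show "\<exists>g\<in>carrier ?F. g \<oplus>\<^bsub>?F\<^esub> f = \<zero>\<^bsub>?F\<^esub>" if "f \<in> carrier ?F" for f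
        using neg[OF that] D[OF that] by (intro bexI[of _ "\<lambda>b. \<ominus>\<^bsub>R\<^esub> f b"]) (simp_all add: R.l_neg)
    qed (auto simp: add D R.a_ac)
  qed (auto simp: R.is_cring smult D R.l_distr R.r_distr R.m_assoc)
qed

lemma additive_eval: "additive_map (free_module R B) R (\<lambda>f. f b)"
  by (rule additive_mapI) (simp_all add: free_module_carrierD(1)[of _ R B])

lemma basis_vec_closed:
  assumes "cring R" "b \<in> B"
  shows "basis_vec R b \<in> carrier (free_module R B)"
proof -
  interpret cring R by fact
  have "{c. basis_vec R b c \<noteq> \<zero>\<^bsub>R\<^esub>} \<subseteq> {b}" by (auto simp: basis_vec_def)
  then show ?thesis
    using assms(2) finite_subset by (fastforce simp: free_module_def basis_vec_def)
qed

lemma (in abelian_monoid) finsum_single: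
  assumes "finite I" "i \<in> I" "f i \<in> carrier G" "\<And>j. j \<in> I \<Longrightarrow> j \<noteq> i \<Longrightarrow> f j = \<zero>"
  shows "finsum G f I = f i"
proof -
  have "finsum G f I = finsum G (\<lambda>j. if i = j then f j else \<zero>) I"
    using assms(3,4) by (intro finsum_cong') auto
  also have "\<dots> = f i"
    using assms add.finprod_singleton[of i I f] by (simp add: Pi_def) (metis assms(3,4) zero_closed)
  finally show ?thesis .
qed

lemma finsum_free_module:
  assumes "cring R" "finite I" "\<And>i. i \<in> I \<Longrightarrow> f i \<in> carrier (free_module R B)"
  shows "finsum (free_module R B) f I b = (\<Oplus>\<^bsub>R\<^esub>i\<in>I. f i b)"
proof -
  interpret cring R by fact
  show ?thesis
    using additive_map_finsum[OF module_abelian_group[OF module_free_module[OF assms(1)]]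
        abelian_group_axioms additive_eval[of R B b] assms(2), of f] assms(3) by simp
qed

lemma free_module_expand:
  assumes R: "cring R" and B: "finite B" and f: "f \<in> carrier (free_module R B)"
  shows "f = (\<Oplus>\<^bsub>free_module R B\<^esub>b\<in>B. f b \<odot>\<^bsub>free_module R B\<^esub> basis_vec R b)"
proof
  fix c
  interpret R: cring R by fact
  interpret F: Module.module R "free_module R B" by (rule module_free_module[OF R])
  note fc = free_module_carrierD[OF f]
  have "(\<Oplus>\<^bsub>free_module R B\<^esub>b\<in>B. f b \<odot>\<^bsub>free_module R B\<^esub> basis_vec R b) c
      = (\<Oplus>\<^bsub>R\<^esub>b\<in>B. f b \<otimes>\<^bsub>R\<^esub> basis_vec R b c)"
    using finsum_free_module[OF R B, of "\<lambda>b. f b \<odot>\<^bsub>free_module R B\<^esub> basis_vec R b" B c]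
      F.smult_closed[OF fc(1) basis_vec_closed[OF R]] by simp
  also have "\<dots> = f c"
  proof (cases "c \<in> B")
    case True
    then show ?thesis
      using R.finsum_single[OF B True, of "\<lambda>b. f b \<otimes>\<^bsub>R\<^esub> basis_vec R b c"] fc
      by (simp add: basis_vec_def)
  next
    case False
    have "(\<Oplus>\<^bsub>R\<^esub>b\<in>B. f b \<otimes>\<^bsub>R\<^esub> basis_vec R b c) = (\<Oplus>\<^bsub>R\<^esub>b\<in>B. \<zero>\<^bsub>R\<^esub>)"
      using False fc by (intro R.finsum_cong') (auto simp: basis_vec_def)
    then show ?thesis using fc(2)[OF False] by simp
  qed
  finally show "f c = (\<Oplus>\<^bsub>free_module R B\<^esub>b\<in>B. f b \<odot>\<^bsub>free_module R B\<^esub> basis_vec R b) c" ..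
qed

text \<open>Replaces the support of \<open>f\<close>, which varies with \<open>f\<close>, by the
  fixed index set \<open>B\<close>; additivity in \<open>f\<close> then becomes termwise.\<close>

lemma lin_ext_eq:
  assumes N: "Module.module R N" and B: "finite B" and f: "f \<in> carrier (free_module R B)"
    and g: "\<And>b. b \<in> B \<Longrightarrow> g b \<in> carrier N"
  shows "lin_ext R N g f = (\<Oplus>\<^bsub>N\<^esub>b\<in>B. f b \<odot>\<^bsub>N\<^esub> g b)"
proof -
  interpret N: Module.module R N by fact
  show ?thesis
    unfolding lin_ext_def
  proof (rule N.add.finprod_mono_neutral_cong_left[OF B])
    show "{b. f b \<noteq> \<zero>\<^bsub>R\<^esub>} \<subseteq> B" using free_module_carrierD(2)[OF f] by blast
  qed (use g free_module_carrierD[OF f] in auto)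
qed

text \<open>M (x) R^B is a direct sum of copies of M, so a family of additive maps out of M, one for
  each basis element, defines a map out of it. The coefficient acts on x inside \<open>h b\<close>,
  since \<open>P\<close> has no scalars; balancing then amounts to commutativity of
  \<open>R\<close>.\<close>

lemma balanced_map_free:
  assumes M: "Module.module R M" and P: "abelian_group P" and B: "finite B"
    and h: "\<And>b. b \<in> B \<Longrightarrow> additive_map M P (h b)"
  shows "balanced_map R M (free_module R B) P (\<lambda>x f. \<Oplus>\<^bsub>P\<^esub>b\<in>B. h b (f b \<odot>\<^bsub>M\<^esub> x))"
proof (rule balanced_mapI)
  interpret M: Module.module R M by fact
  show "additive_map M P (\<lambda>x. \<Oplus>\<^bsub>P\<^esub>b\<in>B. h b (f b \<odot>\<^bsub>M\<^esub> x))"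
    if "f \<in> carrier (free_module R B)" for f
    using free_module_carrierD(1)[OF that]
    by (intro additive_map_finsum_fun[OF P B] additive_map_comp[OF additive_map_smult[OF M] h])
  show "additive_map (free_module R B) P (\<lambda>f. \<Oplus>\<^bsub>P\<^esub>b\<in>B. h b (f b \<odot>\<^bsub>M\<^esub> x))"
    if x: "x \<in> carrier M" for x
  proof (intro additive_map_finsum_fun[OF P B])
    fix b assume b: "b \<in> B"
    have "additive_map (free_module R B) M (\<lambda>f. f b \<odot>\<^bsub>M\<^esub> x)"
      by (rule additive_mapI) (simp_all add: x free_module_carrierD(1)[of _ R B] M.smult_l_distr)
    from additive_map_comp[OF this h[OF b]]
    show "additive_map (free_module R B) P (\<lambda>f. h b (f b \<odot>\<^bsub>M\<^esub> x))" .
  qed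
  show "(\<Oplus>\<^bsub>P\<^esub>b\<in>B. h b (f b \<odot>\<^bsub>M\<^esub> (r \<odot>\<^bsub>M\<^esub> x)))
      = (\<Oplus>\<^bsub>P\<^esub>b\<in>B. h b ((r \<odot>\<^bsub>free_module R B\<^esub> f) b \<odot>\<^bsub>M\<^esub> x))"
    if "r \<in> carrier R" "x \<in> carrier M" "f \<in> carrier (free_module R B)" for r x f
    using that by (simp add: M.m_comm free_module_carrierD(1)[OF that(3)] flip: M.smult_assoc1)
qed

lemma finsum_basis_vec:
  assumes M: "Module.module R M" and P: "abelian_group P" and B: "finite B"
    and h: "\<And>b. b \<in> B \<Longrightarrow> additive_map M P (h b)" and c: "c \<in> B" and x: "x \<in> carrier M"
  shows "(\<Oplus>\<^bsub>P\<^esub>b\<in>B. h b (basis_vec R c b \<odot>\<^bsub>M\<^esub> x)) = h c x"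
proof -
  interpret M: Module.module R M by fact
  interpret P: abelian_group P by fact
  have "h b \<zero>\<^bsub>M\<^esub> = \<zero>\<^bsub>P\<^esub>" if "b \<in> B" for b
    by (rule additive_map_zero[OF M.abelian_group_axioms P h[OF that]])
  then show ?thesis
    using P.finsum_single[OF B c, of "\<lambda>b. h b (basis_vec R c b \<odot>\<^bsub>M\<^esub> x)"]
      additive_map_closed[OF h[OF c] x] x by (simp add: basis_vec_def)
qed

section \<open>Coordinates on a tensor product with a finite free module\<close>

locale free_tensor = M: Module.module R M for R :: "('r, 's) ring_scheme"
    and M :: "('r, 'a, 'p) module_scheme" and B :: "'b set" +
  assumes finite_B: "finite B"
begin

lemma cring_R: "cring R" by (rule M.is_cring)

sublocale tensor_pair R M "free_module R B"
  by (intro tensor_pair.intro M.module_axioms module_free_module cring_R)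

text \<open>A component of the isomorphism from M (x) R^B to M^B.\<close>

definition coord :: "'b \<Rightarrow> ('a \<times> ('b \<Rightarrow> 'r) \<Rightarrow>\<^sub>0 int) set \<Rightarrow> 'a"
  where "coord b = tensor_lift M (\<lambda>x f. f b \<odot>\<^bsub>M\<^esub> x)"

lemma balanced_coord: "balanced_map R M (free_module R B) M (\<lambda>x f. f b \<odot>\<^bsub>M\<^esub> x)"
  by (intro balanced_mapI additive_mapI)
    (auto simp: free_module_carrierD(1)[of _ R B] M.smult_l_distr M.smult_r_distr M.m_comm simp flip: M.smult_assoc1)

lemma coord_tens:
  "x \<in> carrier M \<Longrightarrow> f \<in> carrier (free_module R B) \<Longrightarrow> coord b (tens R M (free_module R B) x f) = f b \<odot>\<^bsub>M\<^esub> x"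
  unfolding coord_def by (rule tensor_lift_tens[OF M.abelian_group_axioms balanced_coord])

lemma coord_mod_hom: "coord b \<in> mod_hom R T M"
  unfolding coord_def
proof (rule tensor_lift_mod_hom[OF M.module_axioms balanced_coord])
  show "f b \<odot>\<^bsub>M\<^esub> (r \<odot>\<^bsub>M\<^esub> x) = r \<odot>\<^bsub>M\<^esub> (f b \<odot>\<^bsub>M\<^esub> x)"
    if "r \<in> carrier R" "x \<in> carrier M" "f \<in> carrier (free_module R B)" for r x f
    using that free_module_carrierD(1)[OF that(3)] by (simp add: M.m_comm flip: M.smult_assoc1)
qed

lemma coord_closed: "X \<in> carrier T \<Longrightarrow> coord b X \<in> carrier M"
  by (rule additive_map_closed[OF mod_hom_additive[OF coord_mod_hom]])

lemma additive_tens_basis: "b \<in> B \<Longrightarrow> additive_map M T (\<lambda>x. tens R M (free_module R B) x (basis_vec R b))"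
  by (rule additive_mapI) (simp_all add: tens_closed basis_vec_closed[OF cring_R] tens_add_left)

lemma tens_expand:
  assumes x: "x \<in> carrier M" and f: "f \<in> carrier (free_module R B)"
  shows "tens R M (free_module R B) x f
    = (\<Oplus>\<^bsub>T\<^esub>b\<in>B. tens R M (free_module R B) (f b \<odot>\<^bsub>M\<^esub> x) (basis_vec R b))"
proof -
  let ?F = "free_module R B"
  have add: "additive_map ?F T (tens R M ?F x)"
    by (rule additive_mapI) (simp_all add: x tens_closed tens_add_right del: free_module_simps)
  have c: "f b \<odot>\<^bsub>?F\<^esub> basis_vec R b \<in> carrier ?F" if "b \<in> B" for b
    by (rule N.smult_closed[OF free_module_carrierD(1)[OF f] basis_vec_closed[OF cring_R that]])
  have "tens R M ?F x f = tens R M ?F x (\<Oplus>\<^bsub>?F\<^esub>b\<in>B. f b \<odot>\<^bsub>?F\<^esub> basis_vec R b)"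
    using free_module_expand[OF cring_R finite_B f] by simp
  also have "\<dots> = (\<Oplus>\<^bsub>T\<^esub>b\<in>B. tens R M ?F x (f b \<odot>\<^bsub>?F\<^esub> basis_vec R b))"
    by (rule additive_map_finsum[OF N.abelian_group_axioms abelian_group_tensor add finite_B c])
  also have "\<dots> = (\<Oplus>\<^bsub>T\<^esub>b\<in>B. tens R M ?F (f b \<odot>\<^bsub>M\<^esub> x) (basis_vec R b))"
  proof (rule T.finsum_cong'[OF refl])
    show "(\<lambda>b. tens R M ?F (f b \<odot>\<^bsub>M\<^esub> x) (basis_vec R b)) \<in> B \<rightarrow> carrier T"
      by (intro Pi_I tens_closed M.smult_closed free_module_carrierD(1)[OF f] x basis_vec_closed[OF cring_R])
    show "tens R M ?F x (f b \<odot>\<^bsub>?F\<^esub> basis_vec R b) = tens R M ?F (f b \<odot>\<^bsub>M\<^esub> x) (basis_vec R b)"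
      if "b \<in> B" for b
      by (rule tens_smult[OF free_module_carrierD(1)[OF f] x basis_vec_closed[OF cring_R that], symmetric])
  qed
  finally show ?thesis .
qed

text \<open>Both sides are additive in X, and on pure tensors the claim is the expansion of the
  second factor in the basis with its coefficients moved to the left.\<close>

lemma tensor_expand:
  assumes X: "X \<in> carrier T"
  shows "X = (\<Oplus>\<^bsub>T\<^esub>b\<in>B. tens R M (free_module R B) (coord b X) (basis_vec R b))"
proof (rule additive_map_eqI[OF abelian_group_tensor additive_map_ident _ _ X])
  show "additive_map T T (\<lambda>X. \<Oplus>\<^bsub>T\<^esub>b\<in>B. tens R M (free_module R B) (coord b X) (basis_vec R b))"
    by (intro additive_map_finsum_fun abelian_group_tensor finite_B
        additive_map_comp[OF mod_hom_additive[OF coord_mod_hom] additive_tens_basis])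
  show "tens R M (free_module R B) x f
      = (\<Oplus>\<^bsub>T\<^esub>b\<in>B. tens R M (free_module R B) (coord b (tens R M (free_module R B) x f)) (basis_vec R b))"
    if "x \<in> carrier M" "f \<in> carrier (free_module R B)" for x f
    unfolding coord_tens[OF that] by (rule tens_expand[OF that])
qed

lemma coord_eqI:
  assumes "X \<in> carrier T" "Y \<in> carrier T" "\<And>b. b \<in> B \<Longrightarrow> coord b X = coord b Y"
  shows "X = Y"
proof -
  have "(\<Oplus>\<^bsub>T\<^esub>b\<in>B. tens R M (free_module R B) (coord b X) (basis_vec R b))
      = (\<Oplus>\<^bsub>T\<^esub>b\<in>B. tens R M (free_module R B) (coord b Y) (basis_vec R b))"
    by (intro T.finsum_cong' refl Pi_I tens_closed coord_closed basis_vec_closed cring_R assms(2))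
      (simp_all add: assms(3))
  then show ?thesis
    using tensor_expand[OF assms(1)] tensor_expand[OF assms(2)] by simp
qed

text \<open>The test for equality used throughout: after moving coefficients to the left factor,
  only tensors x (x) b remain, with x arbitrary in \<open>M\<close>. The maps need not respect
  scalars.\<close>

lemma basis_additive_map_eqI:
  assumes P: "abelian_group P" and f: "additive_map T P f" and g: "additive_map T P g"
    and eq: "\<And>x b. x \<in> carrier M \<Longrightarrow> b \<in> B \<Longrightarrow>
      f (tens R M (free_module R B) x (basis_vec R b)) = g (tens R M (free_module R B) x (basis_vec R b))"
    and X: "X \<in> carrier T"
  shows "f X = g X"
proof -
  interpret P: abelian_group P by fact
  let ?t = "\<lambda>b. tens R M (free_module R B) (coord b X) (basis_vec R b)"
  have t: "?t b \<in> carrier T" if "b \<in> B" for b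
    by (intro tens_closed coord_closed X basis_vec_closed[OF cring_R that])
  have "f X = f (\<Oplus>\<^bsub>T\<^esub>b\<in>B. ?t b)" using tensor_expand[OF X] by simp
  also have "\<dots> = (\<Oplus>\<^bsub>P\<^esub>b\<in>B. f (?t b))"
    by (rule additive_map_finsum[OF abelian_group_tensor P f finite_B t])
  also have "\<dots> = (\<Oplus>\<^bsub>P\<^esub>b\<in>B. g (?t b))"
    using eq[OF coord_closed[OF X]] additive_map_closed[OF g t]
    by (intro P.finsum_cong') auto
  also have "\<dots> = g (\<Oplus>\<^bsub>T\<^esub>b\<in>B. ?t b)"
    by (rule additive_map_finsum[OF abelian_group_tensor P g finite_B t, symmetric])
  also have "\<dots> = g X" using tensor_expand[OF X] by simp
  finally show ?thesis .
qed

end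

lemma module_restrict_scalars:
  assumes S: "cring S" and \<phi>: "\<phi> \<in> Ring.ring_hom S R" and M: "Module.module R M"
  shows "Module.module S (restrict_scalars \<phi> M)"
proof -
  interpret M: Module.module R M by fact
  have s: "carrier (restrict_scalars \<phi> M) = carrier M" "\<zero>\<^bsub>restrict_scalars \<phi> M\<^esub> = \<zero>\<^bsub>M\<^esub>"
    "x \<oplus>\<^bsub>restrict_scalars \<phi> M\<^esub> z = x \<oplus>\<^bsub>M\<^esub> z" "c \<odot>\<^bsub>restrict_scalars \<phi> M\<^esub> x = \<phi> c \<odot>\<^bsub>M\<^esub> x" for x z c
    by (simp_all add: restrict_scalars_def)
  have "abelian_group (restrict_scalars \<phi> M)"
    by (rule abelian_groupI)
      (auto simp: s M.a_ac intro!: bexI[of _ "\<ominus>\<^bsub>M\<^esub> _"] M.l_neg)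
  then show ?thesis
    using ring_hom_closed[OF \<phi>] ring_hom_add[OF \<phi>] ring_hom_mult[OF \<phi>] ring_hom_one[OF \<phi>]
    by (intro moduleI S) (simp_all add: s M.smult_l_distr M.smult_r_distr M.smult_assoc1)
qed

lemma mod_hom_restrict_scalars:
  assumes "f \<in> mod_hom R M N" "\<phi> \<in> Ring.ring_hom S R"
  shows "f \<in> mod_hom S (restrict_scalars \<phi> M) (restrict_scalars \<phi> N)"
  using assms ring_hom_closed[OF assms(2)] by (auto simp: mod_hom_def restrict_scalars_def)

subsection \<open>Antisymmetrized words as determinants\<close>

abbreviation delete_nth :: "nat \<Rightarrow> 'a list \<Rightarrow> 'a list"
  where "delete_nth j w \<equiv> take j w @ drop (Suc j) w"

lemma nth_delete_nth:
  "j < length w \<Longrightarrow> i < length w - 1 \<Longrightarrow> delete_nth j w ! i = w ! (if i < j then i else Suc i)"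
  by (auto simp: nth_append min_def)

lemma length_delete_nth: "j < length w \<Longrightarrow> length (delete_nth j w) = length w - 1"
  by auto

lemma set_delete_nth: "set (delete_nth j w) \<subseteq> set w"
  by (auto dest: in_set_takeD in_set_dropD)

text \<open>Rows are indexed by the places of \<open>w\<close> and columns by those of
  \<open>u\<close>. Its determinant is the coefficient of \<open>u\<close> in the antisymmetrization
  of \<open>w\<close>, so determinant theory replaces sums over permutations.\<close>

definition incidence_mat :: "'a list \<Rightarrow> 'a list \<Rightarrow> 'b::comm_ring_1 mat"
  where "incidence_mat w u = mat (length w) (length u) (\<lambda>(i, j). if w ! i = u ! j then 1 else 0)"

lemma incidence_mat_carrier: "length u = length w \<Longrightarrow> incidence_mat w u \<in> carrier_mat (length w) (length w)"
  by (simp add: incidence_mat_def)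

lemma incidence_mat_index:
  "i < length w \<Longrightarrow> j < length u \<Longrightarrow> incidence_mat w u $$ (i, j) = (if w ! i = u ! j then 1 else 0)"
  by (simp add: incidence_mat_def)

text \<open>In the Leibniz formula the product of the entries at (\<open>\<tau> j\<close>,
  \<open>j\<close>) is 1 exactly when permuting \<open>w\<close> by \<open>\<tau>\<close> yields
  \<open>u\<close>, and 0 otherwise.\<close>

lemma vbracket_det:
  assumes "length u = length w"
  shows "vbracket w u = det (incidence_mat w u)"
proof -
  let ?n = "length w"
  have "(of_int (sign \<tau>) :: ratfun) * vtens (permute_list \<tau> w) u
      = of_int (sign \<tau>) * (\<Prod>j<?n. incidence_mat w u $$ (\<tau> j, j))"
    if \<tau>: "\<tau> permutes {0..<?n}" for \<tau>
  proof -
    have less: "\<tau> j < ?n" if "j < ?n" for j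
      using permutes_in_image[OF \<tau>, of j] that by simp
    have "u = permute_list \<tau> w \<longleftrightarrow> (\<forall>j<?n. w ! \<tau> j = u ! j)"
      using assms \<tau> by (auto simp: list_eq_iff_nth_eq permute_list_nth atLeast0LessThan)
    moreover have "(\<Prod>j<?n. incidence_mat w u $$ (\<tau> j, j)) = (if \<forall>j<?n. w ! \<tau> j = u ! j then 1 else (0::ratfun))"
      using less assms by (auto simp: incidence_mat_def intro!: prod.neutral)
    ultimately show ?thesis by (auto simp: basis_vec_def)
  qed
  \<comment> \<open>\<open>permute_list\<close> reads \<open>w\<close> at \<open>\<tau> j\<close>,
    hence the Leibniz formula that permutes the row index.\<close>
  then show ?thesis
    unfolding vbracket_def det_col[OF incidence_mat_carrier[OF assms]] lessThan_atLeast0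
    by (intro sum.cong) (auto simp: lessThan_atLeast0)
qed

lemma vbracket_support:
  assumes "vbracket w u \<noteq> 0"
  shows "mset u = mset w"
proof -
  obtain \<tau> where "\<tau> permutes {..<length w}" "of_int (sign \<tau>) * vtens (permute_list \<tau> w) u \<noteq> (0::ratfun)"
    using assms unfolding vbracket_def by (metis (mono_tags, lifting) mem_Collect_eq sum.neutral)
  then have "u = permute_list \<tau> w" by (auto simp: basis_vec_def split: if_splits)
  then show ?thesis
    using \<open>\<tau> permutes {..<length w}\<close> by simp
qed

lemma incidence_mat_delete:
  assumes "i < length w" "j < length u"
  shows "mat_delete (incidence_mat w u) i j = incidence_mat (delete_nth i w) (delete_nth j u)"
  using assms
  by (intro eq_matI) (auto simp: mat_delete_def incidence_mat_def nth_delete_nth length_delete_nth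
      simp del: length_append)

text \<open>Laplace expansion along a row follows one letter of \<open>w\<close> through all its
  possible places; this form serves to move that letter within \<open>w\<close>.\<close>

lemma vbracket_expand_row:
  assumes "length u = length w" "i < length w"
  shows "vbracket w u
    = (\<Sum>j<length u. (if w ! i = u ! j then (-1) ^ (i + j) * vbracket (delete_nth i w) (delete_nth j u) else 0))"
  unfolding vbracket_det[OF assms(1)] laplace_expansion_row[OF incidence_mat_carrier[OF assms(1)] assms(2)]
proof (rule sum.cong)
  show "incidence_mat w u $$ (i, j) * cofactor (incidence_mat w u) i j
    = (if w ! i = u ! j then (-1) ^ (i + j) * vbracket (delete_nth i w) (delete_nth j u) else 0)"
    if "j \<in> {..<length u}" for j
    using that assms
    by (auto simp: cofactor_def incidence_mat_delete vbracket_det incidence_mat_index)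
qed (use assms in simp)

text \<open>Laplace expansion along column 0 fixes the first tensor factor instead; this is the
  factor that the module action consumes.\<close>

lemma vbracket_expand_column:
  assumes "Suc (length u) = length w"
  shows "vbracket w (a # u)
    = (\<Sum>i<length w. (if w ! i = a then (-1) ^ i * vbracket (delete_nth i w) u else 0))"
proof -
  have l: "length (a # u) = length w" using assms by simp
  then have 0: "0 < length w" by auto
  show ?thesis
    unfolding vbracket_det[OF l] laplace_expansion_column[OF incidence_mat_carrier[OF l] 0]
  proof (rule sum.cong)
    fix i assume "i \<in> {..<length w}"
    then have i: "i < length w" by simp
    have "mat_delete (incidence_mat w (a # u) :: ratfun mat) i 0 = incidence_mat (delete_nth i w) u"
      using incidence_mat_delete[OF i, of 0 "a # u"] by simp
    moreover have "(incidence_mat w (a # u) :: ratfun mat) $$ (i, 0) = (if w ! i = a then 1 else 0)"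
      using incidence_mat_index[OF i, of 0 "a # u"] by simp
    moreover have "length u = length (delete_nth i w)"
      using i assms by simp
    ultimately show "incidence_mat w (a # u) $$ (i, 0) * cofactor (incidence_mat w (a # u)) i 0
      = (if w ! i = a then (-1) ^ i * vbracket (delete_nth i w) u else 0)"
      by (simp add: cofactor_def vbracket_det del: length_append)
  qed simp
qed

text \<open>Exchanging two places of the word at which the coefficient is read exchanges two columns
  of the incidence matrix.\<close>

lemma vbracket_swap:
  assumes "length u = length w" "k < length w" "l < length w" "k \<noteq> l"
  shows "vbracket w (u[k := u ! l, l := u ! k]) = - vbracket w u"
proof -
  have "incidence_mat w (u[k := u ! l, l := u ! k]) = swapcols k l (incidence_mat w u :: ratfun mat)"
    using assms
    by (intro eq_matI) (auto simp: incidence_mat_def nth_list_update)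
  then show ?thesis
    using det_swapcols[OF assms(2-4) incidence_mat_carrier[OF assms(1)]] assms(1)
    by (simp add: vbracket_det)
qed

text \<open>A repeated letter gives two identical rows. Words of another length lie outside the
  support.\<close>

lemma vbracket_not_distinct:
  assumes "\<not> distinct w"
  shows "vbracket w = (\<lambda>u. 0)"
proof
  fix u
  obtain i j where ij: "i < length w" "j < length w" "i \<noteq> j" "w ! i = w ! j"
    using assms by (auto simp: distinct_conv_nth)
  show "vbracket w u = 0"
  proof (cases "length u = length w")
    case True
    have "row (incidence_mat w u :: ratfun mat) i = row (incidence_mat w u) j"
      using ij True by (intro eq_vecI) (auto simp: incidence_mat_def)
    then show ?thesis
      unfolding vbracket_det[OF True]
      using det_identical_rows[OF incidence_mat_carrier[OF True] ij(3,1,2)] by blast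
  next
    case False
    then show ?thesis using vbracket_support[of w u] by (metis size_mset)
  qed
qed

lemma vbracket_self:
  assumes "distinct w"
  shows "vbracket w w = 1"
proof -
  have "incidence_mat w w = (1\<^sub>m (length w) :: ratfun mat)"
    using assms by (intro eq_matI) (auto simp: incidence_mat_def nth_eq_iff_index_eq)
  then show ?thesis by (simp add: vbracket_det)
qed

text \<open>The support of a bracket consists of rearrangements, and a finite set has one increasing
  arrangement. Reading coefficients at increasing words is therefore dual to the increasing
  brackets; injectivity of the comparison map rests on this.\<close>

lemma vbracket_sorted:
  assumes "finite S" "finite S'"
  shows "vbracket (sorted_list_of_set S) (sorted_list_of_set S') = (if S = S' then 1 else 0)"
proof (cases "S = S'")
  case False
  then show ?thesis
    using vbracket_support[of "sorted_list_of_set S" "sorted_list_of_set S'"] assms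
    by (metis set_mset_mset set_sorted_list_of_set)
qed (simp add: vbracket_self)

lemma vbracket_Nil: "vbracket [] = vtens []"
proof
  fix u
  show "vbracket [] u = vtens [] u"
    using vbracket_support[of "[]" u] vbracket_self[of "[]"]
    by (cases "u = []") (auto simp: basis_vec_def)
qed

lemma finite_words: "finite (words m n)"
  unfolding words_def using finite_lists_length_eq[of "{1..m}" n] by (simp add: conj_commute)

lemma vbracket_closed:
  assumes "w \<in> words m n"
  shows "vbracket w \<in> carrier (Vpow m n)"
proof (rule free_module_carrierI[OF finite_words])
  show "vbracket w u = \<zero>\<^bsub>KK\<^esub>" if "u \<notin> words m n" for u
    using vbracket_support[of w u] that assms
    by (auto simp: words_def dest: mset_eq_setD mset_eq_length)
qed simp

definition inversions :: "nat list \<Rightarrow> nat"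
  where "inversions w = card {(a, b). a < b \<and> b < length w \<and> w ! b < w ! a}"

lemma insort_position:
  fixes s :: "nat list"
  assumes "sorted s" "i \<notin> set s"
  defines "r \<equiv> card {t \<in> set s. t < i}"
  assumes "distinct s"
  shows "r \<le> length s" "insort i s ! r = i" "delete_nth r (insort i s) = s"
proof -
  \<comment> \<open>The same rank computed from the list, which makes induction over the list
    possible.\<close>
  define r' where "r' = length (filter (\<lambda>t. t < i) s)"
  have "set (filter (\<lambda>t. t < i) s) = {t \<in> set s. t < i}" by auto
  then have r: "r = r'"
    unfolding r_def r'_def using distinct_card[of "filter (\<lambda>t. t < i) s"] assms(4) by simp
  show "r \<le> length s" by (simp add: r r'_def)
  have "insort i s ! r' = i \<and> delete_nth r' (insort i s) = s"
    using assms(1,2) unfolding r'_def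
  proof (induction s)
    case (Cons a s)
    show ?case
    proof (cases "i < a")
      case True
      then have "filter (\<lambda>t. t < i) (a # s) = []"
        using Cons.prems by (auto simp: filter_empty_conv)
      then show ?thesis using True by simp
    next
      case False
      then show ?thesis using Cons by auto
    qed
  qed simp
  then show "insort i s ! r = i" "delete_nth r (insort i s) = s" by (simp_all add: r)
qed

text \<open>Inversions split by whether their left place is the new first place or not. Distinctness
  turns the count of places into a count of letters.\<close>

lemma inversions_Cons:
  assumes "distinct (i # w)"
  shows "inversions (i # w) = card {t \<in> set w. t < i} + inversions w"
proof -
  let ?I = "{(a, b). a < b \<and> b < length w \<and> w ! b < w ! a}"
  let ?J = "{b. b < length w \<and> w ! b < i}"
  have fI: "finite ?I" by (rule finite_subset[of _ "{..<length w} \<times> {..<length w}"]) auto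
  have "{(a, b). a < b \<and> b < length (i # w) \<and> (i # w) ! b < (i # w) ! a}
      = (\<lambda>b. (0, Suc b)) ` ?J \<union> (\<lambda>(a, b). (Suc a, Suc b)) ` ?I" (is "?L = ?R")
  proof (intro equalityI subsetI)
    fix p assume "p \<in> ?L"
    then obtain a b where p: "p = (a, Suc b)" "a < Suc b" "b < length w" "w ! b < (i # w) ! a"
      by (auto simp: less_Suc_eq_0_disj gr0_conv_Suc)
    then show "p \<in> ?R" by (cases a) auto
  qed auto
  then have "inversions (i # w) = card ((\<lambda>b. (0::nat, Suc b)) ` ?J \<union> (\<lambda>(a, b). (Suc a, Suc b)) ` ?I)"
    by (simp only: inversions_def)
  also have "\<dots> = card ((\<lambda>b. (0::nat, Suc b)) ` ?J) + card ((\<lambda>(a, b). (Suc a, Suc b)) ` ?I)"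
    using fI by (intro card_Un_disjoint) auto
  also have "card ((\<lambda>b. (0::nat, Suc b)) ` ?J) = card ?J"
    by (intro card_image) (auto simp: inj_on_def)
  also have "card ((\<lambda>(a, b). (Suc a, Suc b)) ` ?I) = inversions w"
    unfolding inversions_def by (intro card_image) (auto simp: inj_on_def)
  also have "card ?J = card ((!) w ` ?J)"
    using assms by (intro card_image[symmetric]) (auto simp: inj_on_def nth_eq_iff_index_eq)
  also have "(!) w ` ?J = {t \<in> set w. t < i}"
    by (auto simp: in_set_conv_nth)
  finally show ?thesis .
qed

text \<open>Moving the first letter of \<open>w\<close> to its place in the sorted word costs one sign per smaller
  letter, by comparing the Laplace expansions along the rows where that letter sits.\<close>

lemma vbracket_sort:
  assumes "distinct w"
  shows "vbracket w = (\<lambda>u. (-1) ^ inversions w * vbracket (sorted_list_of_set (set w)) u)"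
  using assms
proof (induction w)
  case Nil
  then show ?case by (simp add: inversions_def)
next
  case (Cons i w)
  let ?s = "sorted_list_of_set (set w)"
  let ?r = "card {t \<in> set w. t < i}"
  have IH: "vbracket w = (\<lambda>u. (-1) ^ inversions w * vbracket ?s u)" using Cons by simp
  have l: "length ?s = length w"
    using Cons.prems by (simp add: distinct_card)
  have s: "sorted_list_of_set (set (i # w)) = insort i ?s"
    using Cons.prems by (simp add: sorted_list_of_set_insert)
  have r: "?r \<le> length ?s" "insort i ?s ! ?r = i" "delete_nth ?r (insort i ?s) = ?s"
    using insort_position[of ?s i] Cons.prems by simp_all
  show ?case
  proof
    fix u
    show "vbracket (i # w) u = (-1) ^ inversions (i # w) * vbracket (sorted_list_of_set (set (i # w))) u"
    proof (cases "length u = length (i # w)")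
      case True
      let ?v = "\<lambda>j. vbracket ?s (delete_nth j u)"
      have "vbracket (i # w) u
          = (\<Sum>j<length u. if i = u ! j then (-1) ^ j * ((-1) ^ inversions w * ?v j) else 0)"
        using vbracket_expand_row[OF True, of 0] by (simp add: IH cong: if_cong)
      moreover have "vbracket (insort i ?s) u
          = (\<Sum>j<length u. if i = u ! j then (-1) ^ (?r + j) * ?v j else 0)"
      proof -
        have "length u = length (insort i ?s)" "?r < length (insort i ?s)"
          using True r(1) l by simp_all
        from vbracket_expand_row[OF this] show ?thesis unfolding r(2,3) .
      qed
      ultimately show ?thesis
        unfolding s inversions_Cons[OF Cons.prems]
        by (auto simp del: sum.lessThan_Suc simp: sum_distrib_left power_add simp flip: power_mult_distrib
            intro!: sum.cong)
    next
      case False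
      then have "vbracket (i # w) u = 0" "vbracket (insort i ?s) u = 0"
        using vbracket_support[of "i # w" u] vbracket_support[of "insort i ?s" u] l
        by (metis size_mset length_Cons length_insort)+
      then show ?thesis unfolding s by simp
    qed
  qed
qed

subsection \<open>The Yang-Baxter operator on antisymmetrized words\<close>

text \<open>Balancedness is only about arguments in the carriers, so a map given by
  \<open>lin_ext\<close> may be exchanged for its expansion as a sum there.\<close>

lemma balanced_map_cong:
  assumes "balanced_map R M N P \<beta>'" "Module.module R M" "Module.module R N"
    and eq: "\<And>x z. x \<in> carrier M \<Longrightarrow> z \<in> carrier N \<Longrightarrow> \<beta> x z = \<beta>' x z"
  shows "balanced_map R M N P \<beta>"
proof -
  interpret M: Module.module R M by fact
  interpret N: Module.module R N by fact
  show ?thesis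
    using assms(1) by (simp add: balanced_map_def additive_map_def eq Pi_def)
qed

section \<open>Linear maps out of free modules\<close>

lemma lin_ext_mod_hom:
  assumes N: "Module.module R N" and B: "finite B" and g: "\<And>b. b \<in> B \<Longrightarrow> g b \<in> carrier N"
  shows "lin_ext R N g \<in> mod_hom R (free_module R B) N"
proof -
  interpret N: Module.module R N by fact
  let ?F = "free_module R B"
  interpret F: Module.module R ?F by (rule module_free_module[OF N.is_cring])
  have eq: "lin_ext R N g f = (\<Oplus>\<^bsub>N\<^esub>b\<in>B. f b \<odot>\<^bsub>N\<^esub> g b)" if "f \<in> carrier ?F" for f
    by (rule lin_ext_eq[OF N B that g])
  have c: "f b \<odot>\<^bsub>N\<^esub> g b \<in> carrier N" if "f \<in> carrier ?F" "b \<in> B" for f b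
    using free_module_carrierD(1)[OF that(1)] g[OF that(2)] by simp
  show ?thesis
  proof (intro mod_homI additive_mapI)
    fix f assume f: "f \<in> carrier ?F"
    show "lin_ext R N g f \<in> carrier N"
      using c f by (simp add: eq)
    show "lin_ext R N g (r \<odot>\<^bsub>?F\<^esub> f) = r \<odot>\<^bsub>N\<^esub> lin_ext R N g f" if r: "r \<in> carrier R" for r
    proof -
      have "lin_ext R N g (r \<odot>\<^bsub>?F\<^esub> f) = (\<Oplus>\<^bsub>N\<^esub>b\<in>B. r \<odot>\<^bsub>N\<^esub> (f b \<odot>\<^bsub>N\<^esub> g b))"
        unfolding eq[OF F.smult_closed[OF r f]]
        using r free_module_carrierD(1)[OF f] g
        by (intro N.finsum_cong') (auto simp: N.smult_assoc1)
      then show ?thesis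
        using N.finsum_smult_ldistr[OF B r, of "\<lambda>b. f b \<odot>\<^bsub>N\<^esub> g b"] c[OF f] by (simp add: eq[OF f])
    qed
    fix f' assume f': "f' \<in> carrier ?F"
    have "lin_ext R N g (f \<oplus>\<^bsub>?F\<^esub> f') = (\<Oplus>\<^bsub>N\<^esub>b\<in>B. f b \<odot>\<^bsub>N\<^esub> g b \<oplus>\<^bsub>N\<^esub> f' b \<odot>\<^bsub>N\<^esub> g b)"
      unfolding eq[OF F.a_closed[OF f f']]
      using free_module_carrierD(1)[OF f] free_module_carrierD(1)[OF f'] g
      by (intro N.finsum_cong') (auto simp: N.smult_l_distr)
    then show "lin_ext R N g (f \<oplus>\<^bsub>?F\<^esub> f') = lin_ext R N g f \<oplus>\<^bsub>N\<^esub> lin_ext R N g f'"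
      using c[OF f] c[OF f'] by (simp add: eq[OF f] eq[OF f'] N.finsum_addf)
  qed
qed

lemma lin_ext_basis_vec:
  assumes N: "Module.module R N" and B: "finite B" and g: "\<And>b. b \<in> B \<Longrightarrow> g b \<in> carrier N"
    and c: "c \<in> B"
  shows "lin_ext R N g (basis_vec R c) = g c"
proof -
  interpret N: Module.module R N by fact
  have "lin_ext R N g (basis_vec R c) = (\<Oplus>\<^bsub>N\<^esub>b\<in>B. basis_vec R c b \<odot>\<^bsub>N\<^esub> g b)"
    by (rule lin_ext_eq[OF N B basis_vec_closed[OF N.is_cring c] g])
  also have "\<dots> = g c"
    using N.finsum_single[OF B c, of "\<lambda>b. basis_vec R c b \<odot>\<^bsub>N\<^esub> g b"] g[OF c] g
    by (simp add: basis_vec_def)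
  finally show ?thesis .
qed

lemma mod_hom_free_eqI:
  assumes R: "cring R" and N: "Module.module R N" and B: "finite B"
    and F: "F \<in> mod_hom R (free_module R B) N" and G: "G \<in> mod_hom R (free_module R B) N"
    and eq: "\<And>b. b \<in> B \<Longrightarrow> F (basis_vec R b) = G (basis_vec R b)"
    and f: "f \<in> carrier (free_module R B)"
  shows "F f = G f"
proof -
  interpret N: Module.module R N by fact
  let ?F = "free_module R B"
  interpret F: Module.module R ?F by (rule module_free_module[OF R])
  have *: "H f = (\<Oplus>\<^bsub>N\<^esub>b\<in>B. f b \<odot>\<^bsub>N\<^esub> H (basis_vec R b))" if H: "H \<in> mod_hom R ?F N" for H
  proof -
    have c: "f b \<odot>\<^bsub>?F\<^esub> basis_vec R b \<in> carrier ?F" if "b \<in> B" for b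
      by (rule F.smult_closed[OF free_module_carrierD(1)[OF f] basis_vec_closed[OF R that]])
    have "H f = H (\<Oplus>\<^bsub>?F\<^esub>b\<in>B. f b \<odot>\<^bsub>?F\<^esub> basis_vec R b)"
      using free_module_expand[OF R B f] by simp
    also have "\<dots> = (\<Oplus>\<^bsub>N\<^esub>b\<in>B. H (f b \<odot>\<^bsub>?F\<^esub> basis_vec R b))"
      by (rule additive_map_finsum[OF F.abelian_group_axioms N.abelian_group_axioms mod_hom_additive[OF H] B c])
    also have "\<dots> = (\<Oplus>\<^bsub>N\<^esub>b\<in>B. f b \<odot>\<^bsub>N\<^esub> H (basis_vec R b))"
    proof (rule N.finsum_cong'[OF refl])
      have "H (basis_vec R b) \<in> carrier N" if "b \<in> B" for b
        by (rule additive_map_closed[OF mod_hom_additive[OF H] basis_vec_closed[OF R that]])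
      then show "(\<lambda>b. f b \<odot>\<^bsub>N\<^esub> H (basis_vec R b)) \<in> B \<rightarrow> carrier N"
        using free_module_carrierD(1)[OF f] by auto
      show "H (f b \<odot>\<^bsub>?F\<^esub> basis_vec R b) = f b \<odot>\<^bsub>N\<^esub> H (basis_vec R b)" if "b \<in> B" for b
        by (rule mod_hom_smult[OF H free_module_carrierD(1)[OF f] basis_vec_closed[OF R that]])
    qed
    finally show ?thesis .
  qed
  have "(\<Oplus>\<^bsub>N\<^esub>b\<in>B. f b \<odot>\<^bsub>N\<^esub> F (basis_vec R b)) = (\<Oplus>\<^bsub>N\<^esub>b\<in>B. f b \<odot>\<^bsub>N\<^esub> G (basis_vec R b))"
  proof (rule N.finsum_cong'[OF refl])
    have "G (basis_vec R b) \<in> carrier N" if "b \<in> B" for b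
      by (rule additive_map_closed[OF mod_hom_additive[OF G] basis_vec_closed[OF R that]])
    then show "(\<lambda>b. f b \<odot>\<^bsub>N\<^esub> G (basis_vec R b)) \<in> B \<rightarrow> carrier N"
      using free_module_carrierD(1)[OF f] by auto
  qed (simp add: eq)
  then show ?thesis using *[OF F] *[OF G] by simp
qed

lemma (in module) finsum_smult_rdistr:
  assumes "finite I" "\<And>i. i \<in> I \<Longrightarrow> c i \<in> carrier R" "x \<in> carrier M"
  shows "(\<Oplus>\<^bsub>M\<^esub>i\<in>I. c i \<odot>\<^bsub>M\<^esub> x) = (\<Oplus>i\<in>I. c i) \<odot>\<^bsub>M\<^esub> x"
  using assms by (induction I rule: finite_induct) (simp_all add: Pi_def smult_l_distr)

lemma mod_hom_comp:
  "f \<in> mod_hom R M N \<Longrightarrow> g \<in> mod_hom R N P \<Longrightarrow> (\<lambda>x. g (f x)) \<in> mod_hom R M P"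
  by (auto simp: mod_hom_def Pi_def)

lemma (in tensor_pair) tens_mod_hom:
  assumes "x \<in> carrier M"
  shows "tens R M N x \<in> mod_hom R N T"
  using assms
  by (intro mod_homI additive_mapI) (simp_all add: tens_closed tens_add_right smult_tens tens_smult)

section \<open>Tensor powers of V and words\<close>

lemma module_Vpow: "Module.module KK (Vpow m n)"
  by (rule module_free_module[OF cring_KK])

lemma Vpow_carrier_iff: "f \<in> carrier (Vpow m n) \<longleftrightarrow> (\<forall>u. u \<notin> words m n \<longrightarrow> f u = 0)"
  using free_module_carrierI[OF finite_words[of m n], of f KK] free_module_carrierD(2)[of f KK "words m n"]
  by auto

lemma vtens_closed: "w \<in> words m n \<Longrightarrow> vtens w \<in> carrier (Vpow m n)"
  by (rule basis_vec_closed[OF cring_KK])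

lemma finsum_Vpow:
  assumes "finite I" "\<And>i. i \<in> I \<Longrightarrow> f i \<in> carrier (Vpow m n)"
  shows "finsum (Vpow m n) f I = (\<lambda>u. \<Sum>i\<in>I. f i u)"
  using finsum_free_module[OF cring_KK assms] finsum_type_ring[OF cring_KK assms(1)] by auto

lemma lin_ext_Vpow:
  assumes "f \<in> carrier (Vpow m n')" "\<And>w. w \<in> words m n' \<Longrightarrow> g w \<in> carrier (Vpow m n)"
  shows "lin_ext KK (Vpow m n) g f = (\<lambda>u. \<Sum>w\<in>words m n'. f w * g w u)"
proof -
  have "f w \<odot>\<^bsub>Vpow m n\<^esub> g w \<in> carrier (Vpow m n)" if "w \<in> words m n'" for w
    using assms(2)[OF that] by (simp add: Vpow_carrier_iff)
  then show ?thesis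
    using lin_ext_eq[OF module_Vpow finite_words assms] finsum_Vpow[OF finite_words, where f = "\<lambda>w. f w \<odot>\<^bsub>Vpow m n\<^esub> g w"]
    by simp
qed

definition swap_adj :: "nat \<Rightarrow> 'a list \<Rightarrow> 'a list"
  where "swap_adj p w = w[p := w ! Suc p, Suc p := w ! p]"

lemma swap_adj_decomp:
  assumes "Suc p < length w"
  shows "take p w @ [w ! p, w ! Suc p] @ drop (p + 2) w = w"
    and "take p w @ [w ! Suc p, w ! p] @ drop (p + 2) w = swap_adj p w"
proof -
  show 1: "take p w @ [w ! p, w ! Suc p] @ drop (p + 2) w = w"
    using assms by (simp add: Cons_nth_drop_Suc)
  have "swap_adj (length us) (us @ [a, b] @ vs) = us @ [b, a] @ vs" for us vs and a b :: 'a
    by (simp add: swap_adj_def list_update_append nth_append)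
  from this[of "take p w" "w ! p" "w ! Suc p" "drop (p + 2) w"]
  show "take p w @ [w ! Suc p, w ! p] @ drop (p + 2) w = swap_adj p w"
    unfolding 1 using assms by simp
qed

lemma words_nth: "w \<in> words m n \<Longrightarrow> i < n \<Longrightarrow> w ! i \<in> {1..m}"
  unfolding words_def using nth_mem[of i w] by blast

lemma swap_adj_words:
  assumes "w \<in> words m n" "p + 2 \<le> n"
  shows "swap_adj p w \<in> words m n"
proof -
  have "set (swap_adj p w) \<subseteq> {1..m}"
    unfolding swap_adj_def using assms words_nth[OF assms(1)]
    by (intro set_update_subsetI) (auto simp: words_def)
  then show ?thesis using assms(1) by (simp add: words_def swap_adj_def)
qed

lemma swap_adj_swap_adj: "Suc p < length w \<Longrightarrow> swap_adj p (swap_adj p w) = w"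
  by (rule nth_equalityI) (simp_all add: swap_adj_def nth_list_update)

lemma swap_adj_nth:
  "Suc p < length w \<Longrightarrow> swap_adj p w ! p = w ! Suc p"
  "Suc p < length w \<Longrightarrow> swap_adj p w ! Suc p = w ! p"
  "length (swap_adj p w) = length w"
  by (simp_all add: swap_adj_def)

lemma YB_basis_closed: "i \<in> {1..m} \<Longrightarrow> j \<in> {1..m} \<Longrightarrow> YB_basis i j \<in> carrier (Vpow m 2)"
  unfolding Vpow_carrier_iff by (auto simp: YB_basis_def basis_vec_def words_def)

lemma words_2_nth: "w \<in> words m 2 \<Longrightarrow> w ! 0 \<in> {1..m} \<and> w ! 1 \<in> {1..m}"
  using words_nth[of w m 2 0] words_nth[of w m 2 1] by simp

lemma YB_mod_hom: "YB m \<in> mod_hom KK (Vpow m 2) (Vpow m 2)"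
  unfolding YB_def using words_2_nth
  by (intro lin_ext_mod_hom module_Vpow finite_words YB_basis_closed) auto

lemma YB_vtens: "i \<in> {1..m} \<Longrightarrow> j \<in> {1..m} \<Longrightarrow> YB m (vtens [i, j]) = YB_basis i j"
  unfolding YB_def using words_2_nth
  by (subst lin_ext_basis_vec[OF module_Vpow finite_words YB_basis_closed]) (auto simp: words_def)

text \<open>The value of R at the places p and p + 1 on the word \<open>w\<close>. If the two
  letters agree, the swap is the identity, so the second branch also covers R(v_i (x) v_i).\<close>

definition YB_word :: "nat \<Rightarrow> nat list \<Rightarrow> (nat list \<Rightarrow> ratfun)"
  where "YB_word p w =
    (if w ! p < w ! Suc p then (\<lambda>u. (1 - yvar^2) * vtens w u + yvar^2 * vtens (swap_adj p w) u)
     else vtens (swap_adj p w))"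

lemma YB_word_closed: "w \<in> words m n \<Longrightarrow> p + 2 \<le> n \<Longrightarrow> YB_word p w \<in> carrier (Vpow m n)"
  using swap_adj_words[of w m n p] by (auto simp: Vpow_carrier_iff YB_word_def basis_vec_def)

lemma sum_basis_vec:
  fixes X :: "nat list \<Rightarrow> ratfun"
  assumes "v \<in> words m n"
  shows "(\<Sum>w\<in>words m n. vtens v w * X w) = X v"
  using assms by (simp add: basis_vec_def finite_words if_distrib[where f = "\<lambda>c. c * _"] sum.delta cong: if_cong)

lemma words_splice:
  assumes "w \<in> words m (p + 2 + q)" "u \<in> words m 2"
  shows "take p w @ u @ drop (p + 2) w \<in> words m (p + 2 + q)"
  using assms by (auto simp: words_def dest: in_set_takeD in_set_dropD)

text \<open>Only the two words made of the letters at p and p + 1 contribute, and splicing them back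
  gives \<open>w\<close> and its swap.\<close>

lemma YB_at_inner:
  assumes w: "w \<in> words m (p + 2 + q)"
  shows "lin_ext KK (Vpow m (p + 2 + q)) (\<lambda>u. vtens (take p w @ u @ drop (p + 2) w))
    (YB m (vtens (take 2 (drop p w)))) = YB_word p w"
proof
  fix u
  let ?i = "w ! p" and ?j = "w ! Suc p" and ?t = "\<lambda>u. vtens (take p w @ u @ drop (p + 2) w)"
  have l: "Suc p < length w" using w by (simp add: words_def)
  have ij: "?i \<in> {1..m}" "?j \<in> {1..m}"
    using words_nth[OF w, of p] words_nth[OF w, of "Suc p"] by simp_all
  have t: "take 2 (drop p w) = [?i, ?j]"
    using l by (simp add: numeral_2_eq_2 flip: Cons_nth_drop_Suc)
  have ws: "[?i, ?j] \<in> words m 2" "[?j, ?i] \<in> words m 2" using ij by (auto simp: words_def)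
  have "lin_ext KK (Vpow m (p + 2 + q)) ?t (YB m (vtens (take 2 (drop p w)))) u
    = (\<Sum>v\<in>words m 2. YB_basis ?i ?j v * ?t v u)"
    unfolding t YB_vtens[OF ij]
    by (subst lin_ext_Vpow[OF YB_basis_closed[OF ij] vtens_closed[OF words_splice[OF w]]]) simp_all
  also have "\<dots> = (if ?i < ?j then (1 - yvar^2) * ?t [?i, ?j] u + yvar^2 * ?t [?j, ?i] u else ?t [?j, ?i] u)"
    using sum_basis_vec[OF ws(1), of "\<lambda>v. ?t v u"] sum_basis_vec[OF ws(2), of "\<lambda>v. ?t v u"]
    by (simp add: YB_basis_def distrib_right sum.distrib mult.assoc flip: sum_distrib_left)
  also have "\<dots> = YB_word p w u"
    unfolding swap_adj_decomp[OF l] by (simp add: YB_word_def)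
  finally show "lin_ext KK (Vpow m (p + 2 + q)) ?t (YB m (vtens (take 2 (drop p w)))) u = YB_word p w u" .
qed

lemma YB_at_mod_hom: "YB_at m p q \<in> mod_hom KK (Vpow m (p + 2 + q)) (Vpow m (p + 2 + q))"
  unfolding YB_at_def
  by (intro lin_ext_mod_hom module_Vpow finite_words) (simp only: YB_at_inner, rule YB_word_closed, simp_all)

lemma YB_at_eq:
  assumes "f \<in> carrier (Vpow m (p + 2 + q))"
  shows "YB_at m p q f = (\<lambda>u. \<Sum>w\<in>words m (p + 2 + q). f w * YB_word p w u)"
proof -
  let ?N = "Vpow m (p + 2 + q)"
  let ?g = "\<lambda>w. lin_ext KK ?N (\<lambda>u. vtens (take p w @ u @ drop (p + 2) w)) (YB m (vtens (take 2 (drop p w))))"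
  have "?g w \<in> carrier ?N" if "w \<in> words m (p + 2 + q)" for w
    unfolding YB_at_inner[OF that] by (rule YB_word_closed[OF that]) simp
  then have "YB_at m p q f = (\<lambda>u. \<Sum>w\<in>words m (p + 2 + q). f w * ?g w u)"
    unfolding YB_at_def by (rule lin_ext_Vpow[OF assms])
  also have "\<dots> = (\<lambda>u. \<Sum>w\<in>words m (p + 2 + q). f w * YB_word p w u)"
    by (intro ext sum.cong refl) (simp only: YB_at_inner)
  finally show ?thesis .
qed

text \<open>Characteristic different from 2. It makes alternating vectors vanish at words with equal
  neighbours, where R would otherwise act by 1, and it finishes the cancellation in the square of
  the Koszul differential.\<close>

lemma ratfun_eq_minus_iff:
  fixes x :: ratfun
  shows "x = - x \<longleftrightarrow> x = 0"
proof -
  have "(2::ratfun) \<noteq> 0"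
  proof -
    have "(2::ratfun) = Fract 1 1 + Fract 1 1" by (simp add: One_fract_def[symmetric])
    also have "\<dots> = Fract 2 1" by simp
    finally show ?thesis
      using eq_fract(1)[of 1 1 "2 :: complex poly" 0] by (simp add: Zero_fract_def)
  qed
  moreover have "x = - x \<longleftrightarrow> 2 * x = 0" by (metis add.right_inverse add_eq_0_iff mult_2)
  ultimately show ?thesis by simp
qed

text \<open>With s the swap, the coefficient of the image at u is (1 - y^2) f(u) + f(s u) on an
  ascent and y^2 f(s u) on a descent. Both equal -y^2 f(u) as f(s u) = -f(u), and at equal
  neighbours f(u) = 0.\<close>

lemma YB_at_alternating:
  assumes f: "f \<in> carrier (Vpow m (p + 2 + q))"
    and alt: "\<And>u. u \<in> words m (p + 2 + q) \<Longrightarrow> f (swap_adj p u) = - f u"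
  shows "YB_at m p q f = (\<lambda>u. - (yvar^2) * f u)"
proof
  fix u
  let ?W = "words m (p + 2 + q)"
  show "YB_at m p q f u = - (yvar^2) * f u"
  proof (cases "u \<in> ?W")
    case False
    have "f w * YB_word p w u = 0" if "w \<in> ?W" for w
      using YB_word_closed[OF that, of p] False by (simp add: Vpow_carrier_iff)
    then have "YB_at m p q f u = 0"
      unfolding YB_at_eq[OF f] by (intro sum.neutral ballI)
    then show ?thesis
      using f False by (simp add: Vpow_carrier_iff)
  next
    case True
    let ?s = "swap_adj p u"
    have len: "Suc p < length w" if "w \<in> ?W" for w using that by (simp add: words_def)
    have s: "?s \<in> ?W" by (rule swap_adj_words[OF True]) simp
    have inv: "u = swap_adj p w \<longleftrightarrow> w = ?s" if "w \<in> ?W" for w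
      using swap_adj_swap_adj[OF len[OF that]] swap_adj_swap_adj[OF len[OF True]] by auto
    note nth = swap_adj_nth(1,2)[OF len[OF True]]
    have eq: "u ! p = u ! Suc p \<Longrightarrow> ?s = u"
      by (simp add: swap_adj_def) (metis list_update_id)
    \<comment> \<open>Row u of the matrix of R: the same numbers as in \<open>YB_word\<close>, but
      with the target u fixed and the source w varying. Hence the swapped word enters with
      coefficient 1 on an ascent of u and with y^2 on a descent.\<close>
    have word: "YB_word p w u = (if u ! p < u ! Suc p then (1 - yvar^2) * vtens u w + vtens ?s w
        else if u ! Suc p < u ! p then yvar^2 * vtens ?s w else vtens u w)" if w: "w \<in> ?W" for w
      using inv[OF w] nth eq by (auto simp: YB_word_def basis_vec_def)
    have d: "(\<Sum>w\<in>?W. vtens v w * f w) = f v" if "v \<in> ?W" for v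
      by (rule sum_basis_vec[OF that])
    have "YB_at m p q f u = (if u ! p < u ! Suc p then (1 - yvar^2) * f u + f ?s
        else if u ! Suc p < u ! p then yvar^2 * f ?s else f u)"
    proof -
      have "(\<Sum>w\<in>?W. f w * (a * vtens u w + b * vtens ?s w))
          = a * (\<Sum>w\<in>?W. vtens u w * f w) + b * (\<Sum>w\<in>?W. vtens ?s w * f w)" for a b
        unfolding sum_distrib_left sum.distrib[symmetric] by (intro sum.cong refl) (simp add: algebra_simps)
      then have *: "(\<Sum>w\<in>?W. f w * (a * vtens u w + b * vtens ?s w)) = a * f u + b * f ?s" for a b
        unfolding d[OF True] d[OF s] .
      have "YB_at m p q f u = (\<Sum>w\<in>?W. f w * (if u ! p < u ! Suc p then (1 - yvar^2) * vtens u w + vtens ?s w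
        else if u ! Suc p < u ! p then yvar^2 * vtens ?s w else vtens u w))"
        unfolding YB_at_eq[OF f] by (intro sum.cong refl) (simp only: word)
      then show ?thesis
        using *[of "1 - yvar^2" 1] *[of 0 "yvar^2"] *[of 1 0] by simp
    qed
    moreover have "f u = 0" if "u ! p = u ! Suc p"
      using alt[OF True] eq[OF that] ratfun_eq_minus_iff by metis
    ultimately show ?thesis
      using alt[OF True] by (auto simp: algebra_simps)
  qed
qed

lemma vbracket_swap_adj:
  assumes "w \<in> words m n" "u \<in> words m n" "p + 2 \<le> n"
  shows "vbracket w (swap_adj p u) = - vbracket w u"
  unfolding swap_adj_def using assms by (intro vbracket_swap) (auto simp: words_def)

lemma foldr_YB_at_mod_hom:
  assumes "\<And>p. p \<in> set ps \<Longrightarrow> p + 2 \<le> n"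
  shows "foldr (\<lambda>p g. YB_at m p (n - 2 - p) \<circ> g) ps id \<in> mod_hom KK (Vpow m n) (Vpow m n)"
  using assms
proof (induction ps)
  case Nil
  then show ?case by (auto simp: mod_hom_def)
next
  case (Cons p ps)
  \<comment> \<open>Subtraction is truncated, so the number of factors is recovered only because p +
    2 is at most n.\<close>
  have n: "p + 2 + (n - 2 - p) = n" using Cons.prems[of p] by simp
  have "YB_at m p (n - 2 - p) \<in> mod_hom KK (Vpow m n) (Vpow m n)"
    using YB_at_mod_hom[of m p "n - 2 - p"] by (simp only: n)
  then show ?case
    using mod_hom_comp[OF Cons.IH] Cons.prems by (simp add: comp_def)
qed

lemma YB_d_mod_hom: "k \<le> n \<Longrightarrow> YB_d m n k \<in> mod_hom KK (Vpow m n) (Vpow m n)"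
  unfolding YB_d_def by (rule foldr_YB_at_mod_hom) auto

text \<open>A multiple of a bracket still changes sign under every adjacent swap, so each further
  factor contributes another -y^2.\<close>

lemma foldr_YB_at_vbracket:
  assumes w: "w \<in> words m n" and "\<And>p. p \<in> set ps \<Longrightarrow> p + 2 \<le> n"
  shows "foldr (\<lambda>p g. YB_at m p (n - 2 - p) \<circ> g) ps id (vbracket w)
    = (\<lambda>u. (- (yvar^2)) ^ length ps * vbracket w u)"
  using assms(2)
proof (induction ps)
  case (Cons p ps)
  have n: "p + 2 + (n - 2 - p) = n" "p + 2 \<le> n" using Cons.prems[of p] by simp_all
  let ?f = "\<lambda>u. (- (yvar^2)) ^ length ps * vbracket w u"
  have "?f \<in> carrier (Vpow m n)"
    using vbracket_closed[OF w] by (simp add: Vpow_carrier_iff)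
  then have "YB_at m p (n - 2 - p) ?f = (\<lambda>u. - (yvar^2) * ?f u)"
    using YB_at_alternating[of ?f m p "n - 2 - p"] vbracket_swap_adj[OF w _ n(2)] n by simp
  then show ?case using Cons by (simp add: mult.assoc)
qed simp

lemma YB_d_vbracket:
  "w \<in> words m n \<Longrightarrow> k \<le> n \<Longrightarrow> YB_d m n k (vbracket w) = (\<lambda>u. (- (yvar^2)) ^ (k - 1) * vbracket w u)"
  unfolding YB_d_def by (subst foldr_YB_at_vbracket) auto

subsection \<open>The one-term differential\<close>

lemma mod_hom_closed: "f \<in> mod_hom R M N \<Longrightarrow> x \<in> carrier M \<Longrightarrow> f x \<in> carrier N"
  by (auto simp: mod_hom_def)

lemma mod_hom_ident: "(\<lambda>x. x) \<in> mod_hom R M M"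
  by (simp add: mod_hom_def)

lemma mod_hom_smult_map:
  assumes "Module.module R N" "f \<in> mod_hom R M N" "r \<in> carrier R"
  shows "(\<lambda>x. r \<odot>\<^bsub>N\<^esub> f x) \<in> mod_hom R M N"
proof -
  interpret N: Module.module R N by fact
  show ?thesis
    using assms(2,3) by (auto simp: mod_hom_def Pi_def N.smult_r_distr N.m_comm simp flip: N.smult_assoc1)
qed

lemma mod_hom_finsum_map:
  assumes "Module.module R N" "finite I" "\<And>i. i \<in> I \<Longrightarrow> (\<lambda>x. f x i) \<in> mod_hom R M N"
  shows "(\<lambda>x. \<Oplus>\<^bsub>N\<^esub>i\<in>I. f x i) \<in> mod_hom R M N"
proof (rule mod_homI)
  interpret N: Module.module R N by fact
  show "additive_map M N (\<lambda>x. \<Oplus>\<^bsub>N\<^esub>i\<in>I. f x i)"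
    by (rule additive_map_finsum_fun[OF N.abelian_group_axioms assms(2) mod_hom_additive[OF assms(3)]])
  fix r x assume rx: "r \<in> carrier R" "x \<in> carrier M"
  have c: "f x i \<in> carrier N" if "i \<in> I" for i
    by (rule mod_hom_closed[OF assms(3)[OF that] rx(2)])
  have "(\<Oplus>\<^bsub>N\<^esub>i\<in>I. f (r \<odot>\<^bsub>M\<^esub> x) i) = (\<Oplus>\<^bsub>N\<^esub>i\<in>I. r \<odot>\<^bsub>N\<^esub> f x i)"
    using mod_hom_smult[OF assms(3) rx] c rx by (intro N.finsum_cong') auto
  also have "\<dots> = r \<odot>\<^bsub>N\<^esub> (\<Oplus>\<^bsub>N\<^esub>i\<in>I. f x i)"
    using N.finsum_smult_ldistr[OF assms(2) rx(1), of "f x"] c by simp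
  finally show "(\<Oplus>\<^bsub>N\<^esub>i\<in>I. f (r \<odot>\<^bsub>M\<^esub> x) i) = r \<odot>\<^bsub>N\<^esub> (\<Oplus>\<^bsub>N\<^esub>i\<in>I. f x i)" .
qed

lemma words_tl: "w \<in> words m n \<Longrightarrow> n \<ge> 1 \<Longrightarrow> hd w \<in> {1..m} \<and> tl w \<in> words m (n - 1)"
  by (cases w) (auto simp: words_def)

lemma words_Cons: "i \<in> {1..m} \<Longrightarrow> u \<in> words m (n - 1) \<Longrightarrow> n \<ge> 1 \<Longrightarrow> i # u \<in> words m n"
  by (auto simp: words_def)

lemma words_delete_nth: "w \<in> words m n \<Longrightarrow> j < n \<Longrightarrow> delete_nth j w \<in> words m (n - 1)"
  using set_delete_nth[of j w] by (auto simp: words_def)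

text \<open>The tensor v_i (x) g in the word basis.\<close>

definition Cons_tensor :: "nat \<Rightarrow> (nat list \<Rightarrow> ratfun) \<Rightarrow> (nat list \<Rightarrow> ratfun)"
  where "Cons_tensor i g = (\<lambda>v. case v of [] \<Rightarrow> 0 | a # u \<Rightarrow> if a = i then g u else 0)"

lemma Cons_tensor_mod_hom:
  assumes "i \<in> {1..m}" "n \<ge> 1"
  shows "Cons_tensor i \<in> mod_hom KK (Vpow m (n - 1)) (Vpow m n)"
proof (intro mod_homI additive_mapI)
  show "Cons_tensor i g \<in> carrier (Vpow m n)" if "g \<in> carrier (Vpow m (n - 1))" for g
    unfolding Vpow_carrier_iff
  proof (intro allI impI)
    fix u assume "u \<notin> words m n"
    then have "v \<notin> words m (n - 1)" if "u = i # v" for v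
      using words_Cons[OF assms(1) _ assms(2), of v] that by blast
    then have "g v = 0" if "u = i # v" for v
      using \<open>g \<in> _\<close> that unfolding Vpow_carrier_iff by blast
    then show "Cons_tensor i g u = 0"
      by (simp add: Cons_tensor_def split: list.splits)
  qed
qed (auto simp: Cons_tensor_def fun_eq_iff split: list.splits)

lemma Cons_tensor_vtens: "Cons_tensor i (vtens u) = vtens (i # u)"
  by (auto simp: Cons_tensor_def basis_vec_def fun_eq_iff split: list.splits)

text \<open>The first-column Laplace expansion written as an identity of tensors. Places are counted
  from 0, so the sign agrees with that of the Koszul differential.\<close>

lemma vbracket_expand:
  assumes w: "w \<in> words m n" and n: "n \<ge> 1"
  shows "vbracket w = (\<lambda>v. \<Sum>j<n. (-1) ^ j * Cons_tensor (w ! j) (vbracket (delete_nth j w)) v)"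
proof
  fix v
  have l: "length w = n" using w by (simp add: words_def)
  show "vbracket w v = (\<Sum>j<n. (-1) ^ j * Cons_tensor (w ! j) (vbracket (delete_nth j w)) v)"
  proof (cases "length v = n")
    case True
    then obtain a u where v: "v = a # u" using n by (cases v) auto
    then show ?thesis
      using vbracket_expand_column[of u w a] True l
      by (auto simp del: sum.lessThan_Suc simp: Cons_tensor_def intro!: sum.cong)
  next
    case False
    have "Cons_tensor (w ! j) (vbracket (delete_nth j w)) v = 0" if "j < n" for j
    proof (cases v)
      case (Cons a u)
      then have "length u \<noteq> length (delete_nth j w)" using False that l by auto
      then have "vbracket (delete_nth j w) u = 0"
        using vbracket_support[of "delete_nth j w" u] by (metis size_mset)
      then show ?thesis using Cons by (simp add: Cons_tensor_def)
    qed (simp add: Cons_tensor_def)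
    moreover have "vbracket w v = 0"
      using vbracket_support[of w v] False l by (metis size_mset)
    ultimately show ?thesis by simp
  qed
qed

locale YB_module =
  fixes m :: nat and M :: "(ratfun, 'a) module"
    and RM :: "('a \<times> (nat list \<Rightarrow> ratfun) \<Rightarrow>\<^sub>0 int) set \<Rightarrow> 'a"
  assumes V_module: "V_module m M RM"
begin

sublocale M: Module.module KK M
  using V_module by (simp add: V_module_def)

sublocale MV: free_tensor KK M "words m n" for n
  by (intro free_tensor.intro free_tensor_axioms.intro M.module_axioms finite_words)

definition act :: "nat \<Rightarrow> 'a \<Rightarrow> 'a"
  where "act i x = RM (MVtens m M 1 x (vtens [i]))"

lemma RM_mod_hom: "RM \<in> mod_hom KK (MV m M 1) M"
  using V_module by (simp add: V_module_def)

lemma tens_left_mod_hom: "f \<in> carrier (Vpow m n) \<Longrightarrow> (\<lambda>x. MVtens m M n x f) \<in> mod_hom KK M (MV m M n)"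
  by (intro mod_homI additive_mapI) (simp_all add: MV.tens_closed MV.tens_add_left MV.smult_tens)

lemma act_mod_hom: "i \<in> {1..m} \<Longrightarrow> act i \<in> mod_hom KK M M"
  using mod_hom_comp[OF tens_left_mod_hom[OF vtens_closed] RM_mod_hom, of "[i]"]
  by (simp add: act_def[abs_def] words_def)

lemma act_closed: "i \<in> {1..m} \<Longrightarrow> x \<in> carrier M \<Longrightarrow> act i x \<in> carrier M"
  by (rule mod_hom_closed[OF act_mod_hom])

abbreviation "head_map n w x \<equiv> MVtens m M (n - 1) (act (hd w) x) (vtens (tl w))"

lemma head_map_mod_hom:
  assumes "n \<ge> 1" "w \<in> words m n"
  shows "head_map n w \<in> mod_hom KK M (MV m M (n - 1))"
  using words_tl[OF assms(2,1)]
  by (intro mod_hom_comp[OF act_mod_hom tens_left_mod_hom[OF vtens_closed]]) simp_all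

text \<open>Linearity of the action moves the coefficient from the outside onto x, which is the
  shape required by \<open>balanced_map_free\<close>.\<close>

lemma RM_id_kernel_eq:
  assumes n: "n \<ge> 1" and x: "x \<in> carrier M" and f: "f \<in> carrier (Vpow m n)"
  shows "lin_ext KK (MV m M (n - 1))
       (\<lambda>w. MVtens m M (n - 1) (RM (MVtens m M 1 x (vtens [hd w]))) (vtens (tl w))) f
    = (\<Oplus>\<^bsub>MV m M (n - 1)\<^esub>w\<in>words m n. head_map n w (f w \<odot>\<^bsub>M\<^esub> x))"
proof -
  have c: "head_map n w x \<in> carrier (MV m M (n - 1))" if "w \<in> words m n" for w
    by (rule mod_hom_closed[OF head_map_mod_hom[OF n that] x])
  have "lin_ext KK (MV m M (n - 1)) (\<lambda>w. head_map n w x) f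
      = (\<Oplus>\<^bsub>MV m M (n - 1)\<^esub>w\<in>words m n. f w \<odot>\<^bsub>MV m M (n - 1)\<^esub> head_map n w x)"
    by (rule lin_ext_eq[OF MV.module_tensor finite_words f c])
  also have "\<dots> = (\<Oplus>\<^bsub>MV m M (n - 1)\<^esub>w\<in>words m n. head_map n w (f w \<odot>\<^bsub>M\<^esub> x))"
  proof (rule MV.T.finsum_cong'[OF refl])
    show "(\<lambda>w. head_map n w (f w \<odot>\<^bsub>M\<^esub> x)) \<in> words m n \<rightarrow> carrier (MV m M (n - 1))"
      using mod_hom_closed[OF head_map_mod_hom[OF n]] x by auto
    show "f w \<odot>\<^bsub>MV m M (n - 1)\<^esub> head_map n w x = head_map n w (f w \<odot>\<^bsub>M\<^esub> x)" if "w \<in> words m n" for w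
      using mod_hom_smult[OF head_map_mod_hom[OF n that], of "f w" x] x by simp
  qed
  finally show ?thesis by (simp add: act_def)
qed

lemma balanced_RM_id:
  assumes n: "n \<ge> 1"
  shows "balanced_map KK M (Vpow m n) (MV m M (n - 1)) (\<lambda>x. lin_ext KK (MV m M (n - 1))
       (\<lambda>w. MVtens m M (n - 1) (RM (MVtens m M 1 x (vtens [hd w]))) (vtens (tl w))))"
proof (rule balanced_map_cong[OF _ M.module_axioms module_Vpow RM_id_kernel_eq[OF n]])
  show "balanced_map KK M (Vpow m n) (MV m M (n - 1))
      (\<lambda>x f. \<Oplus>\<^bsub>MV m M (n - 1)\<^esub>w\<in>words m n. head_map n w (f w \<odot>\<^bsub>M\<^esub> x))"
    by (rule balanced_map_free[OF M.module_axioms MV.abelian_group_tensor finite_words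
          mod_hom_additive[OF head_map_mod_hom[OF n]]])
qed

lemma RM_id_vtens:
  assumes n: "n \<ge> 1" and x: "x \<in> carrier M" and w: "w \<in> words m n"
  shows "RM_id m M RM n (MVtens m M n x (vtens w)) = head_map n w x"
proof -
  have "RM_id m M RM n (MVtens m M n x (vtens w))
      = (\<Oplus>\<^bsub>MV m M (n - 1)\<^esub>v\<in>words m n. head_map n v (vtens w v \<odot>\<^bsub>M\<^esub> x))"
    unfolding RM_id_def
    unfolding MV.tensor_lift_tens[OF MV.abelian_group_tensor balanced_RM_id[OF n] x vtens_closed[OF w]]
    by (rule RM_id_kernel_eq[OF n x vtens_closed[OF w]])
  also have "\<dots> = head_map n w x"
    by (rule finsum_basis_vec[OF M.module_axioms MV.abelian_group_tensor finite_words
          mod_hom_additive[OF head_map_mod_hom[OF n]] w x])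
  finally show ?thesis .
qed

lemma RM_id_mod_hom:
  assumes n: "n \<ge> 1"
  shows "RM_id m M RM n \<in> mod_hom KK (MV m M n) (MV m M (n - 1))"
proof (rule mod_homI)
  show add: "additive_map (MV m M n) (MV m M (n - 1)) (RM_id m M RM n)"
    unfolding RM_id_def by (rule MV.additive_tensor_lift[OF MV.abelian_group_tensor balanced_RM_id[OF n]])
  fix c X assume c: "c \<in> carrier KK" and X: "X \<in> carrier (MV m M n)"
  show "RM_id m M RM n (c \<odot>\<^bsub>MV m M n\<^esub> X) = c \<odot>\<^bsub>MV m M (n - 1)\<^esub> RM_id m M RM n X"
  proof (rule MV.basis_additive_map_eqI[OF MV.abelian_group_tensor _ _ _ X])
    show "additive_map (MV m M n) (MV m M (n - 1)) (\<lambda>X. RM_id m M RM n (c \<odot>\<^bsub>MV m M n\<^esub> X))"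
      by (rule additive_map_comp[OF MV.additive_tensor_smult[OF c] add])
    show "additive_map (MV m M n) (MV m M (n - 1)) (\<lambda>X. c \<odot>\<^bsub>MV m M (n - 1)\<^esub> RM_id m M RM n X)"
      by (rule additive_map_comp[OF add MV.additive_tensor_smult[OF c]])
    show "RM_id m M RM n (c \<odot>\<^bsub>MV m M n\<^esub> MVtens m M n x (vtens w))
        = c \<odot>\<^bsub>MV m M (n - 1)\<^esub> RM_id m M RM n (MVtens m M n x (vtens w))"
      if "x \<in> carrier M" "w \<in> words m n" for x w
      using that c mod_hom_smult[OF head_map_mod_hom[OF n that(2)] c that(1)]
      by (simp add: MV.smult_tens vtens_closed RM_id_vtens[OF n])
  qed
qed

text \<open>The wall condition, evaluated on x (x) v_i (x) v_j.\<close>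

lemma act_commute:
  assumes ij: "i \<in> {1..m}" "j \<in> {1..m}" and x: "x \<in> carrier M"
  shows "act i (act j x) = act j (act i x)"
proof -
  \<comment> \<open>On a descending pair R is the plain flip, so the wall condition there is
    literally the commutation, free of powers of y.\<close>
  have *: "act j (act i x) = act i (act j x)" if "j < i" "i \<in> {1..m}" "j \<in> {1..m}" for i j
  proof -
    have w: "[i, j] \<in> words m 2" "[j, i] \<in> words m 2" "[i] \<in> words m 1" "[j] \<in> words m 1"
      using that by (auto simp: words_def)
    let ?X = "MVtens m M 2 x (vtens [i, j])"
    have X: "?X \<in> carrier (MV m M 2)" by (rule MV.tens_closed[OF x vtens_closed[OF w(1)]])
    have "id_tensor KK M (Vpow m 2) (YB m) ?X = MVtens m M 2 x (vtens [j, i])"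
      unfolding id_tensor_tens[OF M.module_axioms module_Vpow module_Vpow YB_mod_hom x vtens_closed[OF w(1)]]
      using that by (simp add: YB_vtens YB_basis_def)
    moreover have "RM (RM_id m M RM 2 ?X) = RM (RM_id m M RM 2 (id_tensor KK M (Vpow m 2) (YB m) ?X))"
      using V_module X by (simp add: V_module_def)
    ultimately show ?thesis
      using RM_id_vtens[OF _ x w(1)] RM_id_vtens[OF _ x w(2)] by (simp add: act_def)
  qed
  show ?thesis
    using *[of i j] *[of j i] ij by (cases i j rule: linorder_cases) auto
qed

text \<open>Both sides are linear in g, which reduces the claim to words; on a word the action
  consumes the first letter.\<close>

lemma RM_id_Cons_tensor:
  assumes n: "n \<ge> 1" and x: "x \<in> carrier M" and i: "i \<in> {1..m}" and g: "g \<in> carrier (Vpow m (n - 1))"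
  shows "RM_id m M RM n (MVtens m M n x (Cons_tensor i g)) = MVtens m M (n - 1) (act i x) g"
proof (rule mod_hom_free_eqI[OF cring_KK MV.module_tensor finite_words _ _ _ g])
  show "(\<lambda>g. RM_id m M RM n (MVtens m M n x (Cons_tensor i g))) \<in> mod_hom KK (Vpow m (n - 1)) (MV m M (n - 1))"
    by (rule mod_hom_comp[OF mod_hom_comp[OF Cons_tensor_mod_hom[OF i n] MV.tens_mod_hom[OF x]] RM_id_mod_hom[OF n]])
  show "MVtens m M (n - 1) (act i x) \<in> mod_hom KK (Vpow m (n - 1)) (MV m M (n - 1))"
    by (rule MV.tens_mod_hom[OF act_closed[OF i x]])
  show "RM_id m M RM n (MVtens m M n x (Cons_tensor i (vtens u))) = MVtens m M (n - 1) (act i x) (vtens u)"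
    if "u \<in> words m (n - 1)" for u
    using RM_id_vtens[OF n x words_Cons[OF i that n]] by (simp add: Cons_tensor_vtens)
qed

lemma RM_id_vbracket:
  assumes n: "n \<ge> 1" and x: "x \<in> carrier M" and w: "w \<in> words m n"
  shows "RM_id m M RM n (MVtens m M n x (vbracket w))
    = (\<Oplus>\<^bsub>MV m M (n - 1)\<^esub>j\<in>{..<n}. (-1) ^ j \<odot>\<^bsub>MV m M (n - 1)\<^esub>
        MVtens m M (n - 1) (act (w ! j) x) (vbracket (delete_nth j w)))"
proof -
  let ?L = "\<lambda>f. RM_id m M RM n (MVtens m M n x f)"
  let ?c = "\<lambda>j. Cons_tensor (w ! j) (vbracket (delete_nth j w))"
  have i: "w ! j \<in> {1..m}" if "j < n" for j by (rule words_nth[OF w that])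
  have b: "vbracket (delete_nth j w) \<in> carrier (Vpow m (n - 1))" if "j < n" for j
    by (rule vbracket_closed[OF words_delete_nth[OF w that]])
  have c: "?c j \<in> carrier (Vpow m n)" if "j < n" for j
    by (rule mod_hom_closed[OF Cons_tensor_mod_hom[OF i[OF that] n] b[OF that]])
  have sc: "(-1) ^ j \<odot>\<^bsub>Vpow m n\<^esub> ?c j \<in> carrier (Vpow m n)" if "j < n" for j
    by (rule module.smult_closed[OF module_Vpow _ c[OF that]]) simp
  have L: "?L \<in> mod_hom KK (Vpow m n) (MV m M (n - 1))"
    by (rule mod_hom_comp[OF MV.tens_mod_hom[OF x] RM_id_mod_hom[OF n]])
  have Lc: "?L (?c j) = MVtens m M (n - 1) (act (w ! j) x) (vbracket (delete_nth j w))" if "j < n" for j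
    by (rule RM_id_Cons_tensor[OF n x i[OF that] b[OF that]])
  have "vbracket w = (\<Oplus>\<^bsub>Vpow m n\<^esub>j\<in>{..<n}. (-1) ^ j \<odot>\<^bsub>Vpow m n\<^esub> ?c j)"
    using vbracket_expand[OF w n] finsum_Vpow[of "{..<n}" "\<lambda>j. (-1) ^ j \<odot>\<^bsub>Vpow m n\<^esub> ?c j" m n] sc by simp
  then have "?L (vbracket w) = ?L (\<Oplus>\<^bsub>Vpow m n\<^esub>j\<in>{..<n}. (-1) ^ j \<odot>\<^bsub>Vpow m n\<^esub> ?c j)" by simp
  also have "\<dots> = (\<Oplus>\<^bsub>MV m M (n - 1)\<^esub>j\<in>{..<n}. ?L ((-1) ^ j \<odot>\<^bsub>Vpow m n\<^esub> ?c j))"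
    by (rule additive_map_finsum[OF module_abelian_group[OF module_Vpow] MV.abelian_group_tensor mod_hom_additive[OF L]])
      (simp_all only: finite_lessThan lessThan_iff sc)
  also have "\<dots> = (\<Oplus>\<^bsub>MV m M (n - 1)\<^esub>j\<in>{..<n}. (-1) ^ j \<odot>\<^bsub>MV m M (n - 1)\<^esub>
        MVtens m M (n - 1) (act (w ! j) x) (vbracket (delete_nth j w)))"
  proof (rule MV.T.finsum_cong'[OF refl])
    show "(\<lambda>j. (-1) ^ j \<odot>\<^bsub>MV m M (n - 1)\<^esub> MVtens m M (n - 1) (act (w ! j) x) (vbracket (delete_nth j w)))
        \<in> {..<n} \<rightarrow> carrier (MV m M (n - 1))"
      using i b act_closed[OF _ x]
      by (intro Pi_I additive_map_closed[OF MV.additive_tensor_smult] MV.tens_closed) auto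
    show "?L ((-1) ^ j \<odot>\<^bsub>Vpow m n\<^esub> ?c j) = (-1) ^ j \<odot>\<^bsub>MV m M (n - 1)\<^esub>
        MVtens m M (n - 1) (act (w ! j) x) (vbracket (delete_nth j w))" if "j \<in> {..<n}" for j
      using mod_hom_smult[OF L, of "(-1) ^ j" "?c j"] c[of j] Lc[of j] that by simp
  qed
  finally show ?thesis .
qed

lemma YB_diff_mod_hom:
  assumes n: "n \<ge> 1"
  shows "YB_diff m M RM n \<in> mod_hom KK (MV m M n) (MV m M (n - 1))"
  unfolding YB_diff_def[abs_def]
proof (intro mod_hom_finsum_map MV.module_tensor finite_atLeastAtMost mod_hom_smult_map)
  fix i assume "i \<in> {1..n}"
  then show "(\<lambda>X. RM_id m M RM n (id_tensor KK M (Vpow m n) (YB_d m n i) X))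
      \<in> mod_hom KK (MV m M n) (MV m M (n - 1))"
    by (intro mod_hom_comp[OF id_tensor_mod_hom RM_id_mod_hom[OF n]] M.module_axioms module_Vpow YB_d_mod_hom) simp
qed simp

text \<open>The alternating sign cancels against that of (-y^2)^(i-1), so the n summands differ only
  by the powers of y^2 from 0 to n - 1.\<close>

lemma YB_diff_vbracket:
  assumes n: "n \<ge> 1" and x: "x \<in> carrier M" and w: "w \<in> words m n"
  shows "YB_diff m M RM n (MVtens m M n x (vbracket w))
    = qint n \<odot>\<^bsub>MV m M (n - 1)\<^esub> RM_id m M RM n (MVtens m M n x (vbracket w))"
proof -
  interpret T: Module.module KK "MV m M (n - 1)" by (rule MV.module_tensor)
  let ?b = "vbracket w"
  let ?Y = "RM_id m M RM n (MVtens m M n x ?b)"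
  have b: "?b \<in> carrier (Vpow m n)" by (rule vbracket_closed[OF w])
  have Y: "?Y \<in> carrier (MV m M (n - 1))"
    by (rule mod_hom_closed[OF RM_id_mod_hom[OF n] MV.tens_closed[OF x b]])
  have L: "(\<lambda>f. RM_id m M RM n (MVtens m M n x f)) \<in> mod_hom KK (Vpow m n) (MV m M (n - 1))"
    by (rule mod_hom_comp[OF MV.tens_mod_hom[OF x] RM_id_mod_hom[OF n]])
  have summand: "(-1) ^ (i - 1) \<odot>\<^bsub>MV m M (n - 1)\<^esub>
       RM_id m M RM n (id_tensor KK M (Vpow m n) (YB_d m n i) (MVtens m M n x ?b))
     = (yvar^2) ^ (i - 1) \<odot>\<^bsub>MV m M (n - 1)\<^esub> ?Y" if i: "i \<in> {1..n}" for i
  proof -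
    have "id_tensor KK M (Vpow m n) (YB_d m n i) (MVtens m M n x ?b) = MVtens m M n x (YB_d m n i ?b)"
      using i by (intro id_tensor_tens M.module_axioms module_Vpow YB_d_mod_hom x b) simp
    also have "YB_d m n i ?b = (- (yvar^2)) ^ (i - 1) \<odot>\<^bsub>Vpow m n\<^esub> ?b"
      using YB_d_vbracket[OF w, of i] i by simp
    finally have "RM_id m M RM n (id_tensor KK M (Vpow m n) (YB_d m n i) (MVtens m M n x ?b))
        = (- (yvar^2)) ^ (i - 1) \<odot>\<^bsub>MV m M (n - 1)\<^esub> ?Y"
      using mod_hom_smult[OF L _ b, of "(- (yvar^2)) ^ (i - 1)"] by simp
    then show ?thesis
      using T.smult_assoc1[of "(-1) ^ (i - 1)" "(- (yvar^2)) ^ (i - 1)" ?Y] Y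
      by (simp flip: power_mult_distrib)
  qed
  have "YB_diff m M RM n (MVtens m M n x ?b)
      = (\<Oplus>\<^bsub>MV m M (n - 1)\<^esub>i\<in>{1..n}. (yvar^2) ^ (i - 1) \<odot>\<^bsub>MV m M (n - 1)\<^esub> ?Y)"
    unfolding YB_diff_def
  proof (rule MV.T.finsum_cong'[OF refl])
    show "(\<lambda>i. (yvar^2) ^ (i - 1) \<odot>\<^bsub>MV m M (n - 1)\<^esub> ?Y) \<in> {1..n} \<rightarrow> carrier (MV m M (n - 1))"
      using Y by (intro Pi_I T.smult_closed) simp_all
  qed (rule summand)
  also have "\<dots> = (\<Oplus>\<^bsub>KK\<^esub>i\<in>{1..n}. (yvar^2) ^ (i - 1)) \<odot>\<^bsub>MV m M (n - 1)\<^esub> ?Y"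
    by (rule T.finsum_smult_rdistr[OF _ _ Y]) simp_all
  also have "(\<Oplus>\<^bsub>KK\<^esub>i\<in>{1..n}. (yvar^2) ^ (i - 1)) = qint n"
    by (simp add: finsum_type_ring[OF cring_KK] qint_def sum.atLeast1_atMost_eq)
  finally show ?thesis .
qed

end

subsection \<open>The polynomial action\<close>

lemma FF_carrier: "carrier (FF m) = {p. \<forall>a\<in>Poly_Mapping.keys p. Poly_Mapping.keys a \<subseteq> {1..m}}"
  by (simp add: FF_def)

lemma FF_simps [simp]:
  "\<zero>\<^bsub>FF m\<^esub> = 0" "\<one>\<^bsub>FF m\<^esub> = 1" "p \<oplus>\<^bsub>FF m\<^esub> q = p + q" "p \<otimes>\<^bsub>FF m\<^esub> q = p * q"
  by (simp_all add: FF_def)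

lemma cring_FF: "cring (FF m)"
  unfolding FF_def
proof (rule cring_type_ring)
  let ?A = "{p :: mpol. \<forall>a\<in>Poly_Mapping.keys p. Poly_Mapping.keys a \<subseteq> {1..m}}"
  fix p q assume p: "p \<in> ?A" and q: "q \<in> ?A"
  show "p + q \<in> ?A"
    using Poly_Mapping.keys_add[of p q] p q by blast
  show "p * q \<in> ?A"
  proof (intro CollectI ballI)
    fix a assume "a \<in> Poly_Mapping.keys (p * q)"
    then obtain b c where "a = b + c" "b \<in> Poly_Mapping.keys p" "c \<in> Poly_Mapping.keys q"
      using keys_mult[of p q] by blast
    then show "Poly_Mapping.keys a \<subseteq> {1..m}"
      using Poly_Mapping.keys_add[of b c] p q by blast
  qed
qed auto

lemma finsum_FF: "finite I \<Longrightarrow> (\<And>i. i \<in> I \<Longrightarrow> f i \<in> carrier (FF m)) \<Longrightarrow> finsum (FF m) f I = sum f I"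
  using finsum_type_ring[of "carrier (FF m)" I f] cring_FF[of m] unfolding FF_def by simp

lemma pconst_ring_hom: "pconst \<in> Ring.ring_hom KK (FF m)"
  by (rule ring_hom_memI) (simp_all add: pconst_def FF_carrier single_add mult_single)

lemma pconst_closed: "pconst c \<in> carrier (FF m)"
  by (simp add: pconst_def FF_carrier)

lemma pvar_closed: "i \<in> {1..m} \<Longrightarrow> pvar i \<in> carrier (FF m)"
  by (simp add: pvar_def FF_carrier)

text \<open>Signs on the Koszul side are polynomials, while the comparison map respects only
  constants from K; they have to be recognised as such constants.\<close>

lemma sign_eq_pconst: "(-1) ^ j = pconst ((-1) ^ j)"
  by (cases "even j") (simp_all add: pconst_def single_uminus)

lemma sign_closed: "(-1) ^ j \<in> carrier (FF m)"
  using pconst_closed sign_eq_pconst by metis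

lemma FF_mult_closed: "p \<in> carrier (FF m) \<Longrightarrow> q \<in> carrier (FF m) \<Longrightarrow> p * q \<in> carrier (FF m)"
  using cring.cring_simprules(5)[OF cring_FF, of p m q] by simp

lemma FF_sum_closed: "(\<And>i. i \<in> I \<Longrightarrow> f i \<in> carrier (FF m)) \<Longrightarrow> sum f I \<in> carrier (FF m)"
proof (induction I rule: infinite_finite_induct)
  case (insert i I)
  then show ?case using cring.cring_simprules(1)[OF cring_FF, of "f i" m "sum f I"] by simp
qed (simp_all add: FF_carrier)

lemma poly_mapping_expand: "p = (\<Sum>a\<in>Poly_Mapping.keys p. Poly_Mapping.single a (Poly_Mapping.lookup p a))"
  by (rule poly_mapping_eqI) (auto simp: lookup_sum lookup_single when_def in_keys_iff)

lemma poly_mapping_induct_single [case_names single add]: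
  fixes p :: "'a \<Rightarrow>\<^sub>0 'b::comm_monoid_add"
  assumes "\<And>a c. P (Poly_Mapping.single a c)" "\<And>p q. P p \<Longrightarrow> P q \<Longrightarrow> P (p + q)"
  shows "P p"
proof -
  have "P (\<Sum>a\<in>A. Poly_Mapping.single a (Poly_Mapping.lookup p a))" if "finite A" for A
    using that
  proof (induction A rule: finite_induct)
    case empty
    then show ?case using assms(1)[of undefined 0] by simp
  qed (use assms in simp)
  then show ?thesis using poly_mapping_expand[of p] by (metis finite_keys)
qed

context YB_module
begin

text \<open>\<open>mono_act\<close> for an arbitrary list of variables and an arbitrary exponent
  function, so that induction on the list is available.\<close>

definition acts :: "nat list \<Rightarrow> (nat \<Rightarrow> nat) \<Rightarrow> 'a \<Rightarrow> 'a"
  where "acts js e = foldr (\<lambda>i g. (act i ^^ e i) \<circ> g) js id"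

lemma acts_simps [simp]: "acts [] e x = x" "acts (i # js) e x = (act i ^^ e i) (acts js e x)"
  by (simp_all add: acts_def)

lemma mono_act_acts: "mono_act m M RM a = acts [1..<Suc m] (Poly_Mapping.lookup a)"
  by (simp add: mono_act_def acts_def act_def[abs_def])

lemma funpow_act_mod_hom: "i \<in> {1..m} \<Longrightarrow> (act i ^^ k) \<in> mod_hom KK M M"
proof (induction k)
  case 0
  then show ?case using mod_hom_ident by (simp add: id_def)
next
  case (Suc k)
  then show ?case using mod_hom_comp[OF Suc.IH act_mod_hom[of i]] by (simp add: comp_def)
qed

lemma acts_mod_hom: "set js \<subseteq> {1..m} \<Longrightarrow> acts js e \<in> mod_hom KK M M"
proof (induction js)
  case Nil
  then show ?case using mod_hom_ident by (simp add: acts_def id_def)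
next
  case (Cons i js)
  then show ?case
    using mod_hom_comp[OF _ funpow_act_mod_hom[of i "e i"], of "acts js e"]
    by (simp add: acts_def comp_def)
qed

lemma funpow_act_closed: "i \<in> {1..m} \<Longrightarrow> x \<in> carrier M \<Longrightarrow> (act i ^^ k) x \<in> carrier M"
  by (rule mod_hom_closed[OF funpow_act_mod_hom])

lemma acts_closed: "set js \<subseteq> {1..m} \<Longrightarrow> x \<in> carrier M \<Longrightarrow> acts js e x \<in> carrier M"
  by (rule mod_hom_closed[OF acts_mod_hom])

lemma act_funpow_commute:
  "i \<in> {1..m} \<Longrightarrow> j \<in> {1..m} \<Longrightarrow> x \<in> carrier M \<Longrightarrow> act i ((act j ^^ k) x) = (act j ^^ k) (act i x)"
  by (induction k) (simp_all add: act_commute[of i j] funpow_act_closed)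

lemma act_acts_commute:
  "i \<in> {1..m} \<Longrightarrow> set js \<subseteq> {1..m} \<Longrightarrow> x \<in> carrier M \<Longrightarrow> act i (acts js e x) = acts js e (act i x)"
  by (induction js) (simp_all add: act_funpow_commute acts_closed)

lemma funpow_acts_commute:
  "i \<in> {1..m} \<Longrightarrow> set js \<subseteq> {1..m} \<Longrightarrow> x \<in> carrier M \<Longrightarrow>
    (act i ^^ k) (acts js e x) = acts js e ((act i ^^ k) x)"
  by (induction k) (simp_all add: act_acts_commute funpow_act_closed)

text \<open>Interleaving the two products of powers is possible because the operators commute; this
  is where a V-module becomes a module over the polynomial ring.\<close>

lemma acts_add:
  "set js \<subseteq> {1..m} \<Longrightarrow> x \<in> carrier M \<Longrightarrow> acts js (\<lambda>i. e i + e' i) x = acts js e (acts js e' x)"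
  by (induction js) (simp_all add: funpow_add funpow_acts_commute acts_closed)

lemma acts_zero: "acts js (\<lambda>i. 0) x = x"
  by (induction js) simp_all

lemma acts_single:
  "distinct js \<Longrightarrow> acts js (\<lambda>j. if i = j then 1 else 0) x = (if i \<in> set js then act i x else x)"
  by (induction js) auto

lemma mono_act_mod_hom: "mono_act m M RM a \<in> mod_hom KK M M"
  unfolding mono_act_acts by (rule acts_mod_hom) auto

lemma mono_act_closed: "x \<in> carrier M \<Longrightarrow> mono_act m M RM a x \<in> carrier M"
  by (rule mod_hom_closed[OF mono_act_mod_hom])

lemma mono_act_add:
  assumes "x \<in> carrier M"
  shows "mono_act m M RM (a + b) x = mono_act m M RM a (mono_act m M RM b x)"
proof -
  have "set [1..<Suc m] \<subseteq> {1..m}" by auto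
  from acts_add[OF this assms] show ?thesis
    by (simp only: mono_act_acts lookup_add[abs_def])
qed

lemma mono_act_zero: "mono_act m M RM 0 x = x"
  using acts_zero[of "[1..<Suc m]" x] by (simp add: mono_act_acts lookup_zero[abs_def] del: upt_Suc)

lemma mono_act_single:
  assumes "i \<in> {1..m}"
  shows "mono_act m M RM (Poly_Mapping.single i 1) x = act i x"
proof -
  have "Poly_Mapping.lookup (Poly_Mapping.single i (1::nat)) = (\<lambda>j. if i = j then 1 else 0)"
    by (auto simp: lookup_single when_def)
  then show ?thesis
    using acts_single[of "[1..<Suc m]" i x] assms by (simp add: mono_act_acts del: upt_Suc)
qed

lemma KK_smult_simps [simp]:
  "x \<in> carrier M \<Longrightarrow> 0 \<odot>\<^bsub>M\<^esub> x = \<zero>\<^bsub>M\<^esub>" "x \<in> carrier M \<Longrightarrow> 1 \<odot>\<^bsub>M\<^esub> x = x"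
  using M.smult_l_null[of x] M.smult_one[of x] by simp_all

abbreviation "FM \<equiv> F_module m M RM"

lemma F_module_simps [simp]:
  "carrier FM = carrier M" "\<zero>\<^bsub>FM\<^esub> = \<zero>\<^bsub>M\<^esub>" "x \<oplus>\<^bsub>FM\<^esub> z = x \<oplus>\<^bsub>M\<^esub> z"
  by (simp_all add: F_module_def)

lemma F_smult_superset:
  assumes "finite S" "Poly_Mapping.keys p \<subseteq> S" "x \<in> carrier M"
  shows "p \<odot>\<^bsub>FM\<^esub> x = (\<Oplus>\<^bsub>M\<^esub>a\<in>S. Poly_Mapping.lookup p a \<odot>\<^bsub>M\<^esub> mono_act m M RM a x)"
proof -
  have "p \<odot>\<^bsub>FM\<^esub> x = (\<Oplus>\<^bsub>M\<^esub>a\<in>Poly_Mapping.keys p. Poly_Mapping.lookup p a \<odot>\<^bsub>M\<^esub> mono_act m M RM a x)"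
    by (simp add: F_module_def)
  also have "\<dots> = (\<Oplus>\<^bsub>M\<^esub>a\<in>S. Poly_Mapping.lookup p a \<odot>\<^bsub>M\<^esub> mono_act m M RM a x)"
    using mono_act_closed[OF assms(3)] assms(1,2)
    by (intro M.add.finprod_mono_neutral_cong_left) (auto simp: in_keys_iff)
  finally show ?thesis .
qed

lemma F_smult_mod_hom: "(\<lambda>x. p \<odot>\<^bsub>FM\<^esub> x) \<in> mod_hom KK M M"
  by (simp add: F_module_def)
    (intro mod_hom_finsum_map M.module_axioms finite_keys mod_hom_smult_map mono_act_mod_hom, simp)

lemma F_smult_closed: "x \<in> carrier M \<Longrightarrow> p \<odot>\<^bsub>FM\<^esub> x \<in> carrier M"
  by (rule mod_hom_closed[OF F_smult_mod_hom])

lemma F_smult_add: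
  assumes x: "x \<in> carrier M"
  shows "(p + q) \<odot>\<^bsub>FM\<^esub> x = p \<odot>\<^bsub>FM\<^esub> x \<oplus>\<^bsub>M\<^esub> q \<odot>\<^bsub>FM\<^esub> x"
proof -
  let ?S = "Poly_Mapping.keys p \<union> Poly_Mapping.keys q"
  let ?t = "\<lambda>p a. Poly_Mapping.lookup p a \<odot>\<^bsub>M\<^esub> mono_act m M RM a x"
  have S: "finite ?S" "Poly_Mapping.keys (p + q) \<subseteq> ?S"
    using Poly_Mapping.keys_add[of p q] by auto
  have t: "?t p a \<in> carrier M" for p a using mono_act_closed[OF x] by simp
  have "(p + q) \<odot>\<^bsub>FM\<^esub> x = (\<Oplus>\<^bsub>M\<^esub>a\<in>?S. ?t p a \<oplus>\<^bsub>M\<^esub> ?t q a)"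
    unfolding F_smult_superset[OF S x] using t mono_act_closed[OF x]
    by (intro M.finsum_cong') (auto simp: lookup_add M.smult_l_distr[simplified])
  also have "\<dots> = (\<Oplus>\<^bsub>M\<^esub>a\<in>?S. ?t p a) \<oplus>\<^bsub>M\<^esub> (\<Oplus>\<^bsub>M\<^esub>a\<in>?S. ?t q a)"
    using t by (intro M.finsum_addf) auto
  also have "\<dots> = p \<odot>\<^bsub>FM\<^esub> x \<oplus>\<^bsub>M\<^esub> q \<odot>\<^bsub>FM\<^esub> x"
    using F_smult_superset[OF S(1) _ x, of p] F_smult_superset[OF S(1) _ x, of q] by simp
  finally show ?thesis .
qed

lemma F_smult_single:
  assumes "x \<in> carrier M"
  shows "Poly_Mapping.single a c \<odot>\<^bsub>FM\<^esub> x = c \<odot>\<^bsub>M\<^esub> mono_act m M RM a x"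
  using F_smult_superset[of "{a}" "Poly_Mapping.single a c" x] mono_act_closed[OF assms] assms
  by (simp add: split: if_splits)

text \<open>Additive in both polynomials, hence only terms c v^a and d v^b matter; there it combines
  K-linearity of the monomial action with \<open>mono_act_add\<close>.\<close>

lemma F_smult_mult:
  assumes x: "x \<in> carrier M"
  shows "(p * q) \<odot>\<^bsub>FM\<^esub> x = p \<odot>\<^bsub>FM\<^esub> (q \<odot>\<^bsub>FM\<^esub> x)"
proof (induction p rule: poly_mapping_induct_single)
  case (single a c)
  show ?case
  proof (induction q rule: poly_mapping_induct_single)
    case (single b d)
    have "mono_act m M RM a (d \<odot>\<^bsub>M\<^esub> mono_act m M RM b x) = d \<odot>\<^bsub>M\<^esub> mono_act m M RM (a + b) x"
      using mod_hom_smult[OF mono_act_mod_hom, of d "mono_act m M RM b x" a] mono_act_closed[OF x]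
      by (simp add: mono_act_add[OF x])
    then show ?case
      using mono_act_closed[OF x] M.smult_assoc1[of c d "mono_act m M RM (a + b) x"]
      by (simp add: mult_single F_smult_single x)
  next
    case (add p q)
    have "Poly_Mapping.single a c \<odot>\<^bsub>FM\<^esub> (p \<odot>\<^bsub>FM\<^esub> x \<oplus>\<^bsub>M\<^esub> q \<odot>\<^bsub>FM\<^esub> x)
        = Poly_Mapping.single a c \<odot>\<^bsub>FM\<^esub> (p \<odot>\<^bsub>FM\<^esub> x) \<oplus>\<^bsub>M\<^esub> Poly_Mapping.single a c \<odot>\<^bsub>FM\<^esub> (q \<odot>\<^bsub>FM\<^esub> x)"
      by (rule additive_map_add[OF mod_hom_additive[OF F_smult_mod_hom]]) (simp_all add: F_smult_closed x)
    then show ?case by (simp add: distrib_left F_smult_add x add)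
  qed
next
  case (add p p')
  then show ?case by (simp add: distrib_right F_smult_add x F_smult_closed)
qed

lemma F_smult_pconst: "x \<in> carrier M \<Longrightarrow> pconst c \<odot>\<^bsub>FM\<^esub> x = c \<odot>\<^bsub>M\<^esub> x"
  by (simp add: pconst_def F_smult_single mono_act_zero)

lemma F_smult_pvar: "i \<in> {1..m} \<Longrightarrow> x \<in> carrier M \<Longrightarrow> pvar i \<odot>\<^bsub>FM\<^esub> x = act i x"
  by (simp add: pvar_def F_smult_single mono_act_single[simplified] act_closed M.smult_one[simplified])

lemma module_F_module: "Module.module (FF m) FM"
proof (rule moduleI)
  show "abelian_group FM"
    by (rule abelian_groupI) (auto simp: M.a_ac intro!: bexI[of _ "\<ominus>\<^bsub>M\<^esub> _"] M.l_neg)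
  show "\<one>\<^bsub>FF m\<^esub> \<odot>\<^bsub>FM\<^esub> x = x" if "x \<in> carrier FM" for x
    using F_smult_pconst[of x 1] M.smult_one[of x] that by (simp add: pconst_def)
  show "p \<odot>\<^bsub>FM\<^esub> (x \<oplus>\<^bsub>FM\<^esub> z) = p \<odot>\<^bsub>FM\<^esub> x \<oplus>\<^bsub>FM\<^esub> p \<odot>\<^bsub>FM\<^esub> z" if "x \<in> carrier FM" "z \<in> carrier FM" for p x z
    using additive_map_add[OF mod_hom_additive[OF F_smult_mod_hom]] that by simp
qed (simp_all add: cring_FF F_smult_closed F_smult_add F_smult_mult)

end

subsection \<open>The Koszul resolution\<close>

abbreviation subsets_card :: "nat \<Rightarrow> nat \<Rightarrow> nat set set"
  where "subsets_card m k \<equiv> {S. S \<subseteq> {1..m} \<and> card S = k}"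

lemma finite_subsets_card: "finite (subsets_card m k)"
  by (rule finite_subset[of _ "Pow {1..m}"]) auto

lemma finite_of_subsets_card: "S \<in> subsets_card m k \<Longrightarrow> finite S"
  using finite_subset[of S "{1..m}"] by auto

lemma module_ext_pow: "Module.module (FF m) (ext_pow m k)"
  unfolding ext_pow_def by (rule module_free_module[OF cring_FF])

lemma ext_pow_simps [simp]:
  "\<zero>\<^bsub>ext_pow m k\<^esub> = (\<lambda>S. 0)" "f \<oplus>\<^bsub>ext_pow m k\<^esub> g = (\<lambda>S. f S + g S)"
  "p \<odot>\<^bsub>ext_pow m k\<^esub> f = (\<lambda>S. p * f S)"
  by (simp_all add: ext_pow_def)

lemma ext_pow_carrier_iff:
  "f \<in> carrier (ext_pow m k) \<longleftrightarrow> (\<forall>S. f S \<in> carrier (FF m)) \<and> (\<forall>S. S \<notin> subsets_card m k \<longrightarrow> f S = 0)"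
proof
  assume "f \<in> carrier (ext_pow m k)"
  then show "(\<forall>S. f S \<in> carrier (FF m)) \<and> (\<forall>S. S \<notin> subsets_card m k \<longrightarrow> f S = 0)"
    unfolding ext_pow_def
    using free_module_carrierD(1)[of f "FF m" "subsets_card m k"]
      free_module_carrierD(2)[of f "FF m" "subsets_card m k"] by simp
next
  assume "(\<forall>S. f S \<in> carrier (FF m)) \<and> (\<forall>S. S \<notin> subsets_card m k \<longrightarrow> f S = 0)"
  then show "f \<in> carrier (ext_pow m k)"
    unfolding ext_pow_def
    using free_module_carrierI[OF finite_subsets_card[of m k], of f "FF m"] by simp
qed

lemma ext_pow_carrierD:
  assumes "f \<in> carrier (ext_pow m k)"
  shows "f S \<in> carrier (FF m)" "S \<notin> subsets_card m k \<Longrightarrow> f S = 0"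
  using assms by (simp_all add: ext_pow_carrier_iff)

lemma finsum_ext_pow:
  assumes "finite I" "\<And>i. i \<in> I \<Longrightarrow> f i \<in> carrier (ext_pow m k)"
  shows "finsum (ext_pow m k) f I = (\<lambda>S. \<Sum>i\<in>I. f i S)"
proof
  fix S
  have "finsum (ext_pow m k) f I S = (\<Oplus>\<^bsub>FF m\<^esub>i\<in>I. f i S)"
    using finsum_free_module[OF cring_FF assms(1), of f m "subsets_card m k" S] assms(2)
    unfolding ext_pow_def by blast
  also have "\<dots> = (\<Sum>i\<in>I. f i S)"
    using assms by (intro finsum_FF) (auto simp: ext_pow_carrier_iff)
  finally show "finsum (ext_pow m k) f I S = (\<Sum>i\<in>I. f i S)" .
qed

text \<open>For i in S this is the place, counted from 0, of i in the increasing word of S. For i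
  outside S it is the number of factors that e_i must pass in e_i \<and> e_S. Either way it is the
  exponent of the Koszul sign.\<close>

definition position :: "nat \<Rightarrow> nat set \<Rightarrow> nat"
  where "position i S = card {t \<in> S. t < i}"

lemma position_remove: "position i (S - {i}) = position i S"
  unfolding position_def by (rule arg_cong[of _ _ card]) auto

lemma position_insert_self: "position i (insert i S) = position i S"
  unfolding position_def by (rule arg_cong[of _ _ card]) auto

lemma position_insert:
  assumes "finite S" "j \<notin> S"
  shows "position i (insert j S) = position i S + (if j < i then 1 else 0)"
proof -
  have "{t \<in> insert j S. t < i} = (if j < i then insert j {t \<in> S. t < i} else {t \<in> S. t < i})" by auto
  then show ?thesis using assms by (simp add: position_def)
qed

lemma position_eq_0: "(\<And>t. t \<in> S \<Longrightarrow> i \<le> t) \<Longrightarrow> position i S = 0"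
  unfolding position_def by (metis (mono_tags, lifting) card.empty empty_Collect_eq leD)

lemma sorted_position:
  assumes "finite S" "i \<in> S"
  shows "position i S < card S" "sorted_list_of_set S ! position i S = i"
    "delete_nth (position i S) (sorted_list_of_set S) = sorted_list_of_set (S - {i})"
proof -
  let ?s = "sorted_list_of_set (S - {i})"
  have s: "sorted_list_of_set S = insort i ?s"
    using sorted_list_of_set_insert[of "S - {i}" i] assms by (simp add: insert_absorb)
  have p: "card {t \<in> set ?s. t < i} = position i S"
    using assms(1) position_remove[of i S] by (simp add: position_def)
  have "position i S \<le> length ?s" "insort i ?s ! position i S = i" "delete_nth (position i S) (insort i ?s) = ?s"
    using insort_position[of ?s i] assms(1) unfolding p by simp_all
  moreover have "length ?s < card S" using card_Diff1_less[OF assms] assms(1) by simp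
  ultimately show "position i S < card S" "sorted_list_of_set S ! position i S = i"
    "delete_nth (position i S) (sorted_list_of_set S) = sorted_list_of_set (S - {i})"
    unfolding s by simp_all
qed

lemma position_sorted_nth:
  assumes "finite S" "j < card S"
  shows "position (sorted_list_of_set S ! j) S = j"
proof -
  let ?s = "sorted_list_of_set S"
  have i: "?s ! j \<in> S" using nth_mem[of j ?s] assms by simp
  show ?thesis
    using sorted_position(1,2)[OF assms(1) i] assms nth_eq_iff_index_eq[of ?s "position (?s ! j) S" j] by simp
qed

lemma delete_nth_sorted:
  fixes S :: "nat set"
  assumes "finite S" "j < card S"
  shows "delete_nth j (sorted_list_of_set S) = sorted_list_of_set (S - {sorted_list_of_set S ! j})"
proof -
  have "sorted_list_of_set S ! j \<in> S" using nth_mem[of j "sorted_list_of_set S"] assms by simp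
  from sorted_position(3)[OF assms(1) this] show ?thesis
    unfolding position_sorted_nth[OF assms] .
qed

lemma ewedge_distinct: "distinct w \<Longrightarrow> ewedge w = (\<lambda>S. (-1) ^ inversions w * basis_vec (FF m) (set w) S)"
  by (auto simp: ewedge_def basis_vec_def inversions_def fun_eq_iff)

lemma ewedge_sorted:
  assumes "finite S"
  shows "ewedge (sorted_list_of_set S) = basis_vec (FF m) S"
proof -
  let ?s = "sorted_list_of_set S"
  have "{(a, b). a < b \<and> b < length ?s \<and> ?s ! b < ?s ! a} = {}"
  proof -
    have "\<not> ?s ! b < ?s ! a" if "a < b" "b < length ?s" for a b
      using sorted_nth_mono[of ?s a b] that by simp
    then show ?thesis by blast
  qed
  then have "inversions ?s = 0" by (simp only: inversions_def card.empty)
  then show ?thesis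
    using ewedge_distinct[of ?s m] assms by simp
qed

lemma koszul_basis_sorted:
  assumes "finite S"
  shows "koszul_basis (sorted_list_of_set S) T
    = (\<Sum>i\<in>S. (-1) ^ position i S * pvar i * (if T = S - {i} then 1 else 0))"
proof -
  let ?s = "sorted_list_of_set S"
  have "koszul_basis ?s T = (\<Sum>j<card S. (-1) ^ j * pvar (?s ! j) * (if T = S - {?s ! j} then 1 else 0))"
    unfolding koszul_basis_def
  proof (rule sum.cong)
    fix j assume "j \<in> {..<card S}"
    \<comment> \<open>The number of variables is arbitrary here: a basis vector refers only to 0 and
      1, which all rings \<open>FF m\<close> share.\<close>
    then have "ewedge (delete_nth j ?s) = basis_vec (FF 0) (S - {?s ! j})"
      using delete_nth_sorted[OF assms, of j] ewedge_sorted[of "S - {?s ! j}" 0] assms by simp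
    then show "(-1) ^ j * pvar (?s ! j) * ewedge (delete_nth j ?s) T
        = (-1) ^ j * pvar (?s ! j) * (if T = S - {?s ! j} then 1 else 0)"
      by (simp add: basis_vec_def)
  qed (use assms in simp)
  also have "\<dots> = (\<Sum>i\<in>S. (-1) ^ position i S * pvar i * (if T = S - {i} then 1 else 0))"
    using assms nth_mem[of _ ?s] sorted_position[OF assms] position_sorted_nth[OF assms]
    by (intro sum.reindex_bij_witness[of _ "\<lambda>i. position i S" "\<lambda>j. ?s ! j"]) auto
  finally show ?thesis .
qed

lemma koszul_basis_closed:
  assumes S: "S \<in> subsets_card m k"
  shows "koszul_basis (sorted_list_of_set S) \<in> carrier (ext_pow m (k - 1))"
proof -
  note fin = finite_of_subsets_card[OF S]
  have "(-1) ^ position i S * pvar i * (if T = S - {i} then 1 else 0) \<in> carrier (FF m)" if "i \<in> S" for i T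
  proof -
    have "i \<in> {1..m}" using S that by auto
    then show ?thesis
      by (intro FF_mult_closed sign_closed pvar_closed) (simp_all add: FF_carrier)
  qed
  moreover have "S - {i} \<in> subsets_card m (k - 1)" if "i \<in> S" for i
    using S that fin by auto
  ultimately show ?thesis
    unfolding ext_pow_carrier_iff koszul_basis_sorted[OF fin]
    by (intro conjI allI impI FF_sum_closed sum.neutral) auto
qed

lemma koszul_d_mod_hom: "koszul_d m k \<in> mod_hom (FF m) (ext_pow m k) (ext_pow m (k - 1))"
proof -
  have "lin_ext (FF m) (ext_pow m (k - 1)) (\<lambda>S. koszul_basis (sorted_list_of_set S))
      \<in> mod_hom (FF m) (free_module (FF m) (subsets_card m k)) (ext_pow m (k - 1))"
    by (rule lin_ext_mod_hom[OF module_ext_pow finite_subsets_card koszul_basis_closed])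
  then show ?thesis by (simp add: koszul_d_def ext_pow_def[of m k])
qed

text \<open>The Koszul differential read off from the target: the coefficient of \<open>e\<^sub>T\<close> collects the
  contributions of the sets \<open>insert i T\<close>.\<close>

definition koszul_map :: "nat \<Rightarrow> (nat set \<Rightarrow> mpol) \<Rightarrow> (nat set \<Rightarrow> mpol)"
  where "koszul_map m f = (\<lambda>T. \<Sum>i\<in>{1..m} - T. (-1) ^ position i T * pvar i * f (insert i T))"

text \<open>Exchange of summation: pairs of a set S and an i in S with S - {i} = T correspond to the
  i outside T with S = T plus i.\<close>

lemma koszul_d_eq:
  assumes k: "k \<ge> 1" and f: "f \<in> carrier (ext_pow m k)"
  shows "koszul_d m k f = koszul_map m f"
proof
  fix T
  let ?B = "subsets_card m k"
  let ?t = "\<lambda>i S. (-1) ^ position i S * pvar i * f S"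
  let ?I = "{i \<in> {1..m} - T. insert i T \<in> ?B}"
  have f0: "f S = 0" if "S \<notin> ?B" for S using f that by (simp add: ext_pow_carrier_iff)
  have c: "f S \<odot>\<^bsub>ext_pow m (k - 1)\<^esub> koszul_basis (sorted_list_of_set S) \<in> carrier (ext_pow m (k - 1))"
    if "S \<in> ?B" for S
    using f by (intro module.smult_closed[OF module_ext_pow] koszul_basis_closed[OF that])
      (simp add: ext_pow_carrier_iff)
  have "koszul_d m k f = (\<Oplus>\<^bsub>ext_pow m (k - 1)\<^esub>S\<in>?B. f S \<odot>\<^bsub>ext_pow m (k - 1)\<^esub> koszul_basis (sorted_list_of_set S))"
    unfolding koszul_d_def
    by (rule lin_ext_eq[OF module_ext_pow finite_subsets_card f[unfolded ext_pow_def] koszul_basis_closed])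
  then have "koszul_d m k f T = (\<Sum>S\<in>?B. f S * koszul_basis (sorted_list_of_set S) T)"
    using finsum_ext_pow[OF finite_subsets_card c] by simp
  also have "\<dots> = (\<Sum>S\<in>?B. \<Sum>i\<in>S. if T = S - {i} then ?t i S else 0)"
  proof (rule sum.cong[OF refl])
    fix S assume "S \<in> ?B"
    then show "f S * koszul_basis (sorted_list_of_set S) T = (\<Sum>i\<in>S. if T = S - {i} then ?t i S else 0)"
      unfolding koszul_basis_sorted[OF finite_of_subsets_card[OF \<open>S \<in> ?B\<close>]] sum_distrib_left
      by (intro sum.cong refl) (simp add: mult.commute)
  qed
  also have "\<dots> = (\<Sum>(S, i)\<in>Sigma ?B (\<lambda>S. S). if T = S - {i} then ?t i S else 0)"
    by (rule sum.Sigma[OF finite_subsets_card]) (intro ballI finite_of_subsets_card)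
  also have "\<dots> = (\<Sum>(S, i)\<in>{(S, i). S \<in> ?B \<and> i \<in> S \<and> T = S - {i}}. ?t i S)"
  proof (rule sum.mono_neutral_cong_right)
    show "finite (Sigma ?B (\<lambda>S. S))"
      by (intro finite_SigmaI finite_subsets_card finite_of_subsets_card)
  qed (auto split: if_splits)
  also have "\<dots> = (\<Sum>i\<in>?I. ?t i (insert i T))"
    by (intro sum.reindex_bij_witness[of _ "\<lambda>i. (insert i T, i)" "snd"]) (auto simp: insert_absorb)
  \<comment> \<open>The added indices lead to sets of the wrong size or outside {1..m}, where f
    vanishes.\<close>
  also have "\<dots> = (\<Sum>i\<in>{1..m} - T. ?t i (insert i T))"
  proof (rule sum.mono_neutral_left)
    show "\<forall>i\<in>({1..m} - T) - ?I. ?t i (insert i T) = 0"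
    proof
      fix i assume "i \<in> ({1..m} - T) - ?I"
      then have "insert i T \<notin> ?B" by blast
      then show "?t i (insert i T) = 0" using f0[of "insert i T"] by simp
    qed
  qed auto
  also have "\<dots> = koszul_map m f T"
    by (simp add: koszul_map_def position_insert_self)
  finally show "koszul_d m k f T = koszul_map m f T" .
qed

lemma mpol_eq_minus_iff:
  fixes p :: mpol
  assumes "p = - p"
  shows "p = 0"
proof (rule poly_mapping_eqI)
  fix a
  have "Poly_Mapping.lookup p a = - Poly_Mapping.lookup p a"
    using assms by (metis lookup_uminus)
  then show "Poly_Mapping.lookup p a = Poly_Mapping.lookup 0 a"
    by (simp add: ratfun_eq_minus_iff)
qed

text \<open>The terms are indexed by ordered pairs of distinct indices outside T. Inserting the
  smaller index raises the position of the larger by one and not conversely, so (i, j) and (j, i)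
  have opposite signs. The sum equals its own negative.\<close>

lemma koszul_map_koszul_map:
  assumes T: "finite T"
  shows "koszul_map m (koszul_map m f) T = 0"
proof -
  let ?P = "Sigma ({1..m} - T) (\<lambda>i. {1..m} - insert i T)"
  let ?g = "\<lambda>i j. (-1) ^ (position i T + position j (insert i T)) * (pvar i * pvar j) * f (insert j (insert i T))"
  have "koszul_map m (koszul_map m f) T = (\<Sum>i\<in>{1..m} - T. \<Sum>j\<in>{1..m} - insert i T. ?g i j)"
    unfolding koszul_map_def sum_distrib_left by (intro sum.cong refl) (simp add: power_add mult_ac)
  also have "\<dots> = (\<Sum>(i, j)\<in>?P. ?g i j)" by (subst sum.Sigma) auto
  finally have eq: "koszul_map m (koszul_map m f) T = (\<Sum>(i, j)\<in>?P. ?g i j)" .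
  have anti: "?g j i = - ?g i j" if "i \<notin> T" "j \<notin> T" "i \<noteq> j" for i j
    using that T by (cases i j rule: linorder_cases)
      (simp_all add: position_insert insert_commute mult.commute[of "pvar i"] add.commute)
  have "(\<Sum>(i, j)\<in>?P. ?g i j) = (\<Sum>(i, j)\<in>?P. ?g j i)"
    by (rule sum.reindex_bij_witness[of _ "\<lambda>(i, j). (j, i)" "\<lambda>(i, j). (j, i)"]) auto
  also have "\<dots> = - (\<Sum>(i, j)\<in>?P. ?g i j)"
    unfolding sum_negf[symmetric] using anti by (intro sum.cong) auto
  finally show ?thesis unfolding eq by (rule mpol_eq_minus_iff)
qed

section \<open>The contracting homotopy in coefficients\<close>

lemma lookup_pvar_mult:
  "Poly_Mapping.lookup (pvar i * p) a
    = (if i \<in> Poly_Mapping.keys a then Poly_Mapping.lookup p (a - Poly_Mapping.single i 1) else 0)"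
proof (induction p rule: poly_mapping_induct_single)
  case (single b c)
  have "Poly_Mapping.single i 1 + b = a \<longleftrightarrow> i \<in> Poly_Mapping.keys a \<and> b = a - Poly_Mapping.single i 1"
  proof
    assume "Poly_Mapping.single i 1 + b = a"
    then show "i \<in> Poly_Mapping.keys a \<and> b = a - Poly_Mapping.single i 1"
      by (auto simp: in_keys_iff lookup_add)
  next
    assume "i \<in> Poly_Mapping.keys a \<and> b = a - Poly_Mapping.single i 1"
    then show "Poly_Mapping.single i 1 + b = a"
      by (intro poly_mapping_eqI) (auto simp: lookup_add lookup_minus lookup_single when_def in_keys_iff)
  qed
  then show ?case
    by (auto simp: pvar_def mult_single lookup_single when_def)
next
  case (add p q)
  then show ?case by (simp add: distrib_left lookup_add)
qed

lemma lookup_sign_mult: "Poly_Mapping.lookup ((-1) ^ n * p) a = (-1) ^ n * Poly_Mapping.lookup p a"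
  for p :: mpol
  by (cases "even n") simp_all

lemma lookup_koszul_map:
  "Poly_Mapping.lookup (koszul_map m f T) a = (\<Sum>i\<in>{1..m} - T. if i \<in> Poly_Mapping.keys a
    then (-1) ^ position i T * Poly_Mapping.lookup (f (insert i T)) (a - Poly_Mapping.single i 1) else 0)"
  unfolding koszul_map_def lookup_sum
  by (intro sum.cong refl) (simp add: mult.assoc lookup_sign_mult lookup_pvar_mult)

text \<open>The contracting homotopy: it moves the smallest index \<open>i\<close> occurring in \<open>v\<^sup>a e\<^sub>S\<close> from the monomial
  to the wedge, and kills the element if \<open>i\<close> belongs to \<open>S\<close>. Here it is written in coefficients.\<close>

definition koszul_homotopy :: "(nat set \<Rightarrow> mpol) \<Rightarrow> (nat set \<Rightarrow> mpol)"
  where "koszul_homotopy f = (\<lambda>T. Abs_poly_mapping (\<lambda>b.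
    if T \<noteq> {} \<and> (\<forall>j\<in>Poly_Mapping.keys b. Min T \<le> j)
    then Poly_Mapping.lookup (f (T - {Min T})) (b + Poly_Mapping.single (Min T) 1) else 0))"

lemma lookup_koszul_homotopy:
  "Poly_Mapping.lookup (koszul_homotopy f T) b = (if T \<noteq> {} \<and> (\<forall>j\<in>Poly_Mapping.keys b. Min T \<le> j)
    then Poly_Mapping.lookup (f (T - {Min T})) (b + Poly_Mapping.single (Min T) 1) else 0)"
proof -
  let ?e = "Poly_Mapping.single (Min T) (1::nat)"
  \<comment> \<open>Multiplication by a monomial shifts exponents injectively, so the coefficient
    function has finite support and \<open>Abs_poly_mapping\<close> can be inverted.\<close>
  have "finite ((\<lambda>b. b + ?e) -` Poly_Mapping.keys (f (T - {Min T})))"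
    by (rule finite_vimageI) (auto simp: inj_on_def)
  then have "finite {b. (if T \<noteq> {} \<and> (\<forall>j\<in>Poly_Mapping.keys b. Min T \<le> j)
    then Poly_Mapping.lookup (f (T - {Min T})) (b + ?e) else 0) \<noteq> 0}"
    by (rule rev_finite_subset) (auto simp: in_keys_iff split: if_splits)
  then show ?thesis unfolding koszul_homotopy_def by simp
qed

lemma keys_add_nat: "Poly_Mapping.keys (a + b) = Poly_Mapping.keys a \<union> Poly_Mapping.keys b"
  for a b :: "nat \<Rightarrow>\<^sub>0 nat"
  by (auto simp: in_keys_iff lookup_add)

lemma koszul_homotopy_closed:
  assumes f: "f \<in> carrier (ext_pow m n)"
  shows "koszul_homotopy f \<in> carrier (ext_pow m (n + 1))"
  unfolding ext_pow_carrier_iff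
proof (intro conjI allI impI)
  fix T
  have F: "Poly_Mapping.keys a \<subseteq> {1..m}" if "Poly_Mapping.lookup (f S) a \<noteq> 0" for S a
    using f that by (auto simp: ext_pow_carrier_iff FF_carrier in_keys_iff)
  show "koszul_homotopy f T \<in> carrier (FF m)"
    unfolding FF_carrier
  proof (intro CollectI ballI)
    fix b assume "b \<in> Poly_Mapping.keys (koszul_homotopy f T)"
    then have "Poly_Mapping.lookup (f (T - {Min T})) (b + Poly_Mapping.single (Min T) 1) \<noteq> 0"
      by (auto simp: in_keys_iff lookup_koszul_homotopy split: if_splits)
    from F[OF this] show "Poly_Mapping.keys b \<subseteq> {1..m}" by (simp add: keys_add_nat)
  qed
  assume T: "T \<notin> subsets_card m (n + 1)"
  show "koszul_homotopy f T = 0"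
  proof (rule poly_mapping_eqI, rule ccontr)
    fix b assume "Poly_Mapping.lookup (koszul_homotopy f T) b \<noteq> Poly_Mapping.lookup 0 b"
    then have nz: "T \<noteq> {}" "Poly_Mapping.lookup (f (T - {Min T})) (b + Poly_Mapping.single (Min T) 1) \<noteq> 0"
      by (auto simp: lookup_koszul_homotopy split: if_splits)
    \<comment> \<open>For infinite T the value \<open>Min T\<close> is arbitrary. A nonzero
      coefficient of f excludes this, and it also bounds \<open>Min T\<close>, which occurs in the
      exponent.\<close>
    have S: "T - {Min T} \<in> subsets_card m n"
    proof (rule ccontr)
      assume "T - {Min T} \<notin> subsets_card m n"
      then have "f (T - {Min T}) = 0" by (rule ext_pow_carrierD(2)[OF f])
      then show False using nz(2) by simp
    qed
    have fin: "finite T" using finite_of_subsets_card[OF S] by simp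
    have "Min T \<in> {1..m}" using F[OF nz(2)] by (simp add: keys_add_nat)
    then have "T \<subseteq> {1..m}" using S by blast
    moreover have "card T = n + 1"
      using card.remove[OF fin Min_in[OF fin nz(1)]] S by simp
    ultimately have "T \<in> subsets_card m (n + 1)" by simp
    then show False using T by contradiction
  qed
qed

text \<open>The homotopy identity d h + h d = id, coefficient by coefficient. It can fail only at
  the constant term in degree 0, which is what the augmentation sees. The proof splits by whether
  the smallest index occurring in v^a e_T lies in T.\<close>

lemma koszul_homotopy_eq:
  assumes T: "T \<subseteq> {1..m}" and a: "Poly_Mapping.keys a \<subseteq> {1..m}" and ne: "T \<noteq> {} \<or> a \<noteq> 0"
  shows "Poly_Mapping.lookup (koszul_map m (koszul_homotopy f) T) a
      + Poly_Mapping.lookup (koszul_homotopy (koszul_map m f) T) a = Poly_Mapping.lookup (f T) a"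
proof -
  define e where "e i = Poly_Mapping.single i (1::nat)" for i :: nat
  let ?L = "Poly_Mapping.lookup" and ?K = "Poly_Mapping.keys"
  define i0 where "i0 = Min (T \<union> ?K a)"
  have fin: "finite T" "finite (T \<union> ?K a)" using finite_subset[OF T] by auto
  have U: "T \<union> ?K a \<noteq> {}" using ne by auto
  have i0: "i0 \<in> T \<union> ?K a" unfolding i0_def by (rule Min_in[OF fin(2) U])
  have le: "i0 \<le> j" if "j \<in> T \<union> ?K a" for j unfolding i0_def by (rule Min_le[OF fin(2) that])
  have i0m: "i0 \<in> {1..m}" using i0 T a by blast
  have kd: "?K (a - e i) \<subseteq> ?K a" for i by (auto simp: in_keys_iff lookup_minus)
  have ae: "a - e i + e i = a" if "i \<in> ?K a" for i
    using that by (intro poly_mapping_eqI) (auto simp: e_def lookup_add lookup_minus lookup_single when_def in_keys_iff)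
  have ke: "?K (e i) = {i}" for i by (simp add: e_def)
  note hom = lookup_koszul_homotopy[folded e_def] and kos = lookup_koszul_map[folded e_def]
  show ?thesis
  proof (cases "i0 \<in> T")
    \<comment> \<open>In h d, the summand that puts i0 back gives the coefficient of f itself. Every
      other summand has i > i0, so removing i0 lowers its position by one and it cancels the
      corresponding summand of d h.\<close>
    case True
    have minT: "Min T = i0" using fin(1) True le by (intro Min_eqI) auto
    let ?t = "\<lambda>i. if i \<in> ?K a then (-1) ^ position i T * ?L (f (insert i T - {i0})) (a - e i + e i0) else 0"
    have "?L (koszul_map m (koszul_homotopy f) T) a = (\<Sum>i\<in>{1..m} - T. ?t i)"
      unfolding kos
    proof (intro sum.cong refl if_cong arg_cong2[of _ _ _ _ times])
      fix i assume i: "i \<in> ?K a"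
      have "Min (insert i T) = i0" using fin(1) True le i by (intro Min_eqI) auto
      then show "?L (koszul_homotopy f (insert i T)) (a - e i) = ?L (f (insert i T - {i0})) (a - e i + e i0)"
        using kd[of i] le by (auto simp: hom)
    qed
    moreover have "?L (koszul_homotopy (koszul_map m f) T) a = ?L (f T) a - (\<Sum>i\<in>{1..m} - T. ?t i)"
    proof -
      let ?T = "T - {i0}"
      let ?s = "\<lambda>i. if i \<in> ?K (a + e i0) then (-1) ^ position i ?T * ?L (f (insert i ?T)) (a + e i0 - e i) else 0"
      have "?L (koszul_homotopy (koszul_map m f) T) a = ?L (koszul_map m f ?T) (a + e i0)"
        using True le by (auto simp: hom minT)
      also have "\<dots> = (\<Sum>i\<in>{1..m} - ?T. ?s i)" by (rule kos)
      also have "{1..m} - ?T = insert i0 ({1..m} - T)" using i0m by auto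
      also have "(\<Sum>i\<in>insert i0 ({1..m} - T). ?s i) = ?s i0 + (\<Sum>i\<in>{1..m} - T. ?s i)"
        using True by (intro sum.insert) auto
      also have "?s i0 = ?L (f T) a"
        using le True position_eq_0[of ?T i0] by (simp add: keys_add_nat ke insert_absorb)
      also have "(\<Sum>i\<in>{1..m} - T. ?s i) = (\<Sum>i\<in>{1..m} - T. - ?t i)"
      proof (intro sum.cong refl)
        fix i assume i: "i \<in> {1..m} - T"
        show "?s i = - ?t i"
        proof (cases "i \<in> ?K a")
          case iK: True
          have "i0 < i" using le[of i] iK i True by (cases "i = i0") auto
          then have "position i T = Suc (position i ?T)"
            using position_insert[of ?T i0 i] fin(1) True by (simp add: insert_absorb)
          moreover have "insert i ?T = insert i T - {i0}" using i True by auto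
          moreover have "a + e i0 - e i = a - e i + e i0"
          proof -
            have "(a - e i + e i) + e i0 = (a - e i + e i0) + e i" by (simp only: ac_simps)
            then have "a + e i0 = (a - e i + e i0) + e i" unfolding ae[OF iK] .
            then show ?thesis by (simp only: add_diff_cancel_right')
          qed
          ultimately show ?thesis using iK by (simp add: keys_add_nat)
        next
          case False
          then show ?thesis using i True by (auto simp: keys_add_nat ke)
        qed
      qed
      finally show ?thesis by (simp add: sum_negf)
    qed
    ultimately show ?thesis by simp
  next
    \<comment> \<open>Now i0 occurs in the monomial and lies below all of T. Thus h d contributes
      nothing, and in d h only the summand for i0 survives, with sign exponent 0: for another i the
      variable i0 stays in the monomial below \<open>Min (insert i T)\<close>.\<close>
    case False
    then have iK: "i0 \<in> ?K a" using i0 by simp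
    have lt: "i0 < j" if "j \<in> T" for j using le[of j] that False by (cases "j = i0") auto
    have "?L (koszul_homotopy (koszul_map m f) T) a = 0"
    proof (cases "T = {}")
      case False
      then have "\<not> (\<forall>j\<in>?K a. Min T \<le> j)"
        using lt[OF Min_in[OF fin(1)]] iK leD by blast
      then show ?thesis by (simp only: hom) simp
    qed (simp add: hom)
    moreover have "?L (koszul_map m (koszul_homotopy f) T) a = ?L (f T) a"
    proof -
      let ?t = "\<lambda>i. if i \<in> ?K a then (-1) ^ position i T * ?L (koszul_homotopy f (insert i T)) (a - e i) else 0"
      have 0: "?t i = 0" if i: "i \<in> {1..m} - T" "i \<noteq> i0" for i
      proof (cases "i \<in> ?K a")
        case True
        have "i0 < i" using le[of i] True i(2) by simp
        then have "i0 < Min (insert i T)" using lt fin(1) by simp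
        moreover have "i0 \<in> ?K (a - e i)"
          using iK i(2) by (auto simp: in_keys_iff lookup_minus e_def lookup_single when_def)
        ultimately have "\<not> (\<forall>j\<in>?K (a - e i). Min (insert i T) \<le> j)" using leD by blast
        then show ?thesis by (simp only: hom) simp
      qed simp
      have "Min (insert i0 T) = i0" using fin(1) le by (intro Min_eqI) auto
      moreover have "insert i0 T - {i0} = T" using False by auto
      ultimately have t0: "?t i0 = ?L (f T) a"
        using kd[of i0] le iK lt ae[OF iK] position_eq_0[of T i0] by (auto simp: hom less_imp_le)
      have "(\<Sum>i\<in>{1..m} - T. ?t i) = ?t i0 + (\<Sum>i\<in>{1..m} - T - {i0}. ?t i)"
        using i0m False by (intro sum.remove) auto
      also have "(\<Sum>i\<in>{1..m} - T - {i0}. ?t i) = 0"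
        using 0 by (intro sum.neutral ballI) blast
      finally show ?thesis unfolding kos using t0 by simp
    qed
    ultimately show ?thesis by simp
  qed
qed

lemma koszul_homotopy_exact:
  assumes f: "f \<in> carrier (ext_pow m n)"
    and z: "n \<ge> 1 \<Longrightarrow> koszul_map m f = (\<lambda>T. 0)" "n = 0 \<Longrightarrow> Poly_Mapping.lookup (f {}) 0 = 0"
  shows "f = koszul_d m (n + 1) (koszul_homotopy f)"
proof
  fix T
  let ?h = "koszul_homotopy f"
  note h = koszul_homotopy_closed[OF f]
  have g: "koszul_d m (n + 1) ?h \<in> carrier (ext_pow m n)"
    using mod_hom_closed[OF koszul_d_mod_hom h] by simp
  show "f T = koszul_d m (n + 1) ?h T"
  proof (cases "T \<in> subsets_card m n")
    case False
    then show ?thesis using ext_pow_carrierD(2)[OF f] ext_pow_carrierD(2)[OF g] by simp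
  next
    case T: True
    show ?thesis
    proof (rule poly_mapping_eqI)
      fix a
      show "Poly_Mapping.lookup (f T) a = Poly_Mapping.lookup (koszul_d m (n + 1) ?h T) a"
      proof (cases "Poly_Mapping.keys a \<subseteq> {1..m}")
        case False
        then have "a \<notin> Poly_Mapping.keys (f T)" "a \<notin> Poly_Mapping.keys (koszul_d m (n + 1) ?h T)"
          using ext_pow_carrierD(1)[OF f, of T] ext_pow_carrierD(1)[OF g, of T]
          unfolding FF_carrier by blast+
        then show ?thesis by (simp add: in_keys_iff)
      next
        case a: True
        have eq: "koszul_d m (n + 1) ?h = koszul_map m ?h" by (rule koszul_d_eq[OF _ h]) simp
        have h0: "Poly_Mapping.lookup (koszul_homotopy (koszul_map m f) T) a = 0"
        proof (cases "n = 0")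
          case True
          then have "T = {}" using T finite_of_subsets_card[OF T] by simp
          then show ?thesis by (simp add: lookup_koszul_homotopy)
        next
          case False
          then show ?thesis using z(1) by (simp add: lookup_koszul_homotopy)
        qed
        show ?thesis
        proof (cases "T = {} \<and> a = 0")
          \<comment> \<open>The exceptional coefficient: zero on the left by hypothesis, and zero on
            the right because a Koszul boundary has no constant term.\<close>
          case True
          then have "n = 0" using T by simp
          then show ?thesis unfolding eq using True z(2) by (simp add: lookup_koszul_map)
        next
          case False
          then show ?thesis
            unfolding eq using koszul_homotopy_eq[of T m a f] T a h0 by simp
        qed
      qed
    qed
  qed
qed

section \<open>The Koszul complex as a resolution\<close>

lemma koszul_d_koszul_d:
  assumes n: "n \<ge> 2" and f: "f \<in> carrier (ext_pow m n)"
  shows "koszul_d m (n - 1) (koszul_d m n f) = \<zero>\<^bsub>ext_pow m (n - 2)\<^esub>"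
proof -
  have g: "koszul_d m n f \<in> carrier (ext_pow m (n - 1))"
    by (rule mod_hom_closed[OF koszul_d_mod_hom f])
  have "koszul_d m (n - 1) (koszul_d m n f) T = 0" for T
  proof (cases "finite T")
    case True
    have "koszul_d m (n - 1) (koszul_d m n f) = koszul_map m (koszul_map m f)"
    proof -
      have "koszul_d m n f = koszul_map m f" using n by (intro koszul_d_eq[OF _ f]) simp
      moreover have "koszul_d m (n - 1) (koszul_d m n f) = koszul_map m (koszul_d m n f)"
        using n by (intro koszul_d_eq[OF _ g]) auto
      ultimately show ?thesis by simp
    qed
    then show ?thesis using koszul_map_koszul_map[OF True] by simp
  next
    case False
    then have "T \<notin> subsets_card m (n - 1 - 1)" using finite_of_subsets_card by blast
    then show ?thesis
      by (rule ext_pow_carrierD(2)[OF mod_hom_closed[OF koszul_d_mod_hom g]])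
  qed
  then show ?thesis by auto
qed

lemma koszul_chain_complex: "chain_complex (FF m) m (ext_pow m) (koszul_d m)"
  unfolding chain_complex_def
  by (intro conjI allI ballI impI module_ext_pow koszul_d_mod_hom koszul_d_koszul_d) simp_all

lemma lookup_mult_0: "Poly_Mapping.lookup (p * q) 0 = Poly_Mapping.lookup p 0 * Poly_Mapping.lookup q 0"
  for p q :: mpol
proof (induction p rule: poly_mapping_induct_single)
  case (single a c)
  show ?case
  proof (induction q rule: poly_mapping_induct_single)
    case (single b d)
    have "a + b = 0 \<longleftrightarrow> a = 0 \<and> b = 0"
      using keys_add_nat[of a b] by (metis Un_empty keys_eq_empty)
    then show ?case by (auto simp: mult_single lookup_single when_def)
  qed (simp add: distrib_left lookup_add)
qed (simp add: distrib_right lookup_add)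

lemma module_K_module: "Module.module (FF m) K_module"
proof (rule moduleI)
  show "abelian_group K_module"
    by (rule abelian_groupI) (auto simp: K_module_def intro!: exI[of _ "- _"])
qed (auto simp: K_module_def cring_FF lookup_add lookup_mult_0 algebra_simps)

lemma koszul_resolution:
  assumes m: "m \<ge> 1"
  shows "resolution (FF m) m (ext_pow m) (koszul_d m) K_module augmentation"
proof -
  have z: "koszul_map m f = (\<lambda>T. 0)"
    if "f \<in> carrier (ext_pow m n)" "koszul_d m n f = \<zero>\<^bsub>ext_pow m (n - 1)\<^esub>" "n \<ge> 1" for f n
    using koszul_d_eq[OF that(3,1)] that(2) by simp
  have zero: "koszul_d m n \<zero>\<^bsub>ext_pow m n\<^esub> = \<zero>\<^bsub>ext_pow m (n - 1)\<^esub>" for n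
    by (rule additive_map_zero[OF module_abelian_group[OF module_ext_pow]
          module_abelian_group[OF module_ext_pow] mod_hom_additive[OF koszul_d_mod_hom]])
  have aug: "augmentation \<in> mod_hom (FF m) (ext_pow m 0) K_module"
    by (auto simp: mod_hom_def augmentation_def K_module_def lookup_add lookup_mult_0)
  have surj: "augmentation ` carrier (ext_pow m 0) = carrier K_module"
  proof (intro equalityI subsetI)
    fix c :: ratfun
    let ?f = "\<lambda>S :: nat set. if S = {} then pconst c else 0"
    have "?f S \<in> carrier (FF m)" for S
      using pconst_closed[of c m] by (simp add: FF_carrier)
    then have "?f \<in> carrier (ext_pow m 0)"
      unfolding ext_pow_carrier_iff by simp
    then have "augmentation ?f \<in> augmentation ` carrier (ext_pow m 0)" by (rule imageI)
    then show "c \<in> augmentation ` carrier (ext_pow m 0)"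
      by (simp add: augmentation_def pconst_def)
  qed (simp add: K_module_def)
  have ex0: "{f \<in> carrier (ext_pow m 0). augmentation f = \<zero>\<^bsub>K_module\<^esub>} = koszul_d m 1 ` carrier (ext_pow m 1)"
  proof (intro equalityI subsetI)
    fix f assume "f \<in> {f \<in> carrier (ext_pow m 0). augmentation f = \<zero>\<^bsub>K_module\<^esub>}"
    then have f: "f \<in> carrier (ext_pow m 0)" "Poly_Mapping.lookup (f {}) 0 = 0"
      by (simp_all add: augmentation_def K_module_def)
    have "f = koszul_d m (0 + 1) (koszul_homotopy f)"
      using koszul_homotopy_exact[OF f(1)] f(2) by simp
    then show "f \<in> koszul_d m 1 ` carrier (ext_pow m 1)"
      using koszul_homotopy_closed[OF f(1)] by simp
  next
    fix f assume "f \<in> koszul_d m 1 ` carrier (ext_pow m 1)"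
    then obtain g where g: "g \<in> carrier (ext_pow m 1)" "f = koszul_d m 1 g" by blast
    then have "f \<in> carrier (ext_pow m 0)"
      using mod_hom_closed[OF koszul_d_mod_hom g(1)] by simp
    moreover have "f = koszul_map m g" using koszul_d_eq[OF _ g(1)] g(2) by simp
    ultimately show "f \<in> {f \<in> carrier (ext_pow m 0). augmentation f = \<zero>\<^bsub>K_module\<^esub>}"
      by (simp add: augmentation_def K_module_def lookup_koszul_map)
  qed
  have ex: "{f \<in> carrier (ext_pow m n). koszul_d m n f = \<zero>\<^bsub>ext_pow m (n - 1)\<^esub>}
      = koszul_d m (n + 1) ` carrier (ext_pow m (n + 1))" if n: "n \<in> {1..<m}" for n
  proof (intro equalityI subsetI)
    fix f assume "f \<in> {f \<in> carrier (ext_pow m n). koszul_d m n f = \<zero>\<^bsub>ext_pow m (n - 1)\<^esub>}"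
    then have f: "f \<in> carrier (ext_pow m n)" "koszul_map m f = (\<lambda>T. 0)"
      using z n by auto
    have "f = koszul_d m (n + 1) (koszul_homotopy f)"
      using koszul_homotopy_exact[OF f(1)] f(2) n by simp
    then show "f \<in> koszul_d m (n + 1) ` carrier (ext_pow m (n + 1))"
      using koszul_homotopy_closed[OF f(1)] by blast
  next
    fix f assume "f \<in> koszul_d m (n + 1) ` carrier (ext_pow m (n + 1))"
    then obtain g where g: "g \<in> carrier (ext_pow m (n + 1))" "f = koszul_d m (n + 1) g" by blast
    have "koszul_d m n f = \<zero>\<^bsub>ext_pow m (n - 1)\<^esub>"
      using koszul_d_koszul_d[OF _ g(1)] n g(2) by simp
    then show "f \<in> {f \<in> carrier (ext_pow m n). koszul_d m n f = \<zero>\<^bsub>ext_pow m (n - 1)\<^esub>}"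
      using mod_hom_closed[OF koszul_d_mod_hom g(1)] g(2) by simp
  qed
  have inj: "{f \<in> carrier (ext_pow m m). koszul_d m m f = \<zero>\<^bsub>ext_pow m (m - 1)\<^esub>} = {\<zero>\<^bsub>ext_pow m m\<^esub>}"
  proof (intro equalityI subsetI)
    fix f assume "f \<in> {f \<in> carrier (ext_pow m m). koszul_d m m f = \<zero>\<^bsub>ext_pow m (m - 1)\<^esub>}"
    then have f: "f \<in> carrier (ext_pow m m)" "koszul_map m f = (\<lambda>T. 0)"
      using z m by auto
    \<comment> \<open>Injectivity at the top is exactness one step further: a cycle is the boundary
      of its homotopy, which lies in the zero module of degree m + 1.\<close>
    have "T \<notin> subsets_card m (m + 1)" for T
      using card_mono[of "{1..m}" T] by auto
    then have "koszul_homotopy f = \<zero>\<^bsub>ext_pow m (m + 1)\<^esub>"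
      using ext_pow_carrierD(2)[OF koszul_homotopy_closed[OF f(1)]] by (intro ext) simp
    then have "koszul_d m (m + 1) (koszul_homotopy f) = \<zero>\<^bsub>ext_pow m m\<^esub>"
      using zero[of "m + 1"] by simp
    then show "f \<in> {\<zero>\<^bsub>ext_pow m m\<^esub>}"
      using koszul_homotopy_exact[OF f(1)] f(2) m by simp
  next
    fix f assume "f \<in> {\<zero>\<^bsub>ext_pow m m\<^esub>}"
    then show "f \<in> {f \<in> carrier (ext_pow m m). koszul_d m m f = \<zero>\<^bsub>ext_pow m (m - 1)\<^esub>}"
      using zero[of m] by (simp add: ext_pow_carrier_iff FF_carrier)
  qed
  show ?thesis
    unfolding resolution_def
    by (intro conjI ballI koszul_chain_complex module_K_module aug surj ex0 ex inj)
qed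

subsection \<open>The chain isomorphism\<close>

lemma Fract_power: "Fract a 1 ^ n = Fract (a ^ n) 1" for a :: "complex poly"
  by (induction n) (simp_all add: One_fract_def)

lemma Fract_sum: "(\<Sum>i\<in>I. Fract (f i) 1) = Fract (sum f I) 1" for f :: "'i \<Rightarrow> complex poly"
  by (induction I rule: infinite_finite_induct) (simp_all add: Zero_fract_def)

text \<open>As a polynomial in y the quantum integer has constant term 1, contributed by j =
  0.\<close>

lemma qint_nonzero:
  assumes "k \<ge> 1"
  shows "qint k \<noteq> 0"
proof -
  let ?p = "\<Sum>j<k. ([:0, 1:] ^ 2) ^ j :: complex poly"
  have "poly ?p 0 = (\<Sum>j<k. 0 ^ j)" by (simp add: poly_sum)
  also have "\<dots> = 1" using assms by (simp add: sum.remove[of "{..<k}" 0] power_0_left)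
  finally have "?p \<noteq> 0" by (metis poly_0 zero_neq_one)
  moreover have "qint k = Fract ?p 1"
    by (simp add: qint_def yvar_def Fract_power Fract_sum)
  ultimately show ?thesis by (simp add: Zero_fract_def eq_fract)
qed

lemma qfact_nonzero: "qfact k \<noteq> 0"
  by (simp add: qfact_def qint_nonzero)

lemma qfact_0: "qfact 0 = 1"
  by (simp add: qfact_def)

lemma qfact_step: "n \<ge> 1 \<Longrightarrow> qfact n = qfact (n - 1) * qint n"
  by (cases n) (simp_all add: qfact_def)

section \<open>Spans, images and preimages of submodules\<close>

lemma mod_span_superset: "S \<subseteq> mod_span R M S"
  by (auto simp: mod_span_def)

lemma mod_span_minimal: "submodule H R M \<Longrightarrow> S \<subseteq> H \<Longrightarrow> mod_span R M S \<subseteq> H"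
  by (auto simp: mod_span_def)

lemma submodule_finsum:
  assumes M: "Module.module R M" and H: "submodule H R M"
    and "finite I" "\<And>i. i \<in> I \<Longrightarrow> f i \<in> H"
  shows "finsum M f I \<in> H"
proof -
  interpret M: Module.module R M by fact
  interpret H: submodule H R M by fact
  show ?thesis
    using assms(3,4)
  proof (induction I rule: finite_induct)
    case empty
    then show ?case using H.one_closed by simp
  next
    case (insert i I)
    then have "f j \<in> carrier M" if "j \<in> insert i I" for j
      using M.submoduleE(1)[OF H] that by blast
    then show ?case
      using insert M.submoduleE(5)[OF H] by (simp add: Pi_def)
  qed
qed

lemma submodule_image:
  assumes M: "Module.module R M" and N: "Module.module R N" and f: "f \<in> mod_hom R M N"
  shows "submodule (f ` carrier M) R N"
proof -
  interpret M: Module.module R M by fact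
  interpret N: Module.module R N by fact
  note add = mod_hom_additive[OF f]
  show ?thesis
  proof (rule N.submoduleI)
    show "f ` carrier M \<subseteq> carrier N" using mod_hom_closed[OF f] by blast
    show "\<zero>\<^bsub>N\<^esub> \<in> f ` carrier M"
      using additive_map_zero[OF M.abelian_group_axioms N.abelian_group_axioms add]
      by (metis M.zero_closed imageI)
    show "\<ominus>\<^bsub>N\<^esub> a \<in> f ` carrier M" if "a \<in> f ` carrier M" for a
    proof -
      obtain x where x: "x \<in> carrier M" "a = f x" using \<open>a \<in> _\<close> by blast
      show ?thesis
        unfolding x(2) additive_map_minus[OF M.abelian_group_axioms N.abelian_group_axioms add x(1), symmetric]
        using x(1) by simp
    qed
    show "a \<oplus>\<^bsub>N\<^esub> b \<in> f ` carrier M" if "a \<in> f ` carrier M" "b \<in> f ` carrier M" for a b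
    proof -
      obtain x z where x: "x \<in> carrier M" "a = f x" "z \<in> carrier M" "b = f z"
        using \<open>a \<in> _\<close> \<open>b \<in> _\<close> by blast
      show ?thesis
        unfolding x(2,4) additive_map_add[OF add x(1,3), symmetric] using x(1,3) by simp
    qed
    show "r \<odot>\<^bsub>N\<^esub> a \<in> f ` carrier M" if "r \<in> carrier R" "a \<in> f ` carrier M" for r a
    proof -
      obtain x where x: "x \<in> carrier M" "a = f x" using \<open>a \<in> _\<close> by blast
      show ?thesis
        unfolding x(2) mod_hom_smult[OF f that(1) x(1), symmetric] using x(1) that(1) by simp
    qed
  qed
qed

lemma submodule_vimage:
  assumes M: "Module.module R M" and N: "Module.module R N" and f: "f \<in> mod_hom R M N"
    and H: "submodule H R N"
  shows "submodule {x \<in> carrier M. f x \<in> H} R M"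
proof -
  interpret M: Module.module R M by fact
  interpret N: Module.module R N by fact
  note add = mod_hom_additive[OF f]
  have z: "\<zero>\<^bsub>N\<^esub> \<in> H" using submodule_finsum[OF N H, of "{}"] by simp
  show ?thesis
    by (rule M.submoduleI)
      (auto simp: additive_map_zero[OF M.abelian_group_axioms N.abelian_group_axioms add] z
        additive_map_minus[OF M.abelian_group_axioms N.abelian_group_axioms add]
        additive_map_add[OF add] mod_hom_smult[OF f] N.submoduleE(3-5)[OF H])
qed

lemma sorted_words: "S \<in> subsets_card m k \<Longrightarrow> sorted_list_of_set S \<in> words m k"
  using finite_of_subsets_card[of S m k] by (simp add: words_def)

lemma basis_vec_ext_pow: "S \<in> subsets_card m k \<Longrightarrow> basis_vec (FF m) S \<in> carrier (ext_pow m k)"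
  unfolding ext_pow_def by (rule basis_vec_closed[OF cring_FF])

context YB_module
begin

sublocale KT: free_tensor "FF m" FM "subsets_card m k" for k
  by (intro free_tensor.intro free_tensor_axioms.intro module_F_module finite_subsets_card)

abbreviation "KTens k \<equiv> tensor (FF m) FM (ext_pow m k)"

lemma tensor_pair_ext_pow: "tensor_pair (FF m) FM (ext_pow m k)"
  by (intro tensor_pair.intro module_F_module module_ext_pow)

text \<open>\<open>ext_pow\<close> is a constant of its own, whereas the instance \<open>KT\<close>
  speaks of \<open>free_module\<close>; the facts are therefore instantiated or folded to the form
  in which they are used.\<close>

lemmas KTens_closed = tensor_pair.tens_closed[OF tensor_pair_ext_pow]
  and KTens_smult = tensor_pair.tens_smult[OF tensor_pair_ext_pow]
  and KTens_smult_left = tensor_pair.smult_tens[OF tensor_pair_ext_pow]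
  and KTens_abelian_group = tensor_pair.abelian_group_tensor[OF tensor_pair_ext_pow]
  and KTens_mod_hom = tensor_pair.tens_mod_hom[OF tensor_pair_ext_pow]
  and KTens_module = tensor_pair.module_tensor[OF tensor_pair_ext_pow]
  and KTens_basis_eqI = KT.basis_additive_map_eqI[folded ext_pow_def]

lemma koszul_tensor_simps [simp]:
  "carrier (koszul_tensor m M RM k) = carrier (KTens k)"
  "\<zero>\<^bsub>koszul_tensor m M RM k\<^esub> = \<zero>\<^bsub>KTens k\<^esub>"
  "X \<oplus>\<^bsub>koszul_tensor m M RM k\<^esub> Y = X \<oplus>\<^bsub>KTens k\<^esub> Y"
  "c \<odot>\<^bsub>koszul_tensor m M RM k\<^esub> X = pconst c \<odot>\<^bsub>KTens k\<^esub> X"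
  by (simp_all add: koszul_tensor_def restrict_scalars_def)

lemma module_koszul_tensor: "Module.module KK (koszul_tensor m M RM k)"
  unfolding koszul_tensor_def by (rule module_restrict_scalars[OF cring_KK pconst_ring_hom KTens_module])

lemma koszul_tensor_d_KTens: "koszul_tensor_d m M RM n \<in> mod_hom (FF m) (KTens n) (KTens (n - 1))"
  unfolding koszul_tensor_d_def
  by (rule id_tensor_mod_hom[OF module_F_module module_ext_pow module_ext_pow koszul_d_mod_hom])

lemma koszul_tensor_d_tens:
  "x \<in> carrier M \<Longrightarrow> g \<in> carrier (ext_pow m n) \<Longrightarrow>
    koszul_tensor_d m M RM n (Ktens m M RM n x g) = Ktens m M RM (n - 1) x (koszul_d m n g)"
  unfolding koszul_tensor_d_def
  by (rule id_tensor_tens[OF module_F_module module_ext_pow module_ext_pow koszul_d_mod_hom]) simp_all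

lemma koszul_tensor_d_d:
  assumes n: "n \<ge> 2" and X: "X \<in> carrier (KTens n)"
  shows "koszul_tensor_d m M RM (n - 1) (koszul_tensor_d m M RM n X) = \<zero>\<^bsub>KTens (n - 2)\<^esub>"
proof -
  have n2: "n - 1 - 1 = n - 2" by simp
  interpret Z: abelian_group "KTens (n - 2)" by (rule KTens_abelian_group)
  show ?thesis
  proof (rule KTens_basis_eqI[OF KTens_abelian_group _ _ _ X])
    show "additive_map (KTens n) (KTens (n - 2)) (\<lambda>X. koszul_tensor_d m M RM (n - 1) (koszul_tensor_d m M RM n X))"
      using mod_hom_additive[OF mod_hom_comp[OF koszul_tensor_d_KTens[of n] koszul_tensor_d_KTens[of "n - 1"]]]
      unfolding n2 .
    show "additive_map (KTens n) (KTens (n - 2)) (\<lambda>X. \<zero>\<^bsub>KTens (n - 2)\<^esub>)"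
      by (rule additive_mapI) simp_all
    fix x S assume x: "x \<in> carrier FM" and S: "S \<in> subsets_card m n"
    note b = basis_vec_ext_pow[OF S]
    have "koszul_tensor_d m M RM (n - 1) (koszul_tensor_d m M RM n (Ktens m M RM n x (basis_vec (FF m) S)))
        = Ktens m M RM (n - 1 - 1) x (koszul_d m (n - 1) (koszul_d m n (basis_vec (FF m) S)))"
      using x koszul_tensor_d_tens[OF _ b] koszul_tensor_d_tens[OF _ mod_hom_closed[OF koszul_d_mod_hom b]]
      by simp
    also have "\<dots> = Ktens m M RM (n - 2) x \<zero>\<^bsub>ext_pow m (n - 2)\<^esub>"
      unfolding koszul_d_koszul_d[OF n b] n2 ..
    also have "\<dots> = \<zero>\<^bsub>KTens (n - 2)\<^esub>"
      by (rule additive_map_zero[OF module_abelian_group[OF module_ext_pow] KTens_abelian_group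
            mod_hom_additive[OF KTens_mod_hom[OF x]]])
    finally show "koszul_tensor_d m M RM (n - 1) (koszul_tensor_d m M RM n (Ktens m M RM n x (basis_vec (FF m) S)))
        = \<zero>\<^bsub>KTens (n - 2)\<^esub>" .
  qed
qed

lemma koszul_tensor_chain_complex: "chain_complex KK m (koszul_tensor m M RM) (koszul_tensor_d m M RM)"
  unfolding chain_complex_def
proof (intro conjI allI ballI impI)
  show "Module.module KK (koszul_tensor m M RM n)" for n by (rule module_koszul_tensor)
  show "koszul_tensor_d m M RM n \<in> mod_hom KK (koszul_tensor m M RM n) (koszul_tensor m M RM (n - 1))" for n
    unfolding koszul_tensor_def
    by (rule mod_hom_restrict_scalars[OF koszul_tensor_d_KTens pconst_ring_hom])
qed (simp add: koszul_tensor_d_d[simplified])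

definition bracket_map :: "nat \<Rightarrow> nat set \<Rightarrow> 'a \<Rightarrow> ('a \<times> (nat list \<Rightarrow> ratfun) \<Rightarrow>\<^sub>0 int) set"
  where "bracket_map k S x = (1 / qfact k) \<odot>\<^bsub>MV m M k\<^esub> MVtens m M k x (vbracket (sorted_list_of_set S))"

lemma bracket_map_mod_hom:
  assumes "S \<in> subsets_card m k"
  shows "bracket_map k S \<in> mod_hom KK M (MV m M k)"
  unfolding bracket_map_def[abs_def]
  by (intro mod_hom_smult_map[OF MV.module_tensor] tens_left_mod_hom vbracket_closed sorted_words assms) simp

lemma additive_map_FM: "additive_map FM P h \<longleftrightarrow> additive_map M P h" "additive_map Q FM g \<longleftrightarrow> additive_map Q M g"
  by (simp_all add: additive_map_def)

text \<open>The stated formula is prescribed on the basis e_S only. A polynomial coefficient first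
  acts on x through the F-module structure, since M (x) V^k has no such action; this makes the map
  balanced over F.\<close>

definition koszul_iso :: "nat \<Rightarrow> ('a \<times> (nat set \<Rightarrow> mpol) \<Rightarrow>\<^sub>0 int) set \<Rightarrow> ('a \<times> (nat list \<Rightarrow> ratfun) \<Rightarrow>\<^sub>0 int) set"
  where "koszul_iso k = tensor_lift (MV m M k)
    (\<lambda>x g. \<Oplus>\<^bsub>MV m M k\<^esub>S\<in>subsets_card m k. bracket_map k S (g S \<odot>\<^bsub>FM\<^esub> x))"

lemma additive_bracket_map: "S \<in> subsets_card m k \<Longrightarrow> additive_map FM (MV m M k) (bracket_map k S)"
  unfolding additive_map_FM by (rule mod_hom_additive[OF bracket_map_mod_hom])

lemma balanced_koszul_iso: "balanced_map (FF m) FM (ext_pow m k) (MV m M k)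
    (\<lambda>x g. \<Oplus>\<^bsub>MV m M k\<^esub>S\<in>subsets_card m k. bracket_map k S (g S \<odot>\<^bsub>FM\<^esub> x))"
  unfolding ext_pow_def
  by (rule balanced_map_free[OF module_F_module MV.abelian_group_tensor finite_subsets_card additive_bracket_map])

lemma additive_koszul_iso: "additive_map (KTens k) (MV m M k) (koszul_iso k)"
  unfolding koszul_iso_def
  by (rule tensor_pair.additive_tensor_lift[OF tensor_pair_ext_pow MV.abelian_group_tensor balanced_koszul_iso])

lemma koszul_iso_basis:
  assumes x: "x \<in> carrier M" and S: "S \<in> subsets_card m k"
  shows "koszul_iso k (Ktens m M RM k x (basis_vec (FF m) S)) = bracket_map k S x"
proof -
  have x': "x \<in> carrier FM" using x by simp
  have "koszul_iso k (Ktens m M RM k x (basis_vec (FF m) S))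
      = (\<Oplus>\<^bsub>MV m M k\<^esub>S'\<in>subsets_card m k. bracket_map k S' (basis_vec (FF m) S S' \<odot>\<^bsub>FM\<^esub> x))"
    unfolding koszul_iso_def
    by (rule tensor_pair.tensor_lift_tens[OF tensor_pair_ext_pow MV.abelian_group_tensor
          balanced_koszul_iso x' basis_vec_ext_pow[OF S]])
  also have "\<dots> = bracket_map k S x"
    by (rule finsum_basis_vec[OF module_F_module MV.abelian_group_tensor finite_subsets_card
          additive_bracket_map S x'])
  finally show ?thesis .
qed

lemma koszul_iso_mod_hom: "koszul_iso k \<in> mod_hom KK (koszul_tensor m M RM k) (MV m M k)"
proof (rule mod_homI)
  show "additive_map (koszul_tensor m M RM k) (MV m M k) (koszul_iso k)"
    using additive_koszul_iso by (simp add: additive_map_def)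
  fix c X assume c: "c \<in> carrier KK" and "X \<in> carrier (koszul_tensor m M RM k)"
  then have X: "X \<in> carrier (KTens k)" by simp
  have "koszul_iso k (pconst c \<odot>\<^bsub>KTens k\<^esub> X) = c \<odot>\<^bsub>MV m M k\<^esub> koszul_iso k X"
  proof (rule KTens_basis_eqI[OF MV.abelian_group_tensor _ _ _ X])
    show "additive_map (KTens k) (MV m M k) (\<lambda>X. koszul_iso k (pconst c \<odot>\<^bsub>KTens k\<^esub> X))"
      by (rule additive_map_comp[OF tensor_pair.additive_tensor_smult[OF tensor_pair_ext_pow pconst_closed]
            additive_koszul_iso])
    show "additive_map (KTens k) (MV m M k) (\<lambda>X. c \<odot>\<^bsub>MV m M k\<^esub> koszul_iso k X)"
      by (rule additive_map_comp[OF additive_koszul_iso MV.additive_tensor_smult[OF c]])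
    show "koszul_iso k (pconst c \<odot>\<^bsub>KTens k\<^esub> Ktens m M RM k x (basis_vec (FF m) S))
        = c \<odot>\<^bsub>MV m M k\<^esub> koszul_iso k (Ktens m M RM k x (basis_vec (FF m) S))"
      if x: "x \<in> carrier FM" and S: "S \<in> subsets_card m k" for x S
      using x koszul_iso_basis[OF _ S] mod_hom_smult[OF bracket_map_mod_hom[OF S] c]
      by (simp add: KTens_smult_left[OF pconst_closed x basis_vec_ext_pow[OF S]] F_smult_pconst)
  qed
  then show "koszul_iso k (c \<odot>\<^bsub>koszul_tensor m M RM k\<^esub> X) = c \<odot>\<^bsub>MV m M k\<^esub> koszul_iso k X" by simp
qed

lemma koszul_iso_closed: "X \<in> carrier (KTens k) \<Longrightarrow> koszul_iso k X \<in> carrier (MV m M k)"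
  by (rule additive_map_closed[OF additive_koszul_iso])

lemma koszul_iso_pconst:
  assumes x: "x \<in> carrier M" and S: "S \<in> subsets_card m k"
  shows "koszul_iso k (Ktens m M RM k x (\<lambda>T. pconst c * basis_vec (FF m) S T))
    = c \<odot>\<^bsub>MV m M k\<^esub> bracket_map k S x"
proof -
  have "Ktens m M RM k x (pconst c \<odot>\<^bsub>ext_pow m k\<^esub> basis_vec (FF m) S)
      = Ktens m M RM k (pconst c \<odot>\<^bsub>FM\<^esub> x) (basis_vec (FF m) S)"
    using x by (intro KTens_smult[symmetric] pconst_closed basis_vec_ext_pow S) simp
  then show ?thesis
    using koszul_iso_basis[OF _ S, of "c \<odot>\<^bsub>M\<^esub> x"] mod_hom_smult[OF bracket_map_mod_hom[OF S], of c x] x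
    by (simp add: F_smult_pconst)
qed

text \<open>Sorting a word changes the wedge and the bracket by the same sign, the parity of the
  inversions, and both vanish when a letter repeats.\<close>

lemma koszul_iso_ewedge:
  assumes x: "x \<in> carrier M" and w: "w \<in> words m k"
  shows "koszul_iso k (Ktens m M RM k x (ewedge w)) = (1 / qfact k) \<odot>\<^bsub>MV m M k\<^esub> MVtens m M k x (vbracket w)"
proof (cases "distinct w")
  case True
  let ?s = "sorted_list_of_set (set w)" and ?c = "(-1) ^ inversions w :: ratfun"
  have S: "set w \<in> subsets_card m k" using w True by (auto simp: words_def distinct_card)
  have s: "vbracket ?s \<in> carrier (Vpow m k)" by (rule vbracket_closed[OF sorted_words[OF S]])
  have vb: "vbracket w = ?c \<odot>\<^bsub>Vpow m k\<^esub> vbracket ?s"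
    using vbracket_sort[OF True] by simp
  have "MVtens m M k x (vbracket w) = ?c \<odot>\<^bsub>MV m M k\<^esub> MVtens m M k x (vbracket ?s)"
    unfolding vb by (rule mod_hom_smult[OF MV.tens_mod_hom[OF x] _ s]) simp
  moreover have "koszul_iso k (Ktens m M RM k x (ewedge w)) = ?c \<odot>\<^bsub>MV m M k\<^esub> bracket_map k (set w) x"
    using koszul_iso_pconst[OF x S, of ?c] unfolding ewedge_distinct[OF True, of m] sign_eq_pconst[symmetric] .
  moreover have "?c \<odot>\<^bsub>MV m M k\<^esub> ((1 / qfact k) \<odot>\<^bsub>MV m M k\<^esub> MVtens m M k x (vbracket ?s))
      = (1 / qfact k) \<odot>\<^bsub>MV m M k\<^esub> (?c \<odot>\<^bsub>MV m M k\<^esub> MVtens m M k x (vbracket ?s))"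
    using module.smult_assoc1[OF MV.module_tensor, of ?c "1 / qfact k" "MVtens m M k x (vbracket ?s)"]
      module.smult_assoc1[OF MV.module_tensor, of "1 / qfact k" ?c "MVtens m M k x (vbracket ?s)"]
      MV.tens_closed[OF x s] by (simp add: mult.commute)
  ultimately show ?thesis by (simp add: bracket_map_def)
next
  case False
  have "ewedge w = \<zero>\<^bsub>ext_pow m k\<^esub>" "vbracket w = \<zero>\<^bsub>Vpow m k\<^esub>"
    using False vbracket_not_distinct[OF False] by (auto simp: ewedge_def)
  moreover have "Ktens m M RM k x \<zero>\<^bsub>ext_pow m k\<^esub> = \<zero>\<^bsub>KTens k\<^esub>"
    using x by (intro additive_map_zero[OF module_abelian_group[OF module_ext_pow] KTens_abelian_group
        mod_hom_additive[OF KTens_mod_hom]]) simp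
  moreover have "MVtens m M k x \<zero>\<^bsub>Vpow m k\<^esub> = \<zero>\<^bsub>MV m M k\<^esub>"
    by (rule additive_map_zero[OF module_abelian_group[OF module_Vpow] MV.abelian_group_tensor
        mod_hom_additive[OF MV.tens_mod_hom[OF x]]])
  moreover have "koszul_iso k \<zero>\<^bsub>KTens k\<^esub> = \<zero>\<^bsub>MV m M k\<^esub>"
    by (rule additive_map_zero[OF KTens_abelian_group MV.abelian_group_tensor additive_koszul_iso])
  moreover have "(1 / qfact k) \<odot>\<^bsub>MV m M k\<^esub> \<zero>\<^bsub>MV m M k\<^esub> = \<zero>\<^bsub>MV m M k\<^esub>"
    by (rule module.smult_r_null[OF MV.module_tensor]) simp
  ultimately show ?thesis by simp
qed

text \<open>In degree 0 the polynomial passes through the tensor sign to act on x, and [0]! = 1;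
  what remains is the canonical isomorphism.\<close>

lemma koszul_iso_0:
  assumes x: "x \<in> carrier M" and p: "p \<in> carrier (FF m)"
  shows "koszul_iso 0 (Ktens m M RM 0 x (p \<odot>\<^bsub>ext_pow m 0\<^esub> ewedge []))
    = MVtens m M 0 (p \<odot>\<^bsub>FM\<^esub> x) (vtens [])"
proof -
  have S: "{} \<in> subsets_card m 0" by simp
  have e: "ewedge [] = basis_vec (FF m) {}" using ewedge_sorted[of "{}" m] by simp
  have px: "p \<odot>\<^bsub>FM\<^esub> x \<in> carrier M" by (rule F_smult_closed[OF x])
  have "Ktens m M RM 0 x (p \<odot>\<^bsub>ext_pow m 0\<^esub> ewedge []) = Ktens m M RM 0 (p \<odot>\<^bsub>FM\<^esub> x) (basis_vec (FF m) {})"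
    unfolding e using x by (intro KTens_smult[symmetric] p basis_vec_ext_pow S) simp
  moreover have "MVtens m M 0 (p \<odot>\<^bsub>FM\<^esub> x) (vtens []) \<in> carrier (MV m M 0)"
    by (rule MV.tens_closed[OF px vtens_closed]) (simp add: words_def)
  ultimately show ?thesis
    using koszul_iso_basis[OF px S] module.smult_one[OF MV.module_tensor]
    by (simp add: bracket_map_def vbracket_Nil qfact_0)
qed

text \<open>By the duality in \<open>vbracket_sorted\<close> the comparison map is diagonal in these
  coordinates, with the nonzero factor 1/[k]!.\<close>

lemma coord_koszul_iso:
  assumes S': "S' \<in> subsets_card m k" and X: "X \<in> carrier (KTens k)"
  shows "MV.coord (sorted_list_of_set S') (koszul_iso k X) = (1 / qfact k) \<odot>\<^bsub>M\<^esub> KT.coord S' X"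
proof (rule KTens_basis_eqI[OF M.abelian_group_axioms _ _ _ X])
  show "additive_map (KTens k) M (\<lambda>X. MV.coord (sorted_list_of_set S') (koszul_iso k X))"
    by (rule additive_map_comp[OF additive_koszul_iso mod_hom_additive[OF MV.coord_mod_hom]])
  have "additive_map (KTens k) M (KT.coord S')"
    using mod_hom_additive[OF KT.coord_mod_hom[folded ext_pow_def]] unfolding additive_map_FM .
  then show "additive_map (KTens k) M (\<lambda>X. (1 / qfact k) \<odot>\<^bsub>M\<^esub> KT.coord S' X)"
    by (rule additive_map_comp[OF _ additive_map_smult[OF M.module_axioms]]) simp
  fix x S assume "x \<in> carrier FM" and S: "S \<in> subsets_card m k"
  then have x: "x \<in> carrier M" by simp
  have b: "vbracket (sorted_list_of_set S) \<in> carrier (Vpow m k)"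
    by (rule vbracket_closed[OF sorted_words[OF S]])
  have "MV.coord (sorted_list_of_set S') (bracket_map k S x)
      = (1 / qfact k) \<odot>\<^bsub>M\<^esub> MV.coord (sorted_list_of_set S') (MVtens m M k x (vbracket (sorted_list_of_set S)))"
    unfolding bracket_map_def by (rule mod_hom_smult[OF MV.coord_mod_hom _ MV.tens_closed[OF x b]]) simp
  also have "MV.coord (sorted_list_of_set S') (MVtens m M k x (vbracket (sorted_list_of_set S)))
      = (if S = S' then x else \<zero>\<^bsub>M\<^esub>)"
    unfolding MV.coord_tens[OF x b] vbracket_sorted[OF finite_of_subsets_card[OF S] finite_of_subsets_card[OF S']]
    using x by simp
  also have "\<dots> = KT.coord S' (Ktens m M RM k x (basis_vec (FF m) S))"
    unfolding ext_pow_def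
    using KT.coord_tens[of x "basis_vec (FF m) S" k S'] basis_vec_closed[OF cring_FF S] x
      F_smult_pconst[OF x, of 0] F_smult_pconst[OF x, of 1]
    by (auto simp: basis_vec_def pconst_def)
  finally show "MV.coord (sorted_list_of_set S') (koszul_iso k (Ktens m M RM k x (basis_vec (FF m) S)))
      = (1 / qfact k) \<odot>\<^bsub>M\<^esub> KT.coord S' (Ktens m M RM k x (basis_vec (FF m) S))"
    unfolding koszul_iso_basis[OF x S] .
qed

lemma koszul_iso_inj: "inj_on (koszul_iso k) (carrier (KTens k))"
proof (rule inj_onI)
  fix X Y assume X: "X \<in> carrier (KTens k)" and Y: "Y \<in> carrier (KTens k)" and eq: "koszul_iso k X = koszul_iso k Y"
  show "X = Y"
  proof (rule KT.coord_eqI[OF X[unfolded ext_pow_def] Y[unfolded ext_pow_def]])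
    fix S assume S: "S \<in> subsets_card m k"
    have c: "KT.coord S Z \<in> carrier M" if "Z \<in> carrier (KTens k)" for Z
      using KT.coord_closed[folded ext_pow_def, OF that] by simp
    have "qfact k \<odot>\<^bsub>M\<^esub> ((1 / qfact k) \<odot>\<^bsub>M\<^esub> z) = z" if "z \<in> carrier M" for z
      using M.smult_assoc1[of "qfact k" "1 / qfact k" z] that qfact_nonzero by simp
    moreover have "(1 / qfact k) \<odot>\<^bsub>M\<^esub> KT.coord S X = (1 / qfact k) \<odot>\<^bsub>M\<^esub> KT.coord S Y"
      using coord_koszul_iso[OF S X] coord_koszul_iso[OF S Y] eq by simp
    ultimately show "KT.coord S X = KT.coord S Y"
      using c[OF X] c[OF Y] by metis
  qed
qed

lemma koszul_iso_expand:
  assumes X: "X \<in> carrier (KTens k)"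
  shows "koszul_iso k X = (\<Oplus>\<^bsub>MV m M k\<^esub>S\<in>subsets_card m k. bracket_map k S (KT.coord S X))"
proof (rule KTens_basis_eqI[OF MV.abelian_group_tensor additive_koszul_iso _ _ X])
  have "additive_map (KTens k) FM (KT.coord S)" for S
    using mod_hom_additive[OF KT.coord_mod_hom[folded ext_pow_def]] .
  then show "additive_map (KTens k) (MV m M k) (\<lambda>X. \<Oplus>\<^bsub>MV m M k\<^esub>S\<in>subsets_card m k. bracket_map k S (KT.coord S X))"
    by (intro additive_map_finsum_fun[OF MV.abelian_group_tensor finite_subsets_card]
        additive_map_comp[OF _ additive_bracket_map])
  fix x S assume x: "x \<in> carrier FM" and S: "S \<in> subsets_card m k"
  have "koszul_iso k (Ktens m M RM k x (basis_vec (FF m) S)) = bracket_map k S x"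
    using koszul_iso_basis[OF _ S] x by simp
  also have "\<dots> = (\<Oplus>\<^bsub>MV m M k\<^esub>S'\<in>subsets_card m k. bracket_map k S' (basis_vec (FF m) S S' \<odot>\<^bsub>FM\<^esub> x))"
    by (rule finsum_basis_vec[OF module_F_module MV.abelian_group_tensor finite_subsets_card
          additive_bracket_map S x, symmetric])
  also have "\<dots> = (\<Oplus>\<^bsub>MV m M k\<^esub>S'\<in>subsets_card m k.
      bracket_map k S' (KT.coord S' (Ktens m M RM k x (basis_vec (FF m) S))))"
    unfolding ext_pow_def KT.coord_tens[OF x basis_vec_closed[OF cring_FF S]] ..
  finally show "koszul_iso k (Ktens m M RM k x (basis_vec (FF m) S))
    = (\<Oplus>\<^bsub>MV m M k\<^esub>S'\<in>subsets_card m k.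
        bracket_map k S' (KT.coord S' (Ktens m M RM k x (basis_vec (FF m) S))))" .
qed

lemma koszul_iso_image: "koszul_iso k ` carrier (KTens k) = carrier (Cf m M k)"
proof
  let ?G = "{MVtens m M k x u | x u. x \<in> carrier M \<and> u \<in> Vbr m k}"
  have Cf: "carrier (Cf m M k) = mod_span KK (MV m M k) ?G" by (simp add: Cf_def)
  \<comment> \<open>Membership in the span is tested against every subspace H that contains the
    generators.\<close>
  have in_H: "koszul_iso k X \<in> H" if X: "X \<in> carrier (KTens k)" and H: "submodule H KK (MV m M k)" "?G \<subseteq> H" for X H
    unfolding koszul_iso_expand[OF X]
  proof (rule submodule_finsum[OF MV.module_tensor H(1) finite_subsets_card])
    fix S assume S: "S \<in> subsets_card m k"
    have "KT.coord S X \<in> carrier M"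
      using KT.coord_closed[folded ext_pow_def, OF X] by simp
    moreover have "vbracket (sorted_list_of_set S) \<in> Vbr m k"
      unfolding Vbr_def by (rule subsetD[OF mod_span_superset imageI[OF sorted_words[OF S]]])
    ultimately have "MVtens m M k (KT.coord S X) (vbracket (sorted_list_of_set S)) \<in> H"
      using H(2) by blast
    then show "bracket_map k S (KT.coord S X) \<in> H"
      unfolding bracket_map_def by (intro module.submoduleE(4)[OF MV.module_tensor H(1)]) simp_all
  qed
  show "koszul_iso k ` carrier (KTens k) \<subseteq> carrier (Cf m M k)"
    unfolding Cf mod_span_def by (intro image_subsetI InterI) (elim CollectE conjE, rule in_H)
  have sub: "submodule (koszul_iso k ` carrier (KTens k)) KK (MV m M k)"
    using submodule_image[OF module_koszul_tensor MV.module_tensor koszul_iso_mod_hom] by simp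
  have "MVtens m M k x u \<in> koszul_iso k ` carrier (KTens k)" if x: "x \<in> carrier M" and u: "u \<in> Vbr m k" for x u
  proof -
    have "MVtens m M k x (vbracket w) \<in> koszul_iso k ` carrier (KTens k)" if w: "w \<in> words m k" for w
    proof -
      let ?t = "MVtens m M k x (vbracket w)"
      have e: "ewedge w \<in> carrier (ext_pow m k)"
      proof (cases "distinct w")
        case True
        then have "set w \<in> subsets_card m k" using w by (auto simp: words_def distinct_card)
        from module.smult_closed[OF module_ext_pow sign_closed basis_vec_ext_pow[OF this]]
        show ?thesis unfolding ewedge_distinct[OF True, of m] by simp
      next
        case False
        then have "ewedge w = (\<lambda>S. 0)" by (auto simp: ewedge_def)
        then show ?thesis by (simp add: ext_pow_carrier_iff FF_carrier)
      qed
      have "Ktens m M RM k x (ewedge w) \<in> carrier (KTens k)"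
        by (rule KTens_closed[OF _ e]) (simp add: x)
      \<comment> \<open>The image contains the normalized tensor; being a K-subspace, it allows
        multiplication by [k]! to undo the normalization.\<close>
      then have "qfact k \<odot>\<^bsub>MV m M k\<^esub> ((1 / qfact k) \<odot>\<^bsub>MV m M k\<^esub> ?t) \<in> koszul_iso k ` carrier (KTens k)"
        unfolding koszul_iso_ewedge[OF x w, symmetric]
        by (intro module.submoduleE(4)[OF MV.module_tensor sub] imageI) simp_all
      moreover have "qfact k \<odot>\<^bsub>MV m M k\<^esub> ((1 / qfact k) \<odot>\<^bsub>MV m M k\<^esub> ?t) = ?t"
        using module.smult_assoc1[OF MV.module_tensor, of "qfact k" "1 / qfact k" ?t]
          module.smult_one[OF MV.module_tensor, of ?t] MV.tens_closed[OF x vbracket_closed[OF w]]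
          qfact_nonzero by simp
      ultimately show ?thesis by simp
    qed
    \<comment> \<open>For fixed x the vectors u with x (x) u in the image form a subspace;
      containing all brackets, it contains their span.\<close>
    then have "vbracket ` words m k
        \<subseteq> {u \<in> carrier (Vpow m k). MVtens m M k x u \<in> koszul_iso k ` carrier (KTens k)}"
      using vbracket_closed by blast
    from mod_span_minimal[OF submodule_vimage[OF module_Vpow MV.module_tensor MV.tens_mod_hom[OF x] sub] this]
    show ?thesis using u unfolding Vbr_def by blast
  qed
  then have "?G \<subseteq> koszul_iso k ` carrier (KTens k)" by blast
  from mod_span_minimal[OF sub this]
  show "carrier (Cf m M k) \<subseteq> koszul_iso k ` carrier (KTens k)" unfolding Cf .
qed

lemma koszul_iso_koszul_d_basis:
  assumes n: "n \<ge> 1" and x: "x \<in> carrier M" and S: "S \<in> subsets_card m n"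
  shows "koszul_iso (n - 1) (Ktens m M RM (n - 1) x (koszul_d m n (basis_vec (FF m) S)))
    = (\<Oplus>\<^bsub>MV m M (n - 1)\<^esub>j\<in>{..<n}. (1 / qfact (n - 1)) \<odot>\<^bsub>MV m M (n - 1)\<^esub> ((-1) ^ j \<odot>\<^bsub>MV m M (n - 1)\<^esub>
        MVtens m M (n - 1) (act (sorted_list_of_set S ! j) x) (vbracket (delete_nth j (sorted_list_of_set S)))))"
proof -
  let ?s = "sorted_list_of_set S" and ?E = "ext_pow m (n - 1)"
  let ?b = "\<lambda>j. basis_vec (FF m) (S - {?s ! j})"
  let ?p = "\<lambda>j. (-1) ^ j * pvar (?s ! j)"
  have fin: "finite S" "card S = n" using finite_of_subsets_card[OF S] S by simp_all
  have sj: "?s ! j \<in> S" "?s ! j \<in> {1..m}" if "j < n" for j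
    using nth_mem[of j ?s] fin S that by auto
  have Sj: "S - {?s ! j} \<in> subsets_card m (n - 1)" if "j < n" for j
    using S sj[OF that] fin by auto
  have p: "?p j \<in> carrier (FF m)" if "j < n" for j
    by (intro FF_mult_closed sign_closed pvar_closed sj(2)[OF that])
  have pb: "?p j \<odot>\<^bsub>?E\<^esub> ?b j \<in> carrier ?E" if "j < n" for j
    by (rule module.smult_closed[OF module_ext_pow p[OF that] basis_vec_ext_pow[OF Sj[OF that]]])
  \<comment> \<open>The balancing over F moves the variable from the wedge to M, where it becomes
    the action of that basis vector of V.\<close>
  have px: "?p j \<odot>\<^bsub>FM\<^esub> x = (-1) ^ j \<odot>\<^bsub>M\<^esub> act (?s ! j) x" if "j < n" for j
    using F_smult_mult[OF x, of "(-1) ^ j" "pvar (?s ! j)"] F_smult_pvar[OF sj(2)[OF that] x]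
      F_smult_pconst[OF act_closed[OF sj(2)[OF that] x], of "(-1) ^ j"] by (simp flip: sign_eq_pconst)
  have "koszul_d m n (basis_vec (FF m) S) = koszul_basis ?s"
    unfolding koszul_d_def
    by (rule lin_ext_basis_vec[OF module_ext_pow finite_subsets_card koszul_basis_closed S])
  also have "\<dots> = (\<lambda>T. \<Sum>j<n. ?p j * ?b j T)"
    unfolding koszul_basis_def
  proof (intro ext sum.cong)
    show "(-1) ^ j * pvar (?s ! j) * ewedge (delete_nth j ?s) T = ?p j * ?b j T" if "j \<in> {..<n}" for j T
      using delete_nth_sorted[OF fin(1), of j] ewedge_sorted[of "S - {?s ! j}" m] that fin by simp
  qed (use fin in simp)
  also have "\<dots> = (\<Oplus>\<^bsub>?E\<^esub>j\<in>{..<n}. ?p j \<odot>\<^bsub>?E\<^esub> ?b j)"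
    using finsum_ext_pow[of "{..<n}" "\<lambda>j. ?p j \<odot>\<^bsub>?E\<^esub> ?b j" m "n - 1"] pb by simp
  finally have d: "koszul_d m n (basis_vec (FF m) S) = (\<Oplus>\<^bsub>?E\<^esub>j\<in>{..<n}. ?p j \<odot>\<^bsub>?E\<^esub> ?b j)" .
  let ?L = "\<lambda>g. koszul_iso (n - 1) (Ktens m M RM (n - 1) x g)"
  have L: "additive_map ?E (MV m M (n - 1)) ?L"
    using x by (intro additive_map_comp[OF mod_hom_additive[OF KTens_mod_hom] additive_koszul_iso]) simp
  have "?L (koszul_d m n (basis_vec (FF m) S)) = (\<Oplus>\<^bsub>MV m M (n - 1)\<^esub>j\<in>{..<n}. ?L (?p j \<odot>\<^bsub>?E\<^esub> ?b j))"
    unfolding d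
    by (rule additive_map_finsum[OF module_abelian_group[OF module_ext_pow] MV.abelian_group_tensor L])
      (simp_all only: finite_lessThan lessThan_iff pb)
  also have "\<dots> = (\<Oplus>\<^bsub>MV m M (n - 1)\<^esub>j\<in>{..<n}. (1 / qfact (n - 1)) \<odot>\<^bsub>MV m M (n - 1)\<^esub> ((-1) ^ j \<odot>\<^bsub>MV m M (n - 1)\<^esub>
        MVtens m M (n - 1) (act (?s ! j) x) (vbracket (delete_nth j ?s))))"
  proof (rule MV.T.finsum_cong'[OF refl])
    fix j assume "j \<in> {..<n}"
    then have j: "j < n" by simp
    note a = act_closed[OF sj(2)[OF j] x]
    have del: "delete_nth j ?s = sorted_list_of_set (S - {?s ! j})"
      using delete_nth_sorted[OF fin(1), of j] j fin by simp
    have b: "vbracket (delete_nth j ?s) \<in> carrier (Vpow m (n - 1))"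
      unfolding del by (rule vbracket_closed[OF sorted_words[OF Sj[OF j]]])
    have "Ktens m M RM (n - 1) x (?p j \<odot>\<^bsub>?E\<^esub> ?b j) = Ktens m M RM (n - 1) (?p j \<odot>\<^bsub>FM\<^esub> x) (?b j)"
      using x by (intro KTens_smult[symmetric] p[OF j] basis_vec_ext_pow[OF Sj[OF j]]) simp
    then have "?L (?p j \<odot>\<^bsub>?E\<^esub> ?b j) = bracket_map (n - 1) (S - {?s ! j}) ((-1) ^ j \<odot>\<^bsub>M\<^esub> act (?s ! j) x)"
      unfolding px[OF j] using koszul_iso_basis[OF _ Sj[OF j]] a by simp
    also have "\<dots> = (1 / qfact (n - 1)) \<odot>\<^bsub>MV m M (n - 1)\<^esub> ((-1) ^ j \<odot>\<^bsub>MV m M (n - 1)\<^esub>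
        MVtens m M (n - 1) (act (?s ! j) x) (vbracket (delete_nth j ?s)))"
      unfolding bracket_map_def del[symmetric] using MV.smult_tens[OF _ a b, of "(-1) ^ j"] by simp
    finally show "?L (?p j \<odot>\<^bsub>?E\<^esub> ?b j) = \<dots>" .
  next
    show "(\<lambda>j. (1 / qfact (n - 1)) \<odot>\<^bsub>MV m M (n - 1)\<^esub> ((-1) ^ j \<odot>\<^bsub>MV m M (n - 1)\<^esub>
        MVtens m M (n - 1) (act (?s ! j) x) (vbracket (delete_nth j ?s)))) \<in> {..<n} \<rightarrow> carrier (MV m M (n - 1))"
      by (intro Pi_I additive_map_closed[OF MV.additive_tensor_smult] MV.tens_closed act_closed sj(2) x
          vbracket_closed words_delete_nth[OF sorted_words[OF S]]) simp_all
  qed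
  finally show ?thesis .
qed

text \<open>On x (x) e_S both sides are the same Laplace sum over the letters of S; only the scalars
  in front have to be compared.\<close>

lemma koszul_iso_chain_map:
  assumes n: "n \<ge> 1" and X: "X \<in> carrier (KTens n)"
  shows "koszul_iso (n - 1) (koszul_tensor_d m M RM n X) = YB_diff m M RM n (koszul_iso n X)"
proof (rule KTens_basis_eqI[OF MV.abelian_group_tensor _ _ _ X])
  show "additive_map (KTens n) (MV m M (n - 1)) (\<lambda>X. koszul_iso (n - 1) (koszul_tensor_d m M RM n X))"
    by (rule additive_map_comp[OF mod_hom_additive[OF koszul_tensor_d_KTens] additive_koszul_iso])
  show "additive_map (KTens n) (MV m M (n - 1)) (\<lambda>X. YB_diff m M RM n (koszul_iso n X))"
    by (rule additive_map_comp[OF additive_koszul_iso mod_hom_additive[OF YB_diff_mod_hom[OF n]]])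
  fix x S assume "x \<in> carrier FM" and S: "S \<in> subsets_card m n"
  then have x: "x \<in> carrier M" by simp
  let ?s = "sorted_list_of_set S" and ?N = "MV m M (n - 1)"
  let ?t = "\<lambda>j. (-1) ^ j \<odot>\<^bsub>?N\<^esub> MVtens m M (n - 1) (act (?s ! j) x) (vbracket (delete_nth j ?s))"
  note s = sorted_words[OF S]
  have t: "?t j \<in> carrier ?N" if "j < n" for j
    by (intro additive_map_closed[OF MV.additive_tensor_smult] MV.tens_closed act_closed words_nth[OF s that] x
        vbracket_closed words_delete_nth[OF s that]) simp
  then have sum: "(\<Oplus>\<^bsub>?N\<^esub>j\<in>{..<n}. ?t j) \<in> carrier ?N" by (intro MV.T.finsum_closed) simp
  have "koszul_iso (n - 1) (koszul_tensor_d m M RM n (Ktens m M RM n x (basis_vec (FF m) S)))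
      = (\<Oplus>\<^bsub>?N\<^esub>j\<in>{..<n}. (1 / qfact (n - 1)) \<odot>\<^bsub>?N\<^esub> ?t j)"
    unfolding koszul_tensor_d_tens[OF x basis_vec_ext_pow[OF S]] by (rule koszul_iso_koszul_d_basis[OF n x S])
  also have "\<dots> = (1 / qfact (n - 1)) \<odot>\<^bsub>?N\<^esub> (\<Oplus>\<^bsub>?N\<^esub>j\<in>{..<n}. ?t j)"
    using t by (intro module.finsum_smult_ldistr[OF MV.module_tensor, symmetric]) simp_all
  \<comment> \<open>This equation fixes the normalization: passing from degree n to n - 1 must
    absorb the factor [n] that the Yang-Baxter differential produces on brackets.\<close>
  also have "1 / qfact (n - 1) = 1 / qfact n * qint n"
    using qfact_step[OF n] qint_nonzero[OF n] by simp
  also have "(1 / qfact n * qint n) \<odot>\<^bsub>?N\<^esub> (\<Oplus>\<^bsub>?N\<^esub>j\<in>{..<n}. ?t j)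
      = (1 / qfact n) \<odot>\<^bsub>?N\<^esub> (qint n \<odot>\<^bsub>?N\<^esub> (\<Oplus>\<^bsub>?N\<^esub>j\<in>{..<n}. ?t j))"
    using module.smult_assoc1[OF MV.module_tensor _ _ sum, of "1 / qfact n" "qint n"] by simp
  also have "\<dots> = (1 / qfact n) \<odot>\<^bsub>?N\<^esub> YB_diff m M RM n (MVtens m M n x (vbracket ?s))"
    unfolding YB_diff_vbracket[OF n x s] RM_id_vbracket[OF n x s] ..
  also have "\<dots> = YB_diff m M RM n (koszul_iso n (Ktens m M RM n x (basis_vec (FF m) S)))"
    unfolding koszul_iso_basis[OF x S] bracket_map_def
    by (rule mod_hom_smult[OF YB_diff_mod_hom[OF n] _ MV.tens_closed[OF x vbracket_closed[OF s]], symmetric]) simp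
  finally show "koszul_iso (n - 1) (koszul_tensor_d m M RM n (Ktens m M RM n x (basis_vec (FF m) S)))
      = YB_diff m M RM n (koszul_iso n (Ktens m M RM n x (basis_vec (FF m) S)))" .
qed

lemma Cf_simps [simp]:
  "\<zero>\<^bsub>Cf m M k\<^esub> = \<zero>\<^bsub>MV m M k\<^esub>" "X \<oplus>\<^bsub>Cf m M k\<^esub> Y = X \<oplus>\<^bsub>MV m M k\<^esub> Y"
  "c \<odot>\<^bsub>Cf m M k\<^esub> X = c \<odot>\<^bsub>MV m M k\<^esub> X"
  by (simp_all add: Cf_def)

lemma Cf_subset: "carrier (Cf m M k) \<subseteq> carrier (MV m M k)"
  unfolding koszul_iso_image[symmetric] using koszul_iso_closed by blast

lemma Cf_cases:
  assumes "X \<in> carrier (Cf m M k)"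
  obtains Y where "Y \<in> carrier (KTens k)" "X = koszul_iso k Y"
  using assms unfolding koszul_iso_image[symmetric] by blast

text \<open>Every element of C^f is the image of a Koszul tensor, and the comparison map commutes
  with the differentials. Stability under the differential and vanishing of its square are therefore
  inherited from the Koszul side.\<close>

lemma Cf_chain_complex: "chain_complex KK m (Cf m M) (YB_diff m M RM)"
  unfolding chain_complex_def
proof (intro conjI allI ballI impI)
  fix n
  have "submodule (carrier (Cf m M n)) KK (MV m M n)"
    using submodule_image[OF module_koszul_tensor MV.module_tensor koszul_iso_mod_hom] by (simp add: koszul_iso_image)
  from submodule.submodule_is_module[OF this MV.module_tensor]
  show "Module.module KK (Cf m M n)" by (simp add: Cf_def)
next
  fix n assume "n \<in> {1..m}"
  then have n: "n \<ge> 1" by simp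
  have "YB_diff m M RM n X \<in> carrier (Cf m M (n - 1))" if X: "X \<in> carrier (Cf m M n)" for X
  proof -
    obtain Y where Y: "Y \<in> carrier (KTens n)" "X = koszul_iso n Y" using X by (rule Cf_cases)
    show ?thesis
      unfolding Y(2) koszul_iso_chain_map[OF n Y(1), symmetric] koszul_iso_image[symmetric]
      by (rule imageI[OF mod_hom_closed[OF koszul_tensor_d_KTens Y(1)]])
  qed
  moreover have "X \<in> carrier (MV m M n)" if "X \<in> carrier (Cf m M n)" for X
    using Cf_subset that by blast
  ultimately show "YB_diff m M RM n \<in> mod_hom KK (Cf m M n) (Cf m M (n - 1))"
    using additive_map_add[OF mod_hom_additive[OF YB_diff_mod_hom[OF n]]] mod_hom_smult[OF YB_diff_mod_hom[OF n]]
    by (intro mod_homI additive_mapI) simp_all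
next
  fix n X assume n: "n \<in> {2..m}" and "X \<in> carrier (Cf m M n)"
  then obtain Y where Y: "Y \<in> carrier (KTens n)" "X = koszul_iso n Y" by (auto elim: Cf_cases)
  have n1: "n \<ge> 1" "n - 1 \<ge> 1" "n \<ge> 2" "n - 1 - 1 = n - 2" using n by auto
  have "YB_diff m M RM (n - 1) (YB_diff m M RM n X)
      = koszul_iso (n - 2) (koszul_tensor_d m M RM (n - 1) (koszul_tensor_d m M RM n Y))"
    unfolding Y(2) koszul_iso_chain_map[OF n1(1) Y(1), symmetric]
    using koszul_iso_chain_map[OF n1(2) mod_hom_closed[OF koszul_tensor_d_KTens Y(1)]] unfolding n1(4) by simp
  also have "\<dots> = \<zero>\<^bsub>MV m M (n - 2)\<^esub>"
    unfolding koszul_tensor_d_d[OF n1(3) Y(1)]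
    by (rule additive_map_zero[OF KTens_abelian_group MV.abelian_group_tensor additive_koszul_iso])
  finally show "YB_diff m M RM (n - 1) (YB_diff m M RM n X) = \<zero>\<^bsub>Cf m M (n - 2)\<^esub>" by simp
qed

lemma koszul_chain_iso:
  "chain_iso KK m (koszul_tensor m M RM) (koszul_tensor_d m M RM) (Cf m M) (YB_diff m M RM) koszul_iso"
  unfolding chain_iso_def
proof (intro conjI allI ballI impI)
  show "koszul_iso n \<in> mod_hom KK (koszul_tensor m M RM n) (Cf m M n)" for n
    using koszul_iso_mod_hom[of n] koszul_iso_image[of n] by (auto simp: mod_hom_def)
  show "bij_betw (koszul_iso n) (carrier (koszul_tensor m M RM n)) (carrier (Cf m M n))" for n
    using koszul_iso_inj koszul_iso_image by (simp add: bij_betw_def)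
  show "koszul_iso (n - 1) (koszul_tensor_d m M RM n X) = YB_diff m M RM n (koszul_iso n X)"
    if "n \<in> {1..m}" "X \<in> carrier (koszul_tensor m M RM n)" for n X
    using koszul_iso_chain_map[of n X] that by simp
qed

end

theorem theorem3p10:
  fixes m :: nat
    and M :: "(ratfun, 'a) module"
    and RM :: "('a \<times> (nat list \<Rightarrow> ratfun) \<Rightarrow>\<^sub>0 int) set \<Rightarrow> 'a"
  assumes "m \<ge> 1"
    and "V_module m M RM"
  shows "resolution (FF m) m (ext_pow m) (koszul_d m) K_module augmentation
    \<and> chain_complex KK m (koszul_tensor m M RM) (koszul_tensor_d m M RM)
    \<and> chain_complex KK m (Cf m M) (YB_diff m M RM)
    \<and> (\<exists>f. chain_iso KK m (koszul_tensor m M RM) (koszul_tensor_d m M RM)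
               (Cf m M) (YB_diff m M RM) f
         \<and> (\<forall>k\<in>{1..m}. \<forall>x\<in>carrier M. \<forall>w\<in>words m k.
              f k (Ktens m M RM k x (ewedge w))
                = (1 / qfact k) \<odot>\<^bsub>MV m M k\<^esub> MVtens m M k x (vbracket w))
         \<and> (\<forall>x\<in>carrier M. \<forall>p\<in>carrier (FF m).
              f 0 (Ktens m M RM 0 x (p \<odot>\<^bsub>ext_pow m 0\<^esub> ewedge []))
                = MVtens m M 0 (p \<odot>\<^bsub>F_module m M RM\<^esub> x) (vtens [])))"
proof -
  interpret YB_module m M RM using assms(2) by (rule YB_module.intro)
  show ?thesis
    by (intro conjI exI[of _ koszul_iso] ballI koszul_resolution[OF assms(1)] koszul_tensor_chain_complex
        Cf_chain_complex koszul_chain_iso koszul_iso_ewedge koszul_iso_0)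
qed

end
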